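(* Let $K/\mathbb{Q}$ be a Galois extension of degree $d\ge 2$. There exists a normal basis $\beta_1,\dots,\beta_d$ for $K$ over $\mathbb{Q}$ such that $$h(\beta_i)\le \frac{d^{4d}(d^2-d+2)^{4d-3}}{2^{4d-3}}\binom{d-1}{\lfloor (d-1)/2\rfloor}^2 |\Delta_K|^{(d-1)(4d-3)}$$ for all $1\le i\le d$.
   Context: $\Delta_K$ denotes the discriminant of $K$. A normal basis of a Galois extension $K/\mathbb{Q}$ is a $\mathbb{Q}$-basis of $K$ consisting of the Galois conjugates $\sigma(\beta)$, $\sigma\in\mathrm{Gal}(K/\mathbb{Q})$, of a single element $\beta$. The height $h$ is the absolute multiplicative Weil height: for $\alpha\in K$, $h(\alpha)=\prod_{v\in M(K)}\max\{1,|\alpha|_v\}^{d_v/d}$, where $M(K)$ is the set of places of $K$, $d_v=[K_v:\mathbb{Q}_v]$, and $|\cdot|_v$ extends the usual archimedean or $p$-adic absolute value on $\mathbb{Q}$. *)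

theory Defs
  imports
    Complex_Main
    "HOL-Library.FuncSet"
    "HOL-Computational_Algebra.Computational_Algebra"
    "HOL-Algebra.QuotRing"
    "HOL-Algebra.Embedded_Algebras"
    "Jordan_Normal_Form.Determinant"
begin

text \<open>Every field of characteristic 0 is regarded as a vector space over \<open>\<rat>\<close> (scalars of type
  \<^typ>\<open>rat\<close>) and as a module over \<open>\<int>\<close> (scalars of type \<^typ>\<open>int\<close>).\<close>

global_interpretation ratvs:
  Vector_Spaces.vector_space "\<lambda>(q::rat) (x::'a::field_char_0). of_rat q * x"
  by unfold_locales (auto simp: algebra_simps of_rat_add of_rat_mult)

global_interpretation intmod:
  Modules.module "\<lambda>(k::int) (x::'a::field_char_0). of_int k * x"
  by unfold_locales (auto simp: algebra_simps)

definition number_field :: "'a::field_char_0 set \<Rightarrow> bool" where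
  "number_field K \<longleftrightarrow>
     0 \<in> K \<and> 1 \<in> K \<and>
     (\<forall>x\<in>K. \<forall>y\<in>K. x + y \<in> K \<and> x * y \<in> K) \<and>
     (\<forall>x\<in>K. - x \<in> K \<and> inverse x \<in> K) \<and>
     (\<exists>B. finite B \<and> ratvs.span B = K)"

definition field_degree :: "'a::field_char_0 set \<Rightarrow> nat" where
  "field_degree K = ratvs.dim K"

text \<open>Automorphisms are total functions of the ambient type, so they are made \<^const>\<open>extensional\<close>
  in order that each automorphism of \<open>K\<close> is represented exactly once.\<close>

definition galois_group :: "'a::field_char_0 set \<Rightarrow> ('a \<Rightarrow> 'a) set" where
  "galois_group K = {\<sigma> \<in> extensional K. bij_betw \<sigma> K K \<and>
     (\<forall>x\<in>K. \<forall>y\<in>K. \<sigma> (x + y) = \<sigma> x + \<sigma> y \<and> \<sigma> (x * y) = \<sigma> x * \<sigma> y) \<and>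
     (\<forall>q\<in>\<rat>. \<sigma> q = q)}"

definition galois_over_rat :: "'a::field_char_0 set \<Rightarrow> bool" where
  "galois_over_rat K \<longleftrightarrow> number_field K \<and> {x \<in> K. \<forall>\<sigma>\<in>galois_group K. \<sigma> x = x} = \<rat>"

text \<open>The family \<open>b 1, \<dots>, b d\<close>, where \<open>d\<close> is the degree of \<open>K\<close>.\<close>

definition normal_basis :: "'a::field_char_0 set \<Rightarrow> (nat \<Rightarrow> 'a) \<Rightarrow> bool" where
  "normal_basis K b \<longleftrightarrow>
     inj_on b {1..field_degree K} \<and>
     ratvs.independent (b ` {1..field_degree K}) \<and>
     ratvs.span (b ` {1..field_degree K}) = K \<and>
     (\<exists>\<beta>\<in>K. \<exists>s. bij_betw s {1..field_degree K} (galois_group K) \<and>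
        (\<forall>i\<in>{1..field_degree K}. b i = s i \<beta>))"


section \<open>The discriminant\<close>

definition ring_of_integers :: "'a::field_char_0 set \<Rightarrow> 'a set" where
  "ring_of_integers K = {x \<in> K. algebraic_int x}"

definition integral_basis :: "'a::field_char_0 set \<Rightarrow> (nat \<Rightarrow> 'a) \<Rightarrow> bool" where
  "integral_basis K w \<longleftrightarrow>
     inj_on w {..<field_degree K} \<and>
     intmod.independent (w ` {..<field_degree K}) \<and>
     intmod.span (w ` {..<field_degree K}) = ring_of_integers K"

text \<open>The trace of the \<open>\<rat>\<close>-linear map \<open>y \<mapsto> x * y\<close> on \<open>K\<close>; it does not depend on the basis chosen.\<close>

definition field_trace :: "'a::field_char_0 set \<Rightarrow> 'a \<Rightarrow> rat" where
  "field_trace K x =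
     (let B = (SOME B. ratvs.independent B \<and> ratvs.span B = K)
      in \<Sum>b\<in>B. ratvs.representation B (x * b) b)"

text \<open>The value does not depend on the integral basis chosen.\<close>

definition field_discriminant :: "'a::field_char_0 set \<Rightarrow> rat" where
  "field_discriminant K =
     (let w = (SOME w. integral_basis K w); d = field_degree K
      in det (mat d d (\<lambda>(i, j). field_trace K (w i * w j))))"


section \<open>Places and the Weil height\<close>

definition padic_abs :: "nat \<Rightarrow> rat \<Rightarrow> real" where
  "padic_abs p q = (if q = 0 then 0 else
     real p powi (int (multiplicity (int p) (snd (quotient_of q)))
                - int (multiplicity (int p) (fst (quotient_of q)))))"

definition absolute_value_on :: "'a::field set \<Rightarrow> ('a \<Rightarrow> real) \<Rightarrow> bool" where
  "absolute_value_on K v \<longleftrightarrow>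
     (\<forall>x\<in>K. v x \<ge> 0 \<and> (v x = 0 \<longleftrightarrow> x = 0)) \<and>
     (\<forall>x\<in>K. \<forall>y\<in>K. v (x * y) = v x * v y \<and> v (x + y) \<le> v x + v y)"

text \<open>A place is an equivalence class of nontrivial absolute values on \<open>K\<close>.  Each class contains
  exactly one absolute value whose restriction to \<open>\<rat>\<close> is the usual or a \<open>p\<close>-adic absolute value,
  and the place is represented by it.\<close>

definition places :: "'a::field_char_0 set \<Rightarrow> ('a \<Rightarrow> real) set" where
  "places K = {v \<in> extensional K. absolute_value_on K v \<and>
     ((\<forall>q::rat. v (of_rat q) = real_of_rat \<bar>q\<bar>) \<or>
      (\<exists>p. prime p \<and> (\<forall>q::rat. v (of_rat q) = padic_abs p q)))}"

text \<open>The completion \<open>K\<^sub>v\<close> consists of the Cauchy sequences modulo the null sequences, and the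
  completion of \<open>\<rat>\<close> sits in it as the set of classes of rational Cauchy sequences.\<close>

definition cauchy_ring :: "'a::field set \<Rightarrow> ('a \<Rightarrow> real) \<Rightarrow> (nat \<Rightarrow> 'a) ring" where
  "cauchy_ring K v =
     \<lparr>carrier = {s. range s \<subseteq> K \<and> (\<forall>e>0. \<exists>N. \<forall>m\<ge>N. \<forall>n\<ge>N. v (s m - s n) < e)},
      mult = (\<lambda>s t n. s n * t n), one = (\<lambda>n. 1),
      zero = (\<lambda>n. 0), add = (\<lambda>s t n. s n + t n)\<rparr>"

definition null_sequences :: "'a::field set \<Rightarrow> ('a \<Rightarrow> real) \<Rightarrow> (nat \<Rightarrow> 'a) set" where
  "null_sequences K v = {s \<in> carrier (cauchy_ring K v). (\<lambda>n. v (s n)) \<longlonglongrightarrow> 0}"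

definition completion :: "'a::field set \<Rightarrow> ('a \<Rightarrow> real) \<Rightarrow> (nat \<Rightarrow> 'a) set ring" where
  "completion K v = cauchy_ring K v Quot null_sequences K v"

definition completion_rat :: "'a::field_char_0 set \<Rightarrow> ('a \<Rightarrow> real) \<Rightarrow> (nat \<Rightarrow> 'a) set set" where
  "completion_rat K v =
     {null_sequences K v +>\<^bsub>cauchy_ring K v\<^esub> s | s.
        s \<in> carrier (cauchy_ring K v) \<and> range s \<subseteq> \<rat>}"

definition local_degree :: "'a::field_char_0 set \<Rightarrow> ('a \<Rightarrow> real) \<Rightarrow> nat" where
  "local_degree K v =
     ring.dim (completion K v) (completion_rat K v) (carrier (completion K v))"

text \<open>Only finitely many factors of the product over all places differ from 1; the product is
  restricted to these, since \<^const>\<open>prod\<close> is 1 on infinite index sets.\<close>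

definition weil_height :: "'a::field_char_0 set \<Rightarrow> 'a \<Rightarrow> real" where
  "weil_height K x =
     (\<Prod>v | v \<in> places K \<and> max 1 (v x) \<noteq> 1.
        max 1 (v x) powr (real (local_degree K v) / real (field_degree K)))"

end

theory Submission
  imports Defs "Jordan_Normal_Form.Char_Poly"
begin

text \<open>
  Let \<open>G\<close> be the Galois group, \<open>iota : K \<rightarrow> \<complex>\<close> an embedding, and attach to \<open>g \<in> G\<close> the real form
  \<open>L g x = Re (iota (g x)) + Im (iota (g x))\<close>.  On an integral basis these \<open>d\<close> forms have determinant
  \<open>\<plusminus>sqrt \<bar>\<Delta>\<bar>\<close>, so a weak form of Minkowski's theorem on linear forms yields an integer \<open>\<beta> \<noteq> 0\<close> with
  \<open>\<bar>L g \<beta>\<bar> \<le> 1/d\<close> for all \<open>g \<noteq> 1\<close> and \<open>\<bar>L 1 \<beta>\<bar> \<le> M = 4 (2 d)^(d - 1) sqrt \<bar>\<Delta>\<bar>\<close>.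
  Since the norm of \<open>\<beta>\<close> is at least 1 in absolute value, \<open>\<bar>L 1 \<beta>\<bar> > (d - 1)/d\<close>; hence the matrix
  \<open>L (g h) \<beta>\<close> is diagonally dominant up to a permutation and the conjugates of \<open>\<beta>\<close> form a normal basis.

  All conjugates of \<open>\<beta>\<close> are integers of complex absolute value at most \<open>M\<close>.  Every archimedean place has
  the form \<open>\<bar>iota (h x)\<bar>\<close> with \<open>h \<in> G\<close>, so there are at most \<open>d\<close> of them, each of local degree at most 2,
  and the height is at most \<open>M\<^sup>2 = 16 (2 d)^(2 d - 2) \<bar>\<Delta>\<bar>\<close>, far below the stated bound.
\<close>

no_notation fps_nth (infixl "$" 75)
hide_const (open) up_ring.coeff up_ring.monom

section \<open>Linear forms at integral points\<close>

text \<open>The target bound is so generous that every ingredient may lose a constant. The linear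
  forms theorem is a pigeonhole count of integer points modulo an integer lattice, carried over to
  real matrices by rounding \<open>N * A\<close>; the rounding error turns the expected bound 1 into
  2. The bound \<open>1/d\<close> is chosen because \<open>d - 1\<close> such forms add up to at
  most \<open>(d - 1)/d\<close>. The main obstacle is the height: \<open>places K\<close> consists
  of abstract absolute values, and each one extending the usual absolute value has to be recognised
  as an embedding followed by the complex modulus. The small integer itself serves for this: its
  product with its complex conjugate is large at one embedding and its conjugate embedding only, and
  the traces of the powers of that product, being rational, show where such an absolute value is
  large. The local degrees at the archimedean places really add up to \<open>d\<close>; counting up
  to \<open>d\<close> places with degree 2 each at most doubles the exponent, which explains the
  square of \<open>M\<close>.\<close>

lemma mult_mat_vec_index:
  assumes "A \<in> carrier_mat n m" "x \<in> carrier_vec m" "i < n"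
  shows "(A *\<^sub>v x) $ i = (\<Sum>k<m. A $$ (i, k) * x $ k)"
  using assms by (auto simp: scalar_prod_def lessThan_atLeast0 intro!: sum.cong)

text \<open>\<open>insert_index j\<close> lists the indices other than \<open>j\<close> in the order
  in which \<open>mat_delete\<close> keeps them, so a row can be compared with its remainder after
  deletion of column \<open>j\<close>.\<close>

lemma sum_insert_index:
  fixes f :: "nat \<Rightarrow> 'b::comm_monoid_add"
  assumes "j < Suc m"
  shows "(\<Sum>k<Suc m. f k) = f j + (\<Sum>k<m. f (insert_index j k))"
proof -
  have im: "insert_index j ` {..<m} = {..<Suc m} - {j}"
  proof (intro equalityI subsetI)
    fix x assume x: "x \<in> {..<Suc m} - {j}"
    show "x \<in> insert_index j ` {..<m}"
    proof (cases "x < j")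
      case True
      then show ?thesis using assms x by (intro image_eqI[of _ _ x]) (auto simp: insert_index_def)
    next
      case False
      then show ?thesis using assms x by (intro image_eqI[of _ _ "x - 1"]) (auto simp: insert_index_def)
    qed
  qed (auto simp: insert_index_def split: if_splits)
  have inj: "inj_on (insert_index j) {..<m}"
    by (auto simp: inj_on_def insert_index_def split: if_splits)
  have "(\<Sum>k<Suc m. f k) = f j + sum f ({..<Suc m} - {j})"
    using assms by (subst sum.remove[of _ j]) auto
  then show ?thesis by (simp add: im[symmetric] sum.reindex[OF inj])
qed

section \<open>Pigeonhole modulo an integer lattice\<close>

lemma card_residue_class_gt:
  fixes f :: "'b \<Rightarrow> int"
  assumes "finite S" "g > 0" "card S > nat g * D"
  shows "\<exists>r. card {s \<in> S. f s mod g = r} > D"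
proof (rule ccontr)
  assume *: "\<not> ?thesis"
  have "S = (\<Union>r\<in>{0..<g}. {s \<in> S. f s mod g = r})" using assms by auto
  then have "card S \<le> (\<Sum>r\<in>{0..<g}. card {s \<in> S. f s mod g = r})"
    using card_UN_le[of "{0..<g}" "\<lambda>r. {s \<in> S. f s mod g = r}"] by simp
  also have "\<dots> \<le> (\<Sum>r\<in>{0..<g}. D)" using * by (intro sum_mono) (simp add: not_less)
  also have "\<dots> = nat g * D" by simp
  finally show False using assms by simp
qed

text \<open>|det M| is |a| times the determinant of the minor \<open>N\<close>. One residue class of
  first coordinates modulo \<open>a\<close> keeps more than |det N| vectors; multiples of column
  \<open>j\<close> level these coordinates, and the other \<open>m\<close> coordinates are compared
  modulo \<open>N\<close> by \<open>IH\<close>, the hypothesis of the enclosing induction on the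
  dimension.\<close>

lemma congruent_modulo_lattice_single:
  fixes M :: "int mat"
  assumes M: "M \<in> carrier_mat (Suc m) (Suc m)" and det: "det M \<noteq> 0"
    and S: "finite S" "S \<subseteq> carrier_vec (Suc m)" "card S > nat \<bar>det M\<bar>"
    and j: "j < Suc m" and zero: "\<And>k. k < Suc m \<Longrightarrow> k \<noteq> j \<Longrightarrow> M $$ (0, k) = 0"
    and IH: "\<And>N T. N \<in> carrier_mat m m \<Longrightarrow> det N \<noteq> 0 \<Longrightarrow> finite T \<Longrightarrow> T \<subseteq> carrier_vec m \<Longrightarrow>
      card T > nat \<bar>det N\<bar> \<Longrightarrow> \<exists>s\<in>T. \<exists>t\<in>T. s \<noteq> t \<and> (\<exists>x\<in>carrier_vec m. s - t = N *\<^sub>v (x::int vec))"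
  shows "\<exists>s\<in>S. \<exists>t\<in>S. s \<noteq> t \<and> (\<exists>x\<in>carrier_vec (Suc m). s - t = M *\<^sub>v x)"
proof -
  define a where "a = M $$ (0, j)"
  define N where "N = mat_delete M 0 j"
  have N: "N \<in> carrier_mat m m" using M by (auto simp: N_def mat_delete_def)
  have "det M = (\<Sum>k<Suc m. M $$ (0, k) * cofactor M 0 k)"
    by (rule laplace_expansion_row[OF M]) simp
  also have "\<dots> = (\<Sum>k\<in>{j}. M $$ (0, k) * cofactor M 0 k)"
    using j zero by (intro sum.mono_neutral_right) auto
  finally have dM: "det M = a * ((-1) ^ j * det N)" by (simp add: a_def cofactor_def N_def)
  then have absM: "\<bar>det M\<bar> = \<bar>a\<bar> * \<bar>det N\<bar>" by (simp add: abs_mult power_abs)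
  have a0: "a \<noteq> 0" and N0: "det N \<noteq> 0" using dM det by auto
  obtain r where r: "card {s \<in> S. s $ 0 mod \<bar>a\<bar> = r} > nat \<bar>det N\<bar>"
    using card_residue_class_gt[of S "\<bar>a\<bar>" "nat \<bar>det N\<bar>" "\<lambda>s. s $ 0"] S a0 absM
    by (auto simp: nat_mult_distrib)
  define T where "T = {s \<in> S. s $ 0 mod \<bar>a\<bar> = r}"
  \<comment> \<open>The multiple of column \<open>j\<close> that takes the first coordinate of
    \<open>s\<close> down to the common residue \<open>r\<close>.\<close>
  define q where "q s = (s $ 0 - r) div a" for s :: "int vec"
  have q: "s $ 0 = r + q s * a" if "s \<in> T" for s
  proof -
    have "\<bar>a\<bar> dvd s $ 0 - r" using that dvd_minus_mod[of "\<bar>a\<bar>" "s $ 0"] by (simp add: T_def)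
    then show ?thesis by (simp add: q_def)
  qed
  define red where "red s = vec m (\<lambda>i. s $ Suc i - q s * M $$ (Suc i, j))" for s
  \<comment> \<open>Two vectors with the same reduction are already congruent, with
    \<open>x = 0\<close>; if there are none, the image of \<open>T\<close> is as large as
    \<open>T\<close> and \<open>IH\<close> applies.\<close>
  have "\<exists>s\<in>T. \<exists>t\<in>T. s \<noteq> t \<and> (\<exists>x\<in>carrier_vec m. red s - red t = N *\<^sub>v x)"
  proof (cases "inj_on red T")
    case True
    have "\<exists>s\<in>red ` T. \<exists>t\<in>red ` T. s \<noteq> t \<and> (\<exists>x\<in>carrier_vec m. s - t = N *\<^sub>v x)"
    proof (rule IH[OF N N0])
      show "finite (red ` T)" using S by (simp add: T_def)
      show "red ` T \<subseteq> carrier_vec m" by (auto simp: red_def)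
      show "card (red ` T) > nat \<bar>det N\<bar>" using r card_image[OF True] by (simp add: T_def)
    qed
    then obtain s t x where "s \<in> T" "t \<in> T" "red s \<noteq> red t" "x \<in> carrier_vec m"
      "red s - red t = N *\<^sub>v x" by (elim bexE imageE conjE) metis
    then show ?thesis by metis
  next
    case False
    then obtain s t where st: "s \<in> T" "t \<in> T" "s \<noteq> t" "red s = red t" by (auto simp: inj_on_def)
    have "red s - red t = N *\<^sub>v 0\<^sub>v m" using st(4) N
      by (intro eq_vecI) (auto simp: red_def)
    then show ?thesis using st by (meson zero_carrier_vec)
  qed
  then obtain s t x where st: "s \<in> T" "t \<in> T" "s \<noteq> t" and x: "x \<in> carrier_vec m"
    and eq: "red s - red t = N *\<^sub>v x" by blast
  \<comment> \<open>The solution for the minor, with the difference of the subtracted multiples of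
    column \<open>j\<close> put back at position \<open>j\<close>.\<close>
  define y where "y = vec (Suc m) (\<lambda>k. if k = j then q s - q t else x $ delete_index j k)"
  have y: "y \<in> carrier_vec (Suc m)" by (simp add: y_def)
  have yj: "y $ j = q s - q t" using j by (simp add: y_def)
  have yi: "y $ insert_index j k = x $ k" if "k < m" for k
    using that j by (auto simp: y_def insert_index_def delete_index_def)
  have dims: "s \<in> carrier_vec (Suc m)" "t \<in> carrier_vec (Suc m)" using st S by (auto simp: T_def)
  have "s - t = M *\<^sub>v y"
  proof (rule eq_vecI)
    show "dim_vec (s - t) = dim_vec (M *\<^sub>v y)" using dims M by auto
    fix i assume "i < dim_vec (M *\<^sub>v y)"
    then have i: "i < Suc m" using M by auto
    have expand: "(M *\<^sub>v y) $ i = M $$ (i, j) * (q s - q t)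
        + (\<Sum>k<m. M $$ (i, insert_index j k) * x $ k)"
      by (subst mult_mat_vec_index[OF M y i], subst sum_insert_index[OF j]) (simp add: yi yj)
    show "(s - t) $ i = (M *\<^sub>v y) $ i"
    proof (cases i)
      case 0
      have "(\<Sum>k<m. M $$ (i, insert_index j k) * x $ k) = 0"
        using 0 j by (intro sum.neutral) (auto simp: insert_index_def zero)
      then have "(M *\<^sub>v y) $ i = a * (q s - q t)" using expand 0 by (simp add: a_def)
      also have "\<dots> = s $ 0 - t $ 0" by (simp only: q[OF st(1)] q[OF st(2)]) (simp add: algebra_simps)
      finally show ?thesis using 0 dims by simp
    next
      case (Suc l)
      then have l: "l < m" using i by simp
      have "(red s - red t) $ l = (\<Sum>k<m. N $$ (l, k) * x $ k)"
        unfolding eq by (rule mult_mat_vec_index[OF N x l])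
      also have "\<dots> = (\<Sum>k<m. M $$ (i, insert_index j k) * x $ k)"
        using M l j Suc by (intro sum.cong) (auto simp: N_def mat_delete_def insert_index_def)
      finally have "(M *\<^sub>v y) $ i = M $$ (i, j) * (q s - q t) + (red s - red t) $ l"
        using expand by simp
      also have "(red s - red t) $ l = red s $ l - red t $ l" using l by (simp add: red_def)
      also have "\<dots> = (s $ i - q s * M $$ (i, j)) - (t $ i - q t * M $$ (i, j))"
        using l Suc by (simp add: red_def)
      finally have "(M *\<^sub>v y) $ i = s $ i - t $ i" by (simp add: algebra_simps)
      then show ?thesis using i dims by simp
    qed
  qed
  then show ?thesis using st y by (intro bexI[of _ s] bexI[of _ t] conjI bexI[of _ y]) (auto simp: T_def)
qed

text \<open>The index of the lattice \<open>M \<int>\<^sup>n\<close> in \<open>\<int>\<^sup>n\<close> is at most \<open>\<bar>det M\<bar>\<close>: Euclid's algorithm on the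
  first row reduces to the case that it has a single nonzero entry.\<close>

lemma congruent_modulo_lattice:
  fixes M :: "int mat"
  assumes "M \<in> carrier_mat n n" "det M \<noteq> 0"
    and "finite S" "S \<subseteq> carrier_vec n" "card S > nat \<bar>det M\<bar>"
  shows "\<exists>s\<in>S. \<exists>t\<in>S. s \<noteq> t \<and> (\<exists>x\<in>carrier_vec n. s - t = M *\<^sub>v x)"
  using assms
proof (induction n arbitrary: M S)
  case 0
  \<comment> \<open>In dimension 0 there is one vector and the determinant is 1, so \<open>S\<close>
    cannot have more than |det M| elements.\<close>
  have "S \<subseteq> {vNil}" using 0 by (auto intro!: eq_vecI)
  then have "card S \<le> 1" using card_mono[of "{vNil :: int vec}" S] by simp
  then show ?case using 0 by auto
next
  case (Suc m)
  note IH = Suc.IH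
  from Suc.prems show ?case
  proof (induction "\<Sum>j<Suc m. nat \<bar>M $$ (0, j)\<bar>" arbitrary: M rule: less_induct)
    case (less M)
    note M = less.prems(1)
    show ?case
    proof (cases "\<exists>j k. j < Suc m \<and> k < Suc m \<and> j \<noteq> k \<and> M $$ (0, j) \<noteq> 0 \<and> M $$ (0, k) \<noteq> 0")
      case True
      then obtain j k where jk: "j < Suc m" "k < Suc m" "j \<noteq> k" "M $$ (0, k) \<noteq> 0"
        "\<bar>M $$ (0, k)\<bar> \<le> \<bar>M $$ (0, j)\<bar>"
        by (metis linear)
      \<comment> \<open>The sign sets the two entries against each other: the \<open>k\<close> entry
        is nonzero and not the larger one, so the absolute value of the \<open>j\<close> entry drops
        by exactly that of the \<open>k\<close> entry.\<close>
      define a where "a = - sgn (M $$ (0, j)) * sgn (M $$ (0, k))"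
      define M' where "M' = addcol a j k M"
      have M': "M' \<in> carrier_mat (Suc m) (Suc m)" using M by (auto simp: M'_def mat_addcol_def)
      have idx: "M' $$ (0, i) = (if i = j then a * M $$ (0, k) + M $$ (0, j) else M $$ (0, i))"
        if "i < Suc m" for i
        using M that unfolding M'_def mat_addcol_def by auto
      have red: "\<bar>a * M $$ (0, k) + M $$ (0, j)\<bar> < \<bar>M $$ (0, j)\<bar>"
        using jk(4,5) by (auto simp: a_def sgn_if split: if_splits)
      have dec: "(\<Sum>i<Suc m. nat \<bar>M' $$ (0, i)\<bar>) < (\<Sum>i<Suc m. nat \<bar>M $$ (0, i)\<bar>)"
      proof (rule sum_strict_mono_ex1)
        show "\<forall>i\<in>{..<Suc m}. nat \<bar>M' $$ (0, i)\<bar> \<le> nat \<bar>M $$ (0, i)\<bar>" using red idx by auto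
        show "\<exists>i\<in>{..<Suc m}. nat \<bar>M' $$ (0, i)\<bar> < nat \<bar>M $$ (0, i)\<bar>" using red idx jk
          by (intro bexI[of _ j]) auto
      qed simp
      have det': "det M' = det M" unfolding M'_def by (rule det_addcol[OF jk(2,3) M])
      obtain s t x where st: "s \<in> S" "t \<in> S" "s \<noteq> t" "x \<in> carrier_vec (Suc m)" "s - t = M' *\<^sub>v x"
        using less.hyps[OF dec M'] det' less.prems by auto
      \<comment> \<open>A column operation is right multiplication by an integer matrix, so lattice
        points of \<open>M'\<close> are lattice points of \<open>M\<close>.\<close>
      have "M' = M * addrow_mat (Suc m) a k j" unfolding M'_def by (rule addcol_mat[OF M jk(2)])
      then have "s - t = M *\<^sub>v (addrow_mat (Suc m) a k j *\<^sub>v x)"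
        using st M by (simp add: assoc_mult_mat_vec[where n\<^sub>1="Suc m" and n\<^sub>2="Suc m" and n\<^sub>3="Suc m"])
      moreover have "addrow_mat (Suc m) a k j *\<^sub>v x \<in> carrier_vec (Suc m)"
        using st by (intro mult_mat_vec_carrier) auto
      ultimately show ?thesis using st by metis
    next
      case False
      have "\<exists>j<Suc m. \<forall>k<Suc m. k \<noteq> j \<longrightarrow> M $$ (0, k) = 0"
      proof (cases "\<exists>j<Suc m. M $$ (0, j) \<noteq> 0")
        case True then show ?thesis using False by blast
      qed auto
      then obtain j where "j < Suc m" "\<And>k. k < Suc m \<Longrightarrow> k \<noteq> j \<Longrightarrow> M $$ (0, k) = 0" by blast
      then show ?thesis
        by (rule congruent_modulo_lattice_single[OF less.prems _ _ IH])
    qed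
  qed
qed

section \<open>Small values of real linear forms, by rounding\<close>

lemma tendsto_det:
  fixes f :: "nat \<Rightarrow> nat \<Rightarrow> nat \<Rightarrow> real"
  assumes "\<And>i j. i < n \<Longrightarrow> j < n \<Longrightarrow> (\<lambda>N. f N i j) \<longlonglongrightarrow> g i j"
  shows "(\<lambda>N. det (mat n n (\<lambda>(i, j). f N i j))) \<longlonglongrightarrow> det (mat n n (\<lambda>(i, j). g i j))"
proof -
  have eq: "det (mat n n (\<lambda>(i, j). h i j)) =
      (\<Sum>p | p permutes {0..<n}. signof p * (\<Prod>i = 0..<n. h i (p i)))" for h :: "nat \<Rightarrow> nat \<Rightarrow> real"
  proof -
    have "det (mat n n (\<lambda>(i, j). h i j)) = (\<Sum>p | p permutes {0..<n}. signof p *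
        (\<Prod>i = 0..<n. mat n n (\<lambda>(i, j). h i j) $$ (i, p i)))"
      by (subst det_def'[of _ n]) auto
    also have "\<dots> = (\<Sum>p | p permutes {0..<n}. signof p * (\<Prod>i = 0..<n. h i (p i)))"
      by (intro sum.cong prod.cong arg_cong2[of _ _ _ _ "(*)"] refl)
        (auto simp: permutes_in_image dest: permutes_in_image)
    finally show ?thesis .
  qed
  show ?thesis unfolding eq
    by (intro tendsto_sum tendsto_mult tendsto_const tendsto_prod assms)
      (auto simp: permutes_in_image dest: permutes_in_image)
qed

text \<open>The adjugate recovers \<open>det A\<close> times each coordinate from the forms. The
  constant depends on \<open>A\<close> alone; it controls the rounding error in the next lemma and
  later bounds rational coordinates by conjugates.\<close>

lemma sum_norm_le_mult_linear_forms:
  fixes A :: "'b::real_normed_field mat"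
  assumes A: "A \<in> carrier_mat n n" and det: "det A \<noteq> 0"
  shows "\<exists>C>0. \<forall>x. (\<Sum>k<n. norm (x k)) \<le> C * (\<Sum>i<n. norm (\<Sum>k<n. A $$ (i, k) * x k))"
proof -
  define B where "B = adj_mat A"
  have B: "B \<in> carrier_mat n n" and BA: "B * A = det A \<cdot>\<^sub>m 1\<^sub>m n" using adj_mat[OF A] by (auto simp: B_def)
  define C where "C = (\<Sum>k<n. \<Sum>i<n. norm (B $$ (k, i))) / norm (det A)"
  have C: "C \<ge> 0" by (auto simp: C_def intro!: divide_nonneg_nonneg sum_nonneg)
  have main: "(\<Sum>k<n. norm (x k)) \<le> C * (\<Sum>i<n. norm (\<Sum>k<n. A $$ (i, k) * x k))" for x
  proof -
    define L where "L i = (\<Sum>k<n. A $$ (i, k) * x k)" for i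
    define Y where "Y = (\<Sum>i<n. norm (L i))"
    have Y: "norm (L i) \<le> Y" if "i < n" for i using that unfolding Y_def
      by (intro member_le_sum) auto
    have xk: "norm (x k) \<le> (\<Sum>i<n. norm (B $$ (k, i))) * Y / norm (det A)" if k: "k < n" for k
    proof -
      have "(\<Sum>i<n. B $$ (k, i) * L i) = (\<Sum>l<n. (\<Sum>i<n. B $$ (k, i) * A $$ (i, l)) * x l)"
        unfolding L_def by (simp add: sum_distrib_left sum_distrib_right mult.assoc) (rule sum.swap)
      also have "\<dots> = (\<Sum>l<n. (if l = k then det A else 0) * x l)"
      proof (intro sum.cong refl arg_cong2[of _ _ _ _ "(*)"])
        fix l assume "l \<in> {..<n}"
        then have l: "l < n" by simp
        have "(\<Sum>i<n. B $$ (k, i) * A $$ (i, l)) = (B * A) $$ (k, l)"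
          using A B k l by (auto simp: scalar_prod_def lessThan_atLeast0 intro!: sum.cong)
        also have "\<dots> = (if l = k then det A else 0)" unfolding BA using k l by simp
        finally show "(\<Sum>i<n. B $$ (k, i) * A $$ (i, l)) = (if l = k then det A else 0)" .
      qed
      also have "\<dots> = det A * x k" using k by (simp add: if_distrib[of "\<lambda>a. a * _"] cong: if_cong)
      finally have "norm (det A) * norm (x k) = norm (\<Sum>i<n. B $$ (k, i) * L i)"
        by (simp add: norm_mult)
      also have "\<dots> \<le> (\<Sum>i<n. norm (B $$ (k, i)) * Y)"
        by (intro sum_norm_le) (auto simp: norm_mult intro!: mult_left_mono Y)
      also have "\<dots> = (\<Sum>i<n. norm (B $$ (k, i))) * Y" by (simp add: sum_distrib_right)
      finally show ?thesis using det by (simp add: field_simps)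
    qed
    have "(\<Sum>k<n. norm (x k)) \<le> (\<Sum>k<n. (\<Sum>i<n. norm (B $$ (k, i))) * Y / norm (det A))"
      using xk by (intro sum_mono) auto
    also have "\<dots> = C * Y" by (simp add: C_def sum_divide_distrib sum_distrib_right)
    finally show ?thesis by (simp add: Y_def L_def)
  qed
  have nn: "(\<Sum>i<n. norm (\<Sum>k<n. A $$ (i, k) * x k)) \<ge> 0" for x :: "nat \<Rightarrow> 'b"
    by (intro sum_nonneg) auto
  show ?thesis
  \<comment> \<open>\<open>C\<close> is 0 when \<open>n = 0\<close>; adding 1 makes the constant
    positive.\<close>
  proof (intro exI[of _ "C + 1"] conjI allI)
    show "C + 1 > 0" using C by simp
    fix x
    show "(\<Sum>k<n. norm (x k)) \<le> (C + 1) * (\<Sum>i<n. norm (\<Sum>k<n. A $$ (i, k) * x k))"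
      using main[of x] nn[of x] by (simp add: distrib_right)
  qed
qed

text \<open>For large \<open>N\<close> the rounded matrix \<open>M N\<close> has determinant below
  \<open>N ^ n\<close>, the number of integer points in a box of side \<open>N\<close>. Two of these
  points differ by \<open>M N\<close> applied to a nonzero integer vector, and at that vector each
  form is at most 1 plus a rounding error \<open>X / N\<close>, where \<open>X\<close> is the sum of
  the absolute values of the entries.\<close>

lemma exists_int_vec_small_linear_forms:
  fixes A :: "real mat"
  assumes A: "A \<in> carrier_mat n n" and det: "det A \<noteq> 0" "\<bar>det A\<bar> < 1"
  shows "\<exists>x::nat \<Rightarrow> int. (\<exists>k<n. x k \<noteq> 0) \<and> (\<forall>i<n. \<bar>\<Sum>k<n. A $$ (i, k) * of_int (x k)\<bar> \<le> 2)"
proof -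
  obtain C where C: "C > 0" and bnd: "\<And>x. (\<Sum>k<n. norm (x k)) \<le> C * (\<Sum>i<n. norm (\<Sum>k<n. A $$ (i, k) * x k))"
    using sum_norm_le_mult_linear_forms[OF A det(1)] by blast
  define M where "M N = mat n n (\<lambda>(i, j). \<lfloor>real N * A $$ (i, j)\<rfloor>)" for N :: nat
  have M: "M N \<in> carrier_mat n n" for N by (simp add: M_def)
  define f where "f N i j = real_of_int \<lfloor>real N * A $$ (i, j)\<rfloor> / real N" for N i j
  have lim: "(\<lambda>N. f N i j) \<longlonglongrightarrow> A $$ (i, j)" for i j
  proof -
    have "\<bar>f N i j - A $$ (i, j)\<bar> \<le> 1 / real N" if "N > 0" for N
    proof -
      have "\<bar>real_of_int \<lfloor>real N * A $$ (i, j)\<rfloor> - real N * A $$ (i, j)\<bar> \<le> 1" by linarith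
      moreover have "f N i j - A $$ (i, j) = (\<lfloor>real N * A $$ (i, j)\<rfloor> - real N * A $$ (i, j)) / real N"
        using that by (simp add: f_def field_simps)
      ultimately show ?thesis using that by (simp add: divide_right_mono)
    qed
    then have "\<forall>\<^sub>F N in sequentially. norm (f N i j - A $$ (i, j)) \<le> norm (1 / real N) * 1"
      by (auto simp: eventually_sequentially intro!: exI[of _ 1])
    then have "(\<lambda>N. f N i j - A $$ (i, j)) \<longlonglongrightarrow> 0"
      by (rule tendsto_0_le[OF lim_1_over_n])
    then show ?thesis by (simp add: LIM_zero_iff)
  qed
  have "(\<lambda>N. det (mat n n (\<lambda>(i, j). f N i j))) \<longlonglongrightarrow> det (mat n n (\<lambda>(i, j). A $$ (i, j)))"
    by (rule tendsto_det) (rule lim)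
  moreover have "mat n n (\<lambda>(i, j). A $$ (i, j)) = A" using A by (intro eq_matI) auto
  ultimately have lim2: "(\<lambda>N. \<bar>det (mat n n (\<lambda>(i, j). f N i j))\<bar>) \<longlonglongrightarrow> \<bar>det A\<bar>"
    using tendsto_rabs by force
  have ev: "\<forall>\<^sub>F N in sequentially. \<bar>det (mat n n (\<lambda>(i, j). f N i j))\<bar> < 1"
    "\<forall>\<^sub>F N in sequentially. 0 < \<bar>det (mat n n (\<lambda>(i, j). f N i j))\<bar>"
    using order_tendstoD(2)[OF lim2 det(2)] order_tendstoD(1)[OF lim2, of 0] det(1) by simp_all
  \<comment> \<open>The three conditions make the box large enough, keep the rounded matrix
    nonsingular, and keep the rounding error under control.\<close>
  have "\<forall>\<^sub>F N in sequentially. \<bar>det (mat n n (\<lambda>(i, j). f N i j))\<bar> < 1 \<and>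
      0 < \<bar>det (mat n n (\<lambda>(i, j). f N i j))\<bar> \<and> N > nat \<lceil>2 * real n * C\<rceil>"
    by (intro eventually_conj ev eventually_gt_at_top)
  then obtain N where N: "\<bar>det (mat n n (\<lambda>(i, j). f N i j))\<bar> < 1"
      "0 < \<bar>det (mat n n (\<lambda>(i, j). f N i j))\<bar>" "N > nat \<lceil>2 * real n * C\<rceil>"
    using eventually_happens'[OF sequentially_bot] by blast
  have N0: "N > 0" and NC: "real N \<ge> 2 * real n * C" using N(3) by linarith+
  have "map_mat real_of_int (M N) = real N \<cdot>\<^sub>m mat n n (\<lambda>(i, j). f N i j)"
    using N0 by (intro eq_matI) (auto simp: M_def f_def)
  then have "det (map_mat real_of_int (M N)) = real N ^ n * det (mat n n (\<lambda>(i, j). f N i j))"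
    by simp
  then have detM: "real_of_int (det (M N)) = real N ^ n * det (mat n n (\<lambda>(i, j). f N i j))"
    by (simp add: of_int_hom.hom_det)
  have M0: "det (M N) \<noteq> 0" using N(2) N0 detM by auto
  have "real_of_int \<bar>det (M N)\<bar> < real N ^ n"
    using N(1) N0 by (simp add: detM abs_mult)
  then have Mlt: "nat \<bar>det (M N)\<bar> < N ^ n"
    by (metis (no_types, lifting) abs_ge_zero of_int_less_iff of_int_of_nat_eq of_nat_power nat_less_iff)
  define P where "P = PiE {..<n} (\<lambda>_. {0..<int N})"
  define S where "S = vec n ` P"
  have "inj_on (vec n) P"
  proof (rule inj_onI)
    fix u w assume uw: "u \<in> P" "w \<in> P" "vec n u = vec n w"
    show "u = w"
    proof (rule PiE_ext)
      show "u \<in> PiE {..<n} (\<lambda>_. {0..<int N})" "w \<in> PiE {..<n} (\<lambda>_. {0..<int N})" using uw by (auto simp: P_def)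
      fix k assume "k \<in> {..<n}"
      then show "u k = w k" using uw(3) by (metis index_vec lessThan_iff)
    qed
  qed
  then have "card S = N ^ n" by (simp add: S_def card_image P_def card_PiE)
  moreover have "finite S" by (auto simp: S_def P_def intro!: finite_PiE)
  moreover have "S \<subseteq> carrier_vec n" by (auto simp: S_def)
  ultimately obtain s t y where st: "s \<in> S" "t \<in> S" "s \<noteq> t" and y: "y \<in> carrier_vec n"
      and eq: "s - t = M N *\<^sub>v y"
    using congruent_modulo_lattice[OF M M0, of S] Mlt by auto
  have dims: "s \<in> carrier_vec n" "t \<in> carrier_vec n" using st by (auto simp: S_def)
  define x where "x k = y $ k" for k
  have nz: "\<exists>k<n. x k \<noteq> 0"
  proof (rule ccontr)
    assume "\<not> ?thesis"
    then have y0: "y = 0\<^sub>v n" using y by (intro eq_vecI) (auto simp: x_def)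
    have z: "s - t = 0\<^sub>v n" unfolding eq y0 using M[of N] by (intro eq_vecI) auto
    have "s = t"
    proof (rule eq_vecI)
      fix i assume i: "i < dim_vec t"
      then have "(s - t) $ i = 0" using z dims by auto
      then show "s $ i = t $ i" using i dims by simp
    qed (use dims in auto)
    then show False using st by simp
  qed
  define L where "L i = (\<Sum>k<n. A $$ (i, k) * of_int (x k))" for i
  define X where "X = (\<Sum>k<n. \<bar>real_of_int (x k)\<bar>)"
  define Y where "Y = (\<Sum>i<n. \<bar>L i\<bar>)"
  have XY: "X \<le> C * Y" using bnd[of "\<lambda>k. of_int (x k)"] by (simp add: X_def Y_def L_def)
  have L: "\<bar>L i\<bar> \<le> 1 + X / N" if i: "i < n" for i
  proof -
    have "0 \<le> u $ i \<and> u $ i < int N" if "u \<in> S" for u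
    proof -
      obtain f where f: "f \<in> P" "u = vec n f" using \<open>u \<in> S\<close> by (auto simp: S_def)
      then have "f i \<in> {0..<int N}" using i unfolding P_def by (meson PiE_mem lessThan_iff)
      then show ?thesis using f i by simp
    qed
    then have st_i: "0 \<le> s $ i" "s $ i < int N" "0 \<le> t $ i" "t $ i < int N" using st by auto
    have "(\<Sum>k<n. M N $$ (i, k) * x k) = s $ i - t $ i"
      using mult_mat_vec_index[OF M[of N] y i] dims i unfolding eq[symmetric] x_def by simp
    then have "\<bar>\<Sum>k<n. M N $$ (i, k) * x k\<bar> \<le> int N" using st_i by linarith
    then have *: "\<bar>\<Sum>k<n. real_of_int (M N $$ (i, k)) * of_int (x k)\<bar> \<le> real N"
      unfolding of_int_mult[symmetric] of_int_sum[symmetric] of_int_abs[symmetric] by linarith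
    have "real N * L i - (\<Sum>k<n. real_of_int (M N $$ (i, k)) * of_int (x k)) =
        (\<Sum>k<n. (real N * A $$ (i, k) - \<lfloor>real N * A $$ (i, k)\<rfloor>) * of_int (x k))"
      using i by (simp add: L_def sum_distrib_left sum_subtractf[symmetric] M_def algebra_simps)
    also have "\<bar>\<dots>\<bar> \<le> (\<Sum>k<n. 1 * \<bar>of_int (x k)\<bar>)"
    proof (intro order_trans[OF sum_abs] sum_mono)
      fix k
      have "\<bar>real N * A $$ (i, k) - \<lfloor>real N * A $$ (i, k)\<rfloor>\<bar> \<le> 1" by linarith
      then show "\<bar>(real N * A $$ (i, k) - \<lfloor>real N * A $$ (i, k)\<rfloor>) * of_int (x k)\<bar> \<le> 1 * \<bar>of_int (x k)\<bar>"
        unfolding abs_mult by (intro mult_right_mono) auto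
    qed
    also have "\<dots> = X" by (simp add: X_def)
    finally have "\<bar>real N * L i\<bar> \<le> real N + X" using * by linarith
    then have "real N * \<bar>L i\<bar> \<le> real N + X" by (simp add: abs_mult)
    then show ?thesis using N0 by (simp add: field_simps)
  qed
  \<comment> \<open>The forms are bounded through \<open>X\<close> and \<open>X\<close> through the
    forms. As \<open>N\<close> is at least \<open>2 * n * C\<close>, the error amounts to at most
    half of \<open>Y\<close> and can be absorbed, which gives first \<open>Y \<le> 2 * n\<close> and
    then \<open>X \<le> N\<close>.\<close>
  have "Y \<le> (\<Sum>i<n. 1 + X / N)" unfolding Y_def using L by (intro sum_mono) auto
  also have "\<dots> = n + n * X / N" by (simp add: field_simps)
  finally have "Y \<le> n + n * X / N" .
  moreover have "n * X / N \<le> Y / 2"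
  proof -
    have Y0: "Y \<ge> 0" by (auto simp: Y_def intro: sum_nonneg)
    have "2 * (n * X) \<le> 2 * n * (C * Y)" using XY by (simp add: mult_left_mono)
    also have "\<dots> \<le> N * Y" using mult_right_mono[OF NC Y0] by (simp add: mult_ac)
    finally show ?thesis using N0 by (simp add: field_simps)
  qed
  ultimately have Y2: "Y \<le> 2 * n" by linarith
  have "X \<le> N"
  proof -
    have "X \<le> C * (2 * n)" using XY mult_left_mono[OF Y2, of C] C by linarith
    then show ?thesis using NC by (simp add: mult_ac)
  qed
  then have "X / N \<le> 1" using N0 by (simp add: field_simps)
  then have "\<forall>i<n. \<bar>L i\<bar> \<le> 2" using L by fastforce
  then show ?thesis using nz by (auto simp: L_def)
qed

section \<open>Algebraic integers\<close>

text \<open>Coordinates are attached to indices, so repetitions in the family do no harm. The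
  setting of a module yields the statement for rational and for integer scalars at once.\<close>

lemma (in Modules.module) span_image_finite:
  assumes "finite I"
  shows "span (v ` I) = range (\<lambda>c. \<Sum>i\<in>I. scale (c i) (v i))"
proof (intro equalityI)
  have "subspace (range (\<lambda>c. \<Sum>i\<in>I. scale (c i) (v i)))"
    unfolding subspace_def
  proof (intro conjI ballI allI)
    show "0 \<in> range (\<lambda>c. \<Sum>i\<in>I. scale (c i) (v i))"
      by (rule image_eqI[of _ _ "\<lambda>_. 0"]) auto
    fix x y c assume "x \<in> range (\<lambda>c. \<Sum>i\<in>I. scale (c i) (v i))" "y \<in> range (\<lambda>c. \<Sum>i\<in>I. scale (c i) (v i))"
    then obtain a b where ab: "x = (\<Sum>i\<in>I. scale (a i) (v i))" "y = (\<Sum>i\<in>I. scale (b i) (v i))" by blast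
    show "x + y \<in> range (\<lambda>c. \<Sum>i\<in>I. scale (c i) (v i))"
      by (rule image_eqI[of _ _ "\<lambda>i. a i + b i"]) (auto simp: ab scale_left_distrib sum.distrib)
  next
    fix x c assume "x \<in> range (\<lambda>c. \<Sum>i\<in>I. scale (c i) (v i))"
    then obtain a where a: "x = (\<Sum>i\<in>I. scale (a i) (v i))" by blast
    show "scale c x \<in> range (\<lambda>c. \<Sum>i\<in>I. scale (c i) (v i))"
      by (rule image_eqI[of _ _ "\<lambda>i. c * a i"]) (auto simp: a scale_sum_right)
  qed
  moreover have "v j \<in> range (\<lambda>c. \<Sum>i\<in>I. scale (c i) (v i))" if "j \<in> I" for j
  proof (rule image_eqI[of _ _ "\<lambda>i. if i = j then 1 else 0"])
    have "(\<Sum>i\<in>I. scale (if i = j then 1 else 0) (v i)) = (\<Sum>i\<in>I. if i = j then v i else 0)"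
      by (intro sum.cong) auto
    then show "v j = (\<Sum>i\<in>I. scale (if i = j then 1 else 0) (v i))"
      using that assms by simp
  qed simp
  ultimately show "span (v ` I) \<subseteq> range (\<lambda>c. \<Sum>i\<in>I. scale (c i) (v i))"
    by (intro span_minimal) auto
  show "range (\<lambda>c. \<Sum>i\<in>I. scale (c i) (v i)) \<subseteq> span (v ` I)"
    by (rule image_subsetI) (intro span_sum span_scale span_base imageI)
qed

lemma (in Modules.module) independent_imageD:
  assumes "independent (v ` I)" "inj_on v I" "finite I" "(\<Sum>i\<in>I. scale (c i) (v i)) = 0" "i \<in> I"
  shows "c i = 0"
proof -
  have "(\<Sum>x\<in>v ` I. scale (c (the_inv_into I v x)) x) = 0"
    using assms by (subst sum.reindex) (auto simp: the_inv_into_f_f)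
  then have "c (the_inv_into I v (v i)) = 0"
    using assms by (intro independentD[OF assms(1), of "v ` I"]) auto
  then show ?thesis using assms by (simp add: the_inv_into_f_f)
qed

lemma (in Modules.module) independent_imageI:
  assumes "inj_on v I" "finite I"
    and "\<And>c i. (\<Sum>i\<in>I. scale (c i) (v i)) = 0 \<Longrightarrow> i \<in> I \<Longrightarrow> c i = 0"
  shows "independent (v ` I)"
  unfolding independent_explicit_module
proof (intro allI impI)
  fix t u x assume t: "finite t" "t \<subseteq> v ` I" "(\<Sum>v\<in>t. scale (u v) v) = 0" "x \<in> t"
  define c where "c i = (if v i \<in> t then u (v i) else 0)" for i
  have "(\<Sum>i\<in>I. scale (c i) (v i)) = (\<Sum>x\<in>v ` I. scale (if x \<in> t then u x else 0) x)"
    using assms(1) by (simp add: sum.reindex c_def)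
  also have "\<dots> = (\<Sum>x\<in>t. scale (if x \<in> t then u x else 0) x)"
    using t assms(2) by (intro sum.mono_neutral_right) auto
  also have "\<dots> = 0" using t(3) by simp
  finally have z: "(\<Sum>i\<in>I. scale (c i) (v i)) = 0" .
  obtain i where "i \<in> I" "x = v i" using t by blast
  then show "u x = 0" using assms(3)[OF z, of i] t(4) by (simp add: c_def)
qed

lemma (in Modules.module) inj_on_if_independent_family:
  assumes "finite I" "\<And>c i. (\<Sum>i\<in>I. scale (c i) (v i)) = 0 \<Longrightarrow> i \<in> I \<Longrightarrow> c i = 0" "(1::'a) \<noteq> 0"
  shows "inj_on v I"
proof (rule inj_onI, rule ccontr)
  fix i j assume ij: "i \<in> I" "j \<in> I" "v i = v j" "i \<noteq> j"
  define c where "c k = (if k = i then 1 else if k = j then - 1 else 0 :: 'a)" for k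
  have "(\<Sum>k\<in>I. scale (c k) (v k)) = (\<Sum>k\<in>{i, j}. scale (c k) (v k))"
    using assms(1) ij by (intro sum.mono_neutral_right) (auto simp: c_def)
  also have "\<dots> = 0" using ij by (simp add: c_def)
  finally have "c i = 0" using assms(2) ij(1) by blast
  then show False using assms(3) by (simp add: c_def)
qed

text \<open>The vector of generators is an eigenvector with eigenvalue \<open>z\<close> of an
  integer matrix, whose characteristic polynomial is monic with integer coefficients.\<close>

lemma algebraic_int_if_finite_module:
  fixes z :: "'a::field_char_0" and v :: "nat \<Rightarrow> 'a"
  assumes "\<And>i. i < n \<Longrightarrow> z * v i \<in> intmod.span (v ` {..<n})" and nz: "\<exists>i<n. v i \<noteq> 0"
  shows "algebraic_int z"
proof -
  have "\<exists>c. z * v i = (\<Sum>j<n. of_int (c j) * v j)" if "i < n" for i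
    using assms(1)[OF that] by (auto simp: intmod.span_image_finite)
  then obtain c where c: "\<And>i. i < n \<Longrightarrow> z * v i = (\<Sum>j<n. of_int (c i j) * v j)" by metis
  define A where "A = mat n n (\<lambda>(i, j). c i j)"
  have A: "A \<in> carrier_mat n n" by (simp add: A_def)
  have A': "map_mat of_int A \<in> carrier_mat n n" by (simp add: A_def)
  have "eigenvector (map_mat of_int A) (vec n v) z"
    unfolding eigenvector_def
  proof (intro conjI)
    show "vec n v \<in> carrier_vec (dim_row (map_mat of_int A))" by (simp add: A_def)
    show "vec n v \<noteq> 0\<^sub>v (dim_row (map_mat of_int A))"
    proof
      assume "vec n v = 0\<^sub>v (dim_row (map_mat of_int A))"
      then have "vec n v = 0\<^sub>v n" by (simp add: A_def)
      then show False using nz by (metis index_vec index_zero_vec(1))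
    qed
    show "map_mat of_int A *\<^sub>v vec n v = z \<cdot>\<^sub>v vec n v"
    proof (rule eq_vecI)
      fix i assume "i < dim_vec (z \<cdot>\<^sub>v vec n v)"
      then have i: "i < n" by simp
      have "(map_mat of_int A *\<^sub>v vec n v) $ i = (\<Sum>j<n. map_mat of_int A $$ (i, j) * vec n v $ j)"
        by (rule mult_mat_vec_index[OF A' _ i]) simp
      also have "\<dots> = z * v i" using i by (simp add: c A_def)
      finally show "(map_mat of_int A *\<^sub>v vec n v) $ i = (z \<cdot>\<^sub>v vec n v) $ i" using i by simp
    qed (simp add: A_def)
  qed
  then have "poly (char_poly (map_mat of_int A)) z = 0"
    using eigenvalue_root_char_poly[OF A'] by (auto simp: eigenvalue_def)
  then have "poly (map_poly of_int (char_poly A)) z = 0"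
    by (simp add: of_int_hom.char_poly_hom[OF A])
  moreover have "lead_coeff (char_poly A) = 1"
    using degree_monic_char_poly[OF A] by simp
  ultimately show ?thesis unfolding algebraic_int_altdef_ipoly by blast
qed

lemma algebraic_int_power_reduction:
  fixes x :: "'a::field_char_0"
  assumes "algebraic_int x"
  obtains m c where "m > 0" "x ^ m = (\<Sum>i<m. of_int (c i) * x ^ i)"
proof -
  obtain p where p: "poly (map_poly of_int p) x = 0" "lead_coeff p = 1"
    using assms unfolding algebraic_int_altdef_ipoly by blast
  define m where "m = degree p"
  have "0 = (\<Sum>i\<le>m. of_int (coeff p i) * x ^ i)"
    using p(1) unfolding poly_altdef by (simp add: m_def degree_map_poly coeff_map_poly)
  also have "\<dots> = (\<Sum>i<m. of_int (coeff p i) * x ^ i) + x ^ m"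
    using p(2) by (simp add: m_def lessThan_Suc_atMost[symmetric])
  finally have *: "x ^ m = (\<Sum>i<m. of_int (- coeff p i) * x ^ i)"
    by (simp add: sum_negf eq_neg_iff_add_eq_0 add.commute)
  have "m > 0"
  proof (rule ccontr)
    assume "\<not> m > 0" then show False using * by simp
  qed
  then show ?thesis by (rule that[OF _ *])
qed

text \<open>The products of powers of \<open>x\<close> below \<open>m\<close> and of
  \<open>y\<close> below \<open>n\<close> generate a finite integer module. The monic relations
  bring \<open>x ^ m\<close> and \<open>y ^ n\<close> back into it, so it is stable under
  \<open>x\<close> and \<open>y\<close>, hence under their sum and product.\<close>

lemma algebraic_int_plus_times:
  fixes x y :: "'a::field_char_0"
  assumes "algebraic_int x" "algebraic_int y"
  shows "algebraic_int (x + y)" "algebraic_int (x * y)"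
proof -
  obtain m a where m: "m > 0" "x ^ m = (\<Sum>i<m. of_int (a i) * x ^ i)"
    using algebraic_int_power_reduction[OF assms(1)] .
  obtain n b where n: "n > 0" "y ^ n = (\<Sum>i<n. of_int (b i) * y ^ i)"
    using algebraic_int_power_reduction[OF assms(2)] .
  \<comment> \<open>Division with remainder by \<open>n\<close> packs both exponents into one index
    below \<open>m * n\<close>.\<close>
  define v where "v k = x ^ (k div n) * y ^ (k mod n)" for k
  define S where "S = intmod.span (v ` {..<m * n})"
  have base: "x ^ i * y ^ j \<in> S" if "i < m" "j < n" for i j
  proof -
    have "i * n + j < Suc i * n" using that by simp
    also have "\<dots> \<le> m * n" using that by (intro mult_right_mono) auto
    finally have "i * n + j < m * n" .
    moreover have "v (i * n + j) = x ^ i * y ^ j" using that by (simp add: v_def)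
    ultimately show ?thesis unfolding S_def by (intro intmod.span_base) (auto intro!: rev_image_eqI)
  qed
  have add: "u \<in> S \<Longrightarrow> w \<in> S \<Longrightarrow> u + w \<in> S" for u w unfolding S_def by (rule intmod.span_add)
  have scale: "u \<in> S \<Longrightarrow> of_int k * u \<in> S" for u k unfolding S_def by (rule intmod.span_scale)
  have sum: "(\<And>i. i \<in> I \<Longrightarrow> f i \<in> S) \<Longrightarrow> sum f I \<in> S" for I and f :: "nat \<Rightarrow> 'a"
    unfolding S_def by (rule intmod.span_sum)
  have xv: "x * v k \<in> S" if "k < m * n" for k
  proof -
    define i j where "i = k div n" "j = k mod n"
    have ij: "i < m" "j < n" using that n(1) by (auto simp: i_j_def less_mult_imp_div_less)
    show ?thesis
    proof (cases "Suc i < m")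
      case True
      then show ?thesis using base[of "Suc i" j] ij by (simp add: v_def i_j_def mult_ac)
    next
      case False
      then have "x ^ m = x * x ^ i" using ij by (metis Suc_lessI power_Suc)
      then have "x * v k = x ^ m * y ^ j" by (simp add: v_def i_j_def)
      also have "\<dots> = (\<Sum>l<m. of_int (a l) * (x ^ l * y ^ j))"
        unfolding m(2) sum_distrib_right by (simp add: mult.assoc)
      also have "\<dots> \<in> S" using ij by (intro sum scale base) auto
      finally show ?thesis .
    qed
  qed
  have yv: "y * v k \<in> S" if "k < m * n" for k
  proof -
    define i j where "i = k div n" "j = k mod n"
    have ij: "i < m" "j < n" using that n(1) by (auto simp: i_j_def less_mult_imp_div_less)
    show ?thesis
    proof (cases "Suc j < n")
      case True
      then show ?thesis using base[of i "Suc j"] ij by (simp add: v_def i_j_def mult_ac)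
    next
      case False
      then have "y ^ n = y * y ^ j" using ij by (metis Suc_lessI power_Suc)
      then have "y * v k = x ^ i * y ^ n" by (simp add: v_def i_j_def)
      also have "\<dots> = (\<Sum>l<n. of_int (b l) * (x ^ i * y ^ l))"
        unfolding n(2) sum_distrib_left by (simp add: mult_ac)
      also have "\<dots> \<in> S" using ij by (intro sum scale base) auto
      finally show ?thesis .
    qed
  qed
  \<comment> \<open>\<open>y * v k\<close> is in general only a combination of generators, so for
    the product stability under \<open>x\<close> is required on all of \<open>S\<close>.\<close>
  have xS: "x * u \<in> S" if "u \<in> S" for u
  proof -
    obtain c where "u = (\<Sum>k<m * n. of_int (c k) * v k)"
      using \<open>u \<in> S\<close> unfolding S_def by (auto simp: intmod.span_image_finite)
    then have "x * u = (\<Sum>k<m * n. of_int (c k) * (x * v k))" by (simp add: sum_distrib_left mult_ac)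
    then show ?thesis using xv by (auto intro!: sum scale)
  qed
  have nz: "\<exists>i<m * n. v i \<noteq> 0" using m(1) n(1) by (intro exI[of _ 0]) (auto simp: v_def)
  show "algebraic_int (x + y)"
    by (rule algebraic_int_if_finite_module[OF _ nz])
      (use xv yv add in \<open>auto simp: S_def[symmetric] distrib_right\<close>)
  show "algebraic_int (x * y)"
    by (rule algebraic_int_if_finite_module[OF _ nz])
      (use xS yv in \<open>auto simp: S_def[symmetric] mult.assoc\<close>)
qed

lemma algebraic_int_sum:
  "(\<And>i. i \<in> I \<Longrightarrow> algebraic_int (f i :: 'a::field_char_0)) \<Longrightarrow> algebraic_int (sum f I)"
  by (induction I rule: infinite_finite_induct) (auto intro: algebraic_int_plus_times)

lemma algebraic_int_prod:
  "(\<And>i. i \<in> I \<Longrightarrow> algebraic_int (f i :: 'a::field_char_0)) \<Longrightarrow> algebraic_int (prod f I)"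
  by (induction I rule: infinite_finite_induct) (auto intro: algebraic_int_plus_times int_imp_algebraic_int)

section \<open>Galois number fields\<close>

lemma common_denominator:
  fixes q :: "'i \<Rightarrow> rat"
  assumes "finite I"
  obtains c :: int and k :: "'i \<Rightarrow> int"
  where "c > 0" "\<And>i. i \<in> I \<Longrightarrow> of_int c * q i = of_int (k i)"
proof -
  define c where "c = (\<Prod>i\<in>I. snd (quotient_of (q i)))"
  have c: "c > 0" by (auto simp: c_def intro!: prod_pos quotient_of_denom_pos')
  have "\<exists>k. of_int c * q i = of_int k" if "i \<in> I" for i
  proof -
    have "snd (quotient_of (q i)) dvd c" unfolding c_def using that assms by (intro dvd_prodI) auto
    then obtain k where k: "c = snd (quotient_of (q i)) * k" by (rule dvdE)
    have "q i = of_int (fst (quotient_of (q i))) / of_int (snd (quotient_of (q i)))"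
      by (rule quotient_of_div) simp
    then have "of_int c * q i = of_int (k * fst (quotient_of (q i)))"
      using quotient_of_denom_pos'[of "q i"] unfolding k by (simp add: field_simps)
    then show ?thesis by blast
  qed
  then obtain k where "\<And>i. i \<in> I \<Longrightarrow> of_int c * q i = of_int (k i)" by metis
  then show ?thesis by (rule that[OF c])
qed

locale galois_number_field =
  fixes K :: "'a::field_char_0 set"
  assumes galois: "galois_over_rat K"
begin

abbreviation "G \<equiv> galois_group K"
abbreviation "d \<equiv> field_degree K"

lemma number_field: "number_field K"
  using galois by (simp add: galois_over_rat_def)

lemma K_zero [simp]: "0 \<in> K" and K_one [simp]: "1 \<in> K"
  and K_add: "x \<in> K \<Longrightarrow> y \<in> K \<Longrightarrow> x + y \<in> K"
  and K_mult: "x \<in> K \<Longrightarrow> y \<in> K \<Longrightarrow> x * y \<in> K"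
  and K_minus: "x \<in> K \<Longrightarrow> - x \<in> K"
  and K_inverse: "x \<in> K \<Longrightarrow> inverse x \<in> K"
  using number_field by (auto simp: number_field_def)

lemma K_diff: "x \<in> K \<Longrightarrow> y \<in> K \<Longrightarrow> x - y \<in> K"
  using K_add[OF _ K_minus] by force

lemma K_divide: "x \<in> K \<Longrightarrow> y \<in> K \<Longrightarrow> x / y \<in> K"
  using K_mult[OF _ K_inverse] by (simp add: divide_inverse)

lemma K_sum: "(\<And>i. i \<in> I \<Longrightarrow> f i \<in> K) \<Longrightarrow> sum f I \<in> K"
  by (induction I rule: infinite_finite_induct) (auto intro: K_add)

lemma K_prod: "(\<And>i. i \<in> I \<Longrightarrow> f i \<in> K) \<Longrightarrow> prod f I \<in> K"
  by (induction I rule: infinite_finite_induct) (auto intro: K_mult)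

lemma K_power: "x \<in> K \<Longrightarrow> x ^ n \<in> K"
  by (induction n) (auto intro: K_mult)

lemma K_of_rat [simp]: "of_rat q \<in> K"
proof -
  obtain B where "ratvs.span B = K" using number_field by (auto simp: number_field_def)
  then have "of_rat q * 1 \<in> K" using ratvs.span_scale[of 1 B q] by simp
  then show ?thesis by simp
qed

lemma K_of_int [simp]: "of_int k \<in> K"
  using K_of_rat[of "of_int k"] by simp

lemma K_of_nat [simp]: "of_nat k \<in> K"
  using K_of_int[of "int k"] by simp

lemmas K_closed = K_add K_mult K_minus K_inverse K_diff K_divide K_sum K_prod K_power

lemma G_closed: "g \<in> G \<Longrightarrow> x \<in> K \<Longrightarrow> g x \<in> K"
  by (auto simp: galois_group_def bij_betw_def)

lemma G_add: "g \<in> G \<Longrightarrow> x \<in> K \<Longrightarrow> y \<in> K \<Longrightarrow> g (x + y) = g x + g y"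
  and G_mult: "g \<in> G \<Longrightarrow> x \<in> K \<Longrightarrow> y \<in> K \<Longrightarrow> g (x * y) = g x * g y"
  and G_rat [simp]: "g \<in> G \<Longrightarrow> g (of_rat q) = of_rat q"
  by (auto simp: galois_group_def)

lemma G_inj: "g \<in> G \<Longrightarrow> x \<in> K \<Longrightarrow> y \<in> K \<Longrightarrow> g x = g y \<longleftrightarrow> x = y"
  by (auto simp: galois_group_def bij_betw_def inj_on_def)

lemma G_0 [simp]: "g \<in> G \<Longrightarrow> g 0 = 0" and G_1 [simp]: "g \<in> G \<Longrightarrow> g 1 = 1"
  using G_rat[of g 0] G_rat[of g 1] by auto

lemma G_int [simp]: "g \<in> G \<Longrightarrow> g (of_int k) = of_int k"
  using G_rat[of g "of_int k"] by simp

lemma G_minus: "g \<in> G \<Longrightarrow> x \<in> K \<Longrightarrow> g (- x) = - g x"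
  using G_add[of g x "- x"] K_minus[of x] by (simp add: eq_neg_iff_add_eq_0 add.commute)

lemma G_sum: "g \<in> G \<Longrightarrow> (\<And>i. i \<in> I \<Longrightarrow> f i \<in> K) \<Longrightarrow> g (sum f I) = (\<Sum>i\<in>I. g (f i))"
  by (induction I rule: infinite_finite_induct) (auto simp: G_add K_sum)

lemma G_prod: "g \<in> G \<Longrightarrow> (\<And>i. i \<in> I \<Longrightarrow> f i \<in> K) \<Longrightarrow> g (prod f I) = (\<Prod>i\<in>I. g (f i))"
  by (induction I rule: infinite_finite_induct) (auto simp: G_mult K_prod)

lemma G_power: "g \<in> G \<Longrightarrow> x \<in> K \<Longrightarrow> g (x ^ n) = g x ^ n"
  by (induction n) (auto simp: G_mult K_power)

lemma G_eqI: "g \<in> G \<Longrightarrow> h \<in> G \<Longrightarrow> (\<And>x. x \<in> K \<Longrightarrow> g x = h x) \<Longrightarrow> g = h"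
  by (rule extensionalityI[of _ K]) (auto simp: galois_group_def)

lemma GI:
  assumes "g \<in> extensional K" "bij_betw g K K"
    and "\<And>x y. x \<in> K \<Longrightarrow> y \<in> K \<Longrightarrow> g (x + y) = g x + g y"
    and "\<And>x y. x \<in> K \<Longrightarrow> y \<in> K \<Longrightarrow> g (x * y) = g x * g y"
    and "\<And>q. g (of_rat q) = of_rat q"
  shows "g \<in> G"
  using assms by (auto simp: galois_group_def elim!: Rats_cases)

lemma G_id: "restrict id K \<in> G"
  by (rule GI) (auto simp: K_closed bij_betw_def inj_on_def)

lemma G_compose:
  assumes "g \<in> G" "h \<in> G"
  shows "compose K g h \<in> G"
proof (rule GI)
  show "bij_betw (compose K g h) K K"
    using assms by (intro bij_betw_compose[of _ _ K]) (auto simp: galois_group_def)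
qed (use assms in \<open>auto simp: compose_eq K_closed G_closed G_add G_mult\<close>)

lemma G_inverse:
  assumes g: "g \<in> G"
  obtains h where "h \<in> G" "\<And>x. x \<in> K \<Longrightarrow> h (g x) = x" "\<And>x. x \<in> K \<Longrightarrow> g (h x) = x"
proof -
  define h where "h = restrict (the_inv_into K g) K"
  have bij: "bij_betw g K K" using g by (simp add: galois_group_def)
  have hg: "h (g x) = x" if "x \<in> K" for x
    using that bij G_closed[OF g that] by (simp add: h_def bij_betw_def the_inv_into_f_f)
  have gh: "g (h x) = x" if "x \<in> K" for x
    using that bij by (simp add: h_def bij_betw_def f_the_inv_into_f)
  have hK: "h x \<in> K" if "x \<in> K" for x
    using that bij_betw_the_inv_into[OF bij] by (auto simp: h_def bij_betw_def)
  have "bij_betw h K K" using hg gh hK G_closed[OF g] by (intro bij_betw_byWitness[of _ g]) auto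
  moreover have "h (x + y) = h x + h y" "h (x * y) = h x * h y" if "x \<in> K" "y \<in> K" for x y
    using that hg[of "h x + h y"] hg[of "h x * h y"] by (auto simp: G_add[OF g] G_mult[OF g] hK gh K_closed)
  moreover have "h (of_rat q) = of_rat q" for q
    using hg[of "of_rat q"] g by simp
  ultimately have "h \<in> G" by (intro GI) (auto simp: h_def)
  then show ?thesis by (rule that) (use hg gh in auto)
qed

lemma G_compose_bij: "g \<in> G \<Longrightarrow> bij_betw (compose K g) G G"
proof -
  assume g: "g \<in> G"
  obtain g' where g': "g' \<in> G" "\<And>x. x \<in> K \<Longrightarrow> g' (g x) = x" "\<And>x. x \<in> K \<Longrightarrow> g (g' x) = x"
    using G_inverse[OF g] by blast
  show ?thesis
  proof (rule bij_betw_byWitness[of _ "compose K g'"])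
    show "\<forall>h\<in>G. compose K g' (compose K g h) = h"
      using g g' by (auto intro!: G_eqI G_compose simp: compose_eq G_closed)
    show "\<forall>h\<in>G. compose K g (compose K g' h) = h"
      using g g' by (auto intro!: G_eqI G_compose simp: compose_eq G_closed)
  qed (use g g' in \<open>auto intro: G_compose\<close>)
qed

lemma fixed_imp_Rats: "x \<in> K \<Longrightarrow> (\<And>g. g \<in> G \<Longrightarrow> g x = x) \<Longrightarrow> x \<in> \<rat>"
  using galois by (auto simp: galois_over_rat_def)

section \<open>Bases, finiteness of the Galois group, and a separating element\<close>

lemma ex_basis: obtains B where "finite B" "ratvs.independent B" "ratvs.span B = K" "card B = d"
proof -
  obtain B0 where B0: "finite B0" "ratvs.span B0 = K" using number_field by (auto simp: number_field_def)
  obtain B where B: "B \<subseteq> K" "ratvs.independent B" "K \<subseteq> ratvs.span B" "card B = ratvs.dim K"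
    using ratvs.basis_exists[of K] by blast
  have "ratvs.span B = K"
    using B B0 ratvs.span_mono[OF B(1)] by (metis ratvs.span_span subset_antisym)
  moreover have "finite B"
    using ratvs.independent_span_bound[OF B0(1) B(2)] B B0 by auto
  ultimately show ?thesis using that B by (simp add: field_degree_def)
qed

lemma ex_basis_family:
  obtains b :: "nat \<Rightarrow> 'a" where "inj_on b {..<d}" "ratvs.independent (b ` {..<d})"
    "ratvs.span (b ` {..<d}) = K" "\<And>i. i < d \<Longrightarrow> b i \<in> K"
proof -
  obtain B where B: "finite B" "ratvs.independent B" "ratvs.span B = K" "card B = d" by (rule ex_basis)
  obtain b where b: "bij_betw b {..<d} B"
    using ex_bij_betw_nat_finite[OF B(1)] B(4) by (auto simp: atLeast0LessThan)
  then have bB: "b ` {..<d} = B" "inj_on b {..<d}" by (auto simp: bij_betw_def)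
  have "b i \<in> K" if "i < d" for i using that bB(1) B(3) ratvs.span_base[of "b i" B] by auto
  then show ?thesis using that bB B by metis
qed

text \<open>In a basis of \<open>K\<close>, multiplication by \<open>x\<close> has a rational
  matrix. Once its denominators are cleared, the integer module generated by the basis is stable
  under \<open>c * x\<close>.\<close>

lemma algebraic_int_multiple:
  assumes x: "x \<in> K"
  obtains c :: int where "c > 0" "algebraic_int (of_int c * x)"
proof -
  obtain b where b: "inj_on b {..<d}" "ratvs.independent (b ` {..<d})"
    "ratvs.span (b ` {..<d}) = K" "\<And>i. i < d \<Longrightarrow> b i \<in> K" using ex_basis_family by blast
  have "\<exists>q. x * b i = (\<Sum>j<d. of_rat (q j) * b j)" if "i < d" for i
  proof -
    have "x * b i \<in> ratvs.span (b ` {..<d})" using x b K_mult that by simp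
    then show ?thesis by (auto simp: ratvs.span_image_finite)
  qed
  then obtain q where q: "\<And>i. i < d \<Longrightarrow> x * b i = (\<Sum>j<d. of_rat (q i j) * b j)" by metis
  obtain c :: int and k where c: "c > 0"
    and "\<And>ij. ij \<in> {..<d} \<times> {..<d} \<Longrightarrow> of_int c * (case ij of (i, j) \<Rightarrow> q i j) = of_int (k ij)"
    using common_denominator[of "{..<d} \<times> {..<d}" "\<lambda>(i, j). q i j"] by blast
  then have k: "of_int c * q i j = of_int (k (i, j))" if "i < d" "j < d" for i j
    using that by force
  have mem: "of_int c * x * b i \<in> intmod.span (b ` {..<d})" if "i < d" for i
  proof -
    have "of_int c * x * b i = (\<Sum>j<d. of_rat (of_int c * q i j) * b j)"
      using that by (simp add: q mult.assoc sum_distrib_left of_rat_mult)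
    also have "\<dots> = (\<Sum>j<d. of_int (k (i, j)) * b j)" using that by (simp add: k)
    finally show ?thesis by (auto simp: intmod.span_image_finite)
  qed
  have nz: "\<exists>i<d. b i \<noteq> 0"
  proof (rule ccontr)
    assume "\<not> ?thesis"
    then have "b ` {..<d} \<subseteq> {0}" by auto
    then have "ratvs.span (b ` {..<d}) \<subseteq> ratvs.span {0}" by (rule ratvs.span_mono)
    then have "K \<subseteq> {0}" using b(3) by simp
    then have "(1::'a) \<in> {0}" using K_one by (rule subsetD)
    then show False by simp
  qed
  have "algebraic_int (of_int c * x)" by (rule algebraic_int_if_finite_module[OF mem nz])
  then show ?thesis by (rule that[OF c])
qed

lemma algebraic_int_G:
  assumes "g \<in> G" "x \<in> K" "algebraic_int x"
  shows "algebraic_int (g x)"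
proof -
  obtain p where p: "poly (map_poly of_int p) x = 0" "lead_coeff p = 1"
    using assms(3) unfolding algebraic_int_altdef_ipoly by blast
  have "poly (map_poly of_int p) (g x) = (\<Sum>i\<le>degree p. of_int (coeff p i) * g x ^ i)"
    by (simp add: poly_altdef degree_map_poly coeff_map_poly)
  also have "\<dots> = g (\<Sum>i\<le>degree p. of_int (coeff p i) * x ^ i)"
    using assms by (simp add: G_sum G_mult G_power K_closed)
  also have "(\<Sum>i\<le>degree p. of_int (coeff p i) * x ^ i) = poly (map_poly of_int p) x"
    by (simp add: poly_altdef degree_map_poly coeff_map_poly)
  finally show ?thesis using p assms(1) unfolding algebraic_int_altdef_ipoly by auto
qed

text \<open>Automorphisms fix the coefficients of an integer polynomial vanishing at
  \<open>c * x\<close>, so \<open>c\<close> times every conjugate is one of its finitely many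
  roots.\<close>

lemma finite_conjugates:
  assumes x: "x \<in> K"
  shows "finite ((\<lambda>g. g x) ` G)"
proof -
  obtain c :: int where c: "c > 0" "algebraic_int (of_int c * x)" using algebraic_int_multiple[OF x] .
  obtain p where p: "poly (map_poly of_int p) (of_int c * x) = 0" "lead_coeff p = 1"
    using c(2) unfolding algebraic_int_altdef_ipoly by blast
  define P where "P = (map_poly of_int p :: 'a poly)"
  have "P \<noteq> 0" using p(2) by (auto simp: P_def map_poly_eq_0_iff)
  have "poly P (of_int c * g x) = 0" if g: "g \<in> G" for g
  proof -
    have "poly P (of_int c * g x) = (\<Sum>i\<le>degree p. of_int (coeff p i) * (of_int c * g x) ^ i)"
      by (simp add: P_def poly_altdef degree_map_poly coeff_map_poly)
    also have "\<dots> = g (\<Sum>i\<le>degree p. of_int (coeff p i) * (of_int c * x) ^ i)"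
      using g x by (simp add: G_sum G_mult G_power K_closed)
    also have "(\<Sum>i\<le>degree p. of_int (coeff p i) * (of_int c * x) ^ i) = 0"
      using p(1) by (simp add: poly_altdef degree_map_poly coeff_map_poly)
    finally show ?thesis using g by simp
  qed
  then have "(\<lambda>g. g x) ` G \<subseteq> (\<lambda>y. y / of_int c) ` {y. poly P y = 0}"
    using c(1) by (auto simp: image_iff field_simps intro!: exI[of _ "of_int c * _"])
  then show ?thesis using poly_roots_finite[OF \<open>P \<noteq> 0\<close>] finite_subset by blast
qed

text \<open>An automorphism is determined by its values on a finite basis, and each value has
  finitely many candidates. The traces and norms below, which are sums and products over
  \<open>G\<close>, rest on this.\<close>

lemma finite_G: "finite G"
proof -
  obtain B where B: "finite B" "ratvs.independent B" "ratvs.span B = K" "card B = d" by (rule ex_basis)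
  have BK: "B \<subseteq> K" using B ratvs.span_base by blast
  have "inj_on (\<lambda>g. restrict g B) G"
  proof (rule inj_onI)
    fix g h assume gh: "g \<in> G" "h \<in> G" "restrict g B = restrict h B"
    have eq: "g b = h b" if "b \<in> B" for b using gh(3) that by (metis restrict_apply')
    show "g = h"
    proof (rule G_eqI[OF gh(1,2)])
      fix x assume "x \<in> K"
      then obtain q where q: "x = (\<Sum>b\<in>B. of_rat (q b) * b)"
        using B(1,3) by (auto simp: ratvs.span_finite)
      show "g x = h x" using gh(1,2) BK eq unfolding q
        by (subst (1 2) G_sum) (auto simp: G_mult K_closed intro!: sum.cong)
    qed
  qed
  moreover have "(\<lambda>g. restrict g B) ` G \<subseteq> (\<Pi>\<^sub>E b\<in>B. (\<lambda>g. g b) ` G)" by auto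
  moreover have "finite (\<Pi>\<^sub>E b\<in>B. (\<lambda>g. g b) ` G)"
    using B(1) BK by (intro finite_PiE finite_conjugates) auto
  ultimately show ?thesis by (meson finite_imageD finite_subset)
qed

text \<open>Two distinct automorphisms agree on the sum of the \<open>of_nat n ^ i * b i\<close>
  only if \<open>n\<close> is a root of the nonzero polynomial \<open>P g h\<close>, so some
  \<open>n\<close> separates all pairs. That the powers of the resulting element span
  \<open>K\<close> is the content of \<open>theta_span\<close>.\<close>

lemma primitive_element:
  obtains \<theta> where "\<theta> \<in> K" "algebraic_int \<theta>" "inj_on (\<lambda>g. g \<theta>) G"
proof -
  obtain b where b: "inj_on b {..<d}" "ratvs.independent (b ` {..<d})"
    "ratvs.span (b ` {..<d}) = K" "\<And>i. i < d \<Longrightarrow> b i \<in> K" using ex_basis_family by blast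
  note bK = b(4)
  define P where "P g h = (\<Sum>i<d. monom (g (b i) - h (b i)) i)" for g h :: "'a \<Rightarrow> 'a"
  have P0: "P g h \<noteq> 0" if gh: "g \<in> G" "h \<in> G" "g \<noteq> h" for g h
  proof
    assume z: "P g h = 0"
    have eq: "g (b i) = h (b i)" if "i < d" for i
    proof -
      have "coeff (P g h) i = (\<Sum>j<d. if j = i then g (b i) - h (b i) else 0)"
        unfolding P_def coeff_sum by (intro sum.cong) auto
      then show ?thesis using z that by simp
    qed
    have "g = h"
    proof (rule G_eqI[OF gh(1,2)])
      fix x assume "x \<in> K"
      then have "x \<in> ratvs.span (b ` {..<d})" using b by simp
      then obtain q where q: "x = (\<Sum>i<d. of_rat (q i) * b i)"
        by (auto simp: ratvs.span_image_finite)
      show "g x = h x" using gh(1,2) bK eq unfolding q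
        by (subst (1 2) G_sum) (auto simp: G_mult K_closed intro!: sum.cong)
    qed
    then show False using gh(3) by simp
  qed
  define bad where "bad = (\<Union>g\<in>G. \<Union>h\<in>G - {g}. {y. poly (P g h) y = 0})"
  have "finite bad" unfolding bad_def using finite_G P0 by (auto intro!: poly_roots_finite)
  moreover have "infinite (range (of_nat :: nat \<Rightarrow> 'a))" by (rule range_inj_infinite) (simp add: inj_def)
  ultimately obtain n :: nat where n: "of_nat n \<notin> bad" by (meson finite_subset image_subsetI)
  define x where "x = (\<Sum>i<d. of_nat n ^ i * b i)"
  have x: "x \<in> K" using bK by (auto simp: x_def intro!: K_sum K_mult K_power)
  have gx: "g x = (\<Sum>i<d. of_nat n ^ i * g (b i))" if "g \<in> G" for g
    using that bK G_int[OF that, of "int n"] unfolding x_def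
    by (subst G_sum) (auto simp: G_mult G_power K_closed)
  have inj: "g = h" if gh: "g \<in> G" "h \<in> G" "g x = h x" for g h
  proof (rule ccontr)
    assume "g \<noteq> h"
    have "poly (P g h) (of_nat n) = (\<Sum>i<d. (g (b i) - h (b i)) * of_nat n ^ i)"
      by (simp add: P_def poly_sum poly_monom)
    also have "\<dots> = g x - h x" using gh by (simp add: gx sum_subtractf algebra_simps)
    finally have "of_nat n \<in> bad" using gh \<open>g \<noteq> h\<close> by (auto simp: bad_def)
    then show False using n by simp
  qed
  obtain c :: int where c: "c > 0" "algebraic_int (of_int c * x)" using algebraic_int_multiple[OF x] .
  have "inj_on (\<lambda>g. g (of_int c * x)) G"
    using c(1) x inj by (auto simp: inj_on_def G_mult)
  then show ?thesis using that[of "of_int c * x"] c x by (simp add: K_closed)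
qed

end

lemma vanishing_coeffs:
  fixes a :: "nat \<Rightarrow> 'b::idom"
  assumes "finite S" "card S \<ge> n" "\<And>x. x \<in> S \<Longrightarrow> (\<Sum>i<n. a i * x ^ i) = 0" "i < n"
  shows "a i = 0"
proof -
  define P where "P = (\<Sum>i<n. monom (a i) i)"
  have c: "coeff P j = (if j < n then a j else 0)" for j
    unfolding P_def coeff_sum by (simp add: if_distrib[of "\<lambda>f. f j"] cong: if_cong)
  have "P = 0"
  proof (rule ccontr)
    assume P: "P \<noteq> 0"
    then have "coeff P (degree P) \<noteq> 0" by simp
    then have deg: "degree P < n" using c by metis
    have "S \<subseteq> {x. poly P x = 0}" using assms(3) by (auto simp: P_def poly_sum poly_monom)
    then have "card S \<le> card {x. poly P x = 0}" using poly_roots_finite[OF P] by (rule card_mono[rotated])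
    also have "\<dots> \<le> degree P" by (rule card_poly_roots_bound[OF P])
    finally show False using deg assms(2) by simp
  qed
  then show ?thesis using c[of i] assms(4) by simp
qed

section \<open>Traces, norms, and the power basis of a separating element\<close>

context galois_number_field
begin

lemma sum_G_compose:
  assumes "h \<in> G" "x \<in> K"
  shows "(\<Sum>g\<in>G. h (g x)) = (\<Sum>g\<in>G. g x)"
  using sum.reindex_bij_betw[OF G_compose_bij[OF assms(1)], of "\<lambda>g. g x"] assms(2)
  by (simp add: compose_eq)

lemma prod_G_compose:
  assumes "h \<in> G" "x \<in> K"
  shows "(\<Prod>g\<in>G. h (g x)) = (\<Prod>g\<in>G. g x)"
  using prod.reindex_bij_betw[OF G_compose_bij[OF assms(1)], of "\<lambda>g. g x"] assms(2)
  by (simp add: compose_eq)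

lemma trace_Rats: "x \<in> K \<Longrightarrow> (\<Sum>g\<in>G. g x) \<in> \<rat>"
  by (rule fixed_imp_Rats) (auto intro!: K_sum simp: G_closed G_sum sum_G_compose)

lemma norm_Rats: "x \<in> K \<Longrightarrow> (\<Prod>g\<in>G. g x) \<in> \<rat>"
  by (rule fixed_imp_Rats) (auto intro!: K_prod simp: G_closed G_prod prod_G_compose)

definition "theta = (SOME \<theta>. \<theta> \<in> K \<and> algebraic_int \<theta> \<and> inj_on (\<lambda>g. g \<theta>) G)"

lemma theta: "theta \<in> K" "algebraic_int theta" "inj_on (\<lambda>g. g theta) G"
proof -
  have "\<exists>\<theta>. \<theta> \<in> K \<and> algebraic_int \<theta> \<and> inj_on (\<lambda>g. g \<theta>) G"
    using primitive_element by metis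
  then have "theta \<in> K \<and> algebraic_int theta \<and> inj_on (\<lambda>g. g theta) G"
    unfolding theta_def by (rule someI_ex)
  then show "theta \<in> K" "algebraic_int theta" "inj_on (\<lambda>g. g theta) G" by auto
qed

lemma coeff_prod_linear_closed:
  "(\<And>i. i \<in> I \<Longrightarrow> a i \<in> K) \<Longrightarrow> coeff (\<Prod>i\<in>I. [:- a i, 1:]) k \<in> K"
proof (induction I arbitrary: k rule: infinite_finite_induct)
  case (insert j I)
  then show ?case by (auto simp: coeff_pCons K_closed split: nat.split)
qed (auto simp: coeff_pCons split: nat.split)

text \<open>The Lagrange interpolation polynomial without its normalising factor: the nodes are the
  conjugates of \<open>theta\<close>, and all of them except \<open>g theta\<close> are
  roots.\<close>

definition "lagr g = (\<Prod>h\<in>G - {g}. [:- h theta, 1:])"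

lemma coeff_lagr: "coeff (lagr g) i \<in> K"
  unfolding lagr_def using theta by (intro coeff_prod_linear_closed) (auto simp: G_closed)

lemma poly_lagr_eq_0: "h \<in> G \<Longrightarrow> h \<noteq> g \<Longrightarrow> poly (lagr g) (h theta) = 0"
  using finite_G by (auto simp: lagr_def poly_prod prod_zero_iff)

lemma poly_lagr_neq_0: "g \<in> G \<Longrightarrow> poly (lagr g) (g theta) \<noteq> 0"
  using finite_G theta(3) by (auto simp: lagr_def poly_prod prod_zero_iff inj_on_def)

lemma poly_lagr:
  assumes "g \<in> G" shows "poly (lagr g) x = (\<Sum>i<card G. coeff (lagr g) i * x ^ i)"
proof -
  have "degree (lagr g) = card (G - {g})"
    unfolding lagr_def using finite_G by (subst degree_prod_eq_sum_degree) auto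
  then have "degree (lagr g) < card G"
    using card_Diff1_less[OF finite_G assms] by simp
  then have "(\<Sum>i<card G. coeff (lagr g) i * x ^ i) = (\<Sum>i\<le>degree (lagr g). coeff (lagr g) i * x ^ i)"
    by (intro sum.mono_neutral_right) (auto simp: coeff_eq_0)
  then show ?thesis by (simp add: poly_altdef)
qed

text \<open>The elements \<open>q i\<close> form the dual basis of the powers of
  \<open>theta\<close> for the trace form, so the coordinates of \<open>x\<close> are the traces of
  \<open>x * q i\<close>. This is Euler's formula: if f is the product of all X - h theta, then
  \<open>lagr e\<close> is f / (X - theta) and \<open>D\<close> is f'(theta).\<close>

lemma theta_span:
  assumes x: "x \<in> K"
  shows "\<exists>c. x = (\<Sum>i<card G. of_rat (c i) * theta ^ i)"
proof -
  define e where "e = restrict id K"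
  have e: "e \<in> G" and e_eq: "\<And>y. y \<in> K \<Longrightarrow> e y = y" using G_id by (auto simp: e_def)
  define D where "D = poly (lagr e) theta"
  have D0: "D \<noteq> 0" using poly_lagr_neq_0[OF e] e_eq theta by (simp add: D_def)
  have DK: "D \<in> K" unfolding D_def poly_lagr[OF e] using coeff_lagr theta
    by (auto intro!: K_sum K_mult K_power)
  define q where "q i = coeff (lagr e) i / D" for i
  have q: "q i \<in> K" for i unfolding q_def using DK coeff_lagr by (rule K_divide[rotated])
  have "(\<Sum>g\<in>G. g (x * q i)) \<in> \<rat>" for i using x q by (intro trace_Rats K_mult)
  then have "\<exists>c. (\<Sum>g\<in>G. g (x * q i)) = of_rat c" for i by (auto elim!: Rats_cases)
  then obtain c where c: "\<And>i. (\<Sum>g\<in>G. g (x * q i)) = of_rat (c i)" by metis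
  \<comment> \<open>Duality: pulling \<open>g\<close> out turns \<open>theta\<close> into
    \<open>h theta\<close> with \<open>h\<close> inverse to \<open>g\<close>, and
    \<open>lagr e\<close> vanishes there unless \<open>g\<close> is the identity.\<close>
  have inner: "(\<Sum>i<card G. g (q i) * theta ^ i) = (if g = e then 1 else 0)" if g: "g \<in> G" for g
  proof -
    obtain h where h: "h \<in> G" "\<And>x. x \<in> K \<Longrightarrow> h (g x) = x" "\<And>x. x \<in> K \<Longrightarrow> g (h x) = x"
      using G_inverse[OF g] by blast
    have "(\<Sum>i<card G. g (q i) * theta ^ i) = g (\<Sum>i<card G. q i * h theta ^ i)"
      using g h theta q by (simp add: G_sum G_mult G_power G_closed K_mult K_power)
    also have "(\<Sum>i<card G. q i * h theta ^ i) = poly (lagr e) (h theta) / D"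
      by (simp add: q_def poly_lagr[OF e] sum_divide_distrib)
    finally have *: "(\<Sum>i<card G. g (q i) * theta ^ i) = g (poly (lagr e) (h theta) / D)" .
    show ?thesis
    proof (cases "g = e")
      case True
      then have "h theta = theta" using h(3)[OF theta(1)] e_eq h(1) theta(1) G_closed by metis
      then show ?thesis using * True D0 e by (simp add: D_def[symmetric])
    next
      case False
      have "h \<noteq> e"
      proof
        assume "h = e"
        then have "g = e" using g e h(3) e_eq by (intro G_eqI) auto
        then show False using False by simp
      qed
      then show ?thesis using * False g poly_lagr_eq_0[OF h(1)] by simp
    qed
  qed
  have "(\<Sum>i<card G. of_rat (c i) * theta ^ i) = (\<Sum>i<card G. \<Sum>g\<in>G. g x * (g (q i) * theta ^ i))"
    by (simp add: c[symmetric] sum_distrib_right G_mult x q mult.assoc)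
  also have "\<dots> = (\<Sum>g\<in>G. g x * (\<Sum>i<card G. g (q i) * theta ^ i))"
    by (subst sum.swap) (simp add: sum_distrib_left)
  also have "\<dots> = (\<Sum>g\<in>G. g x * (if g = e then 1 else 0))" by (simp add: inner)
  also have "\<dots> = x" using e finite_G x e_eq by (simp add: if_distrib[of "\<lambda>a. _ * a"] cong: if_cong)
  finally show ?thesis by metis
qed

lemma theta_conj_indep:
  assumes "\<And>g. g \<in> G \<Longrightarrow> (\<Sum>i<card G. a i * g theta ^ i) = 0" "i < card G"
  shows "a i = 0"
proof (rule vanishing_coeffs[OF _ _ _ assms(2)])
  show "finite ((\<lambda>g. g theta) ` G)" using finite_G by simp
  show "card G \<le> card ((\<lambda>g. g theta) ` G)" using theta(3) by (simp add: card_image)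
qed (use assms(1) in auto)

lemma theta_indep:
  assumes z: "(\<Sum>i<card G. of_rat (c i) * theta ^ i) = 0" and i: "i < card G"
  shows "c i = 0"
proof -
  have "(of_rat (c i) :: 'a) = 0"
  proof (rule theta_conj_indep[OF _ i])
    fix g assume g: "g \<in> G"
    have "g (\<Sum>i<card G. of_rat (c i) * theta ^ i) = (\<Sum>i<card G. of_rat (c i) * g theta ^ i)"
      using g theta by (simp add: G_sum G_mult G_power K_mult K_power)
    then show "(\<Sum>i<card G. of_rat (c i) * g theta ^ i) = 0" using z g by simp
  qed
  then show ?thesis by simp
qed

text \<open>The first \<open>card G\<close> powers of \<open>theta\<close> span \<open>K\<close>,
  and they are independent because a rational relation among them holds at all conjugates of
  \<open>theta\<close>, which are \<open>card G\<close> distinct elements.\<close>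

lemma card_G: "card G = d"
proof -
  let ?v = "\<lambda>i. theta ^ i"
  have inj: "inj_on ?v {..<card G}"
    by (rule ratvs.inj_on_if_independent_family) (auto intro: theta_indep)
  have "ratvs.independent (?v ` {..<card G})"
    by (rule ratvs.independent_imageI[OF inj]) (auto intro: theta_indep)
  moreover have "ratvs.span (?v ` {..<card G}) = K"
    using theta_span theta by (auto simp: ratvs.span_image_finite intro!: K_sum K_mult K_power)
  ultimately have "ratvs.dim K = card (?v ` {..<card G})"
    using ratvs.dim_span_eq_card_independent by metis
  then show ?thesis using inj by (simp add: field_degree_def card_image)
qed

text \<open>Dedekind's independence of automorphisms. Taking \<open>y\<close> to be the powers of
  \<open>theta\<close>, weighted by the coefficients of \<open>lagr h\<close>, isolates the term of
  \<open>h\<close>, since \<open>lagr h\<close> vanishes at every other conjugate.\<close>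

lemma characters_independent:
  assumes "\<And>y. y \<in> K \<Longrightarrow> (\<Sum>g\<in>G. u g * g y) = 0" "h \<in> G"
  shows "u h = 0"
proof -
  have "0 = (\<Sum>i<card G. coeff (lagr h) i * (\<Sum>g\<in>G. u g * g (theta ^ i)))"
    using assms(1) theta by (simp add: K_power)
  also have "\<dots> = (\<Sum>g\<in>G. u g * (\<Sum>i<card G. coeff (lagr h) i * g theta ^ i))"
    by (simp add: sum_distrib_left theta G_power mult_ac) (rule sum.swap)
  also have "\<dots> = (\<Sum>g\<in>G. u g * poly (lagr h) (g theta))"
    by (simp add: poly_lagr[OF assms(2)])
  also have "\<dots> = (\<Sum>g\<in>{h}. u g * poly (lagr h) (g theta))"
    using finite_G assms(2) poly_lagr_eq_0 by (intro sum.mono_neutral_right) auto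
  finally show ?thesis using poly_lagr_neq_0[OF assms(2)] by simp
qed

section \<open>The matrix of conjugates of a family\<close>

lemma ex_enum: "\<exists>s. bij_betw s {..<d} G"
  using ex_bij_betw_nat_finite[OF finite_G] by (simp add: card_G atLeast0LessThan)

definition "enum = (SOME s. bij_betw s {..<d} G)"

lemma enum: "bij_betw enum {..<d} G"
  unfolding enum_def by (rule someI_ex[OF ex_enum])

lemma enum_G: "k < d \<Longrightarrow> enum k \<in> G"
  using enum by (auto simp: bij_betw_def)

lemma sum_enum: "(\<Sum>k<d. f (enum k)) = (\<Sum>g\<in>G. f g)"
  by (rule sum.reindex_bij_betw[OF enum])

definition "conj_mat w = mat d d (\<lambda>(k, i). enum k (w i))"

lemma conj_mat_carrier [simp]: "conj_mat w \<in> carrier_mat d d"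
  by (simp add: conj_mat_def)

text \<open>A vector killed by the transpose is a relation among the automorphisms on the family
  \<open>w\<close>, hence on its span \<open>K\<close>, against
  \<open>characters_independent\<close>.\<close>

lemma det_conj_mat_neq_0:
  assumes span: "ratvs.span (w ` {..<d}) = K"
  shows "det (conj_mat w) \<noteq> 0"
proof
  assume "det (conj_mat w) = 0"
  then have "det (transpose_mat (conj_mat w)) = 0" by (simp add: det_transpose[of _ d])
  then obtain u where u: "u \<in> carrier_vec d" "u \<noteq> 0\<^sub>v d" "transpose_mat (conj_mat w) *\<^sub>v u = 0\<^sub>v d"
    using det_0_iff_vec_prod_zero_field[of "transpose_mat (conj_mat w)" d] by auto
  have wK: "w i \<in> K" if "i < d" for i using that span ratvs.span_base[of "w i" "w ` {..<d}"] by auto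
  have w0: "(\<Sum>k<d. u $ k * enum k (w i)) = 0" if i: "i < d" for i
  proof -
    have "(transpose_mat (conj_mat w) *\<^sub>v u) $ i = (\<Sum>k<d. transpose_mat (conj_mat w) $$ (i, k) * u $ k)"
      using u i by (intro mult_mat_vec_index) auto
    then show ?thesis unfolding u(3) using i by (simp add: conj_mat_def mult.commute)
  qed
  define U where "U g = u $ the_inv_into {..<d} enum g" for g
  have U: "U (enum k) = u $ k" if "k < d" for k
    using that enum by (simp add: U_def the_inv_into_f_f bij_betw_def)
  have "U g = 0" if "g \<in> G" for g
  proof (rule characters_independent[OF _ that])
    fix y assume "y \<in> K"
    then obtain q where q: "y = (\<Sum>i<d. of_rat (q i) * w i)"
      using span by (auto simp: ratvs.span_image_finite)
    have gy: "enum k y = (\<Sum>i<d. of_rat (q i) * enum k (w i))" if "k < d" for k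
      unfolding q using enum_G[OF that] wK by (subst G_sum) (auto simp: G_mult intro!: K_mult)
    have "(\<Sum>g\<in>G. U g * g y) = (\<Sum>k<d. u $ k * enum k y)"
      unfolding sum_enum[symmetric] by (simp add: U)
    also have "\<dots> = (\<Sum>k<d. \<Sum>i<d. of_rat (q i) * (u $ k * enum k (w i)))"
      by (simp add: gy sum_distrib_left mult_ac)
    also have "\<dots> = (\<Sum>i<d. of_rat (q i) * (\<Sum>k<d. u $ k * enum k (w i)))"
      by (subst sum.swap) (simp add: sum_distrib_left)
    also have "\<dots> = 0" by (simp add: w0)
    finally show "(\<Sum>g\<in>G. U g * g y) = 0" .
  qed
  then have "u $ k = 0" if "k < d" for k using U[OF that] enum_G[OF that] by simp
  then have "u = 0\<^sub>v d" using u(1) by (intro eq_vecI) auto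
  then show False using u(2) by simp
qed

end

section \<open>Integral bases and the discriminant\<close>

context galois_number_field
begin

lemma span_eq_K_if_independent:
  assumes w: "\<And>i. i < d \<Longrightarrow> w i \<in> K" and inj: "inj_on w {..<d}" and ind: "ratvs.independent (w ` {..<d})"
  shows "ratvs.span (w ` {..<d}) = K"
proof (intro equalityI subsetI)
  fix x assume "x \<in> ratvs.span (w ` {..<d})"
  then show "x \<in> K" using w by (auto simp: ratvs.span_image_finite intro!: K_sum K_mult)
next
  obtain B where B: "finite B" "ratvs.independent B" "ratvs.span B = K" "card B = d" by (rule ex_basis)
  fix x assume x: "x \<in> K"
  show "x \<in> ratvs.span (w ` {..<d})"
  proof (rule ccontr)
    assume n: "x \<notin> ratvs.span (w ` {..<d})"
    then have ind': "ratvs.independent (insert x (w ` {..<d}))" using ind by (rule ratvs.independent_insertI)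
    have sub: "insert x (w ` {..<d}) \<subseteq> ratvs.span B" unfolding B(3) using x w by auto
    have "card (insert x (w ` {..<d})) \<le> card B"
      using ratvs.independent_span_bound[OF B(1) ind' sub] by simp
    moreover have "x \<notin> w ` {..<d}" using n ratvs.span_base[of x "w ` {..<d}"] by argo
    ultimately show False using inj B(4) by (simp add: card_image)
  qed
qed

lemma conj_mat_mult_vec:
  assumes w: "\<And>i. i < d \<Longrightarrow> w i \<in> K"
  shows "conj_mat w *\<^sub>v vec d (\<lambda>i. of_rat (q i)) = vec d (\<lambda>k. enum k (\<Sum>i<d. of_rat (q i) * w i))"
proof (rule eq_vecI)
  fix k assume "k < dim_vec (vec d (\<lambda>k. enum k (\<Sum>i<d. of_rat (q i) * w i)))"
  then have k: "k < d" by simp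
  have "(conj_mat w *\<^sub>v vec d (\<lambda>i. of_rat (q i))) $ k = (\<Sum>i<d. conj_mat w $$ (k, i) * vec d (\<lambda>i. of_rat (q i)) $ i)"
    by (rule mult_mat_vec_index[OF conj_mat_carrier _ k]) simp
  also have "\<dots> = (\<Sum>i<d. of_rat (q i) * enum k (w i))" using k by (simp add: conj_mat_def mult.commute)
  also have "\<dots> = enum k (\<Sum>i<d. of_rat (q i) * w i)"
    using enum_G[OF k] w by (subst G_sum) (auto simp: G_mult intro!: K_mult)
  finally show "(conj_mat w *\<^sub>v vec d (\<lambda>i. of_rat (q i))) $ k = vec d (\<lambda>k. enum k (\<Sum>i<d. of_rat (q i) * w i)) $ k"
    using k by simp
qed (simp add: conj_mat_def)

lemma independent_if_det_conj_mat_neq_0: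
  assumes w: "\<And>i. i < d \<Longrightarrow> w i \<in> K" and det: "det (conj_mat w) \<noteq> 0"
    and z: "(\<Sum>i<d. of_rat (q i) * w i) = 0" and i: "i < d"
  shows "q i = 0"
proof (rule ccontr)
  assume "q i \<noteq> 0"
  then have "vec d (\<lambda>i. of_rat (q i) :: 'a) \<noteq> 0\<^sub>v d" using i by (metis index_vec index_zero_vec(1) of_rat_eq_0_iff)
  moreover have "conj_mat w *\<^sub>v vec d (\<lambda>i. of_rat (q i)) = 0\<^sub>v d"
    using enum_G by (subst conj_mat_mult_vec[OF w]) (auto simp: z intro!: eq_vecI)
  ultimately have "det (conj_mat w) = 0"
    using det_0_iff_vec_prod_zero_field[OF conj_mat_carrier, of w] vec_carrier by blast
  then show False using det by simp
qed

text \<open>The matrix of conjugates of a basis diagonalises multiplication by \<open>x\<close>,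
  with the conjugates of \<open>x\<close> as eigenvalues, and a trace is unchanged by such a base
  change. \<open>B\<close> is the basis chosen in the definition of
  \<open>field_trace\<close>.\<close>

lemma field_trace:
  assumes x: "x \<in> K"
  shows "of_rat (field_trace K x) = (\<Sum>g\<in>G. g x)"
proof -
  define B where "B = (SOME B. ratvs.independent B \<and> ratvs.span B = K)"
  have "\<exists>B. ratvs.independent B \<and> ratvs.span B = K" using ex_basis by metis
  then have "ratvs.independent B \<and> ratvs.span B = K" unfolding B_def by (rule someI_ex)
  then have B: "ratvs.independent B" "ratvs.span B = K" by auto
  have BK: "B \<subseteq> K" using B ratvs.span_base by blast
  obtain B0 where B0: "finite B0" "ratvs.span B0 = K" using number_field by (auto simp: number_field_def)
  have fin: "finite B" using ratvs.independent_span_bound[OF B0(1) B(1)] BK B0(2) by simp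
  have card: "card B = d" using ratvs.dim_span_eq_card_independent[OF B(1)] B(2) by (simp add: field_degree_def)
  obtain b where b: "bij_betw b {..<d} B"
    using ex_bij_betw_nat_finite[OF fin] card by (auto simp: atLeast0LessThan)
  have bB: "b ` {..<d} = B" using b by (auto simp: bij_betw_def)
  have bK: "b i \<in> K" if "i < d" for i using that bB BK by auto
  define W where "W = conj_mat b"
  have W: "W \<in> carrier_mat d d" by (simp add: W_def)
  \<comment> \<open>The adjugate stands for the inverse; the factor \<open>det W\<close> it brings
    along is cancelled in the last line.\<close>
  define A where "A = adj_mat W"
  have A: "A \<in> carrier_mat d d" "W * A = det W \<cdot>\<^sub>m 1\<^sub>m d" "A * W = det W \<cdot>\<^sub>m 1\<^sub>m d"
    using adj_mat[OF W] by (auto simp: A_def)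
  have D: "det W \<noteq> 0" unfolding W_def by (rule det_conj_mat_neq_0) (simp add: bB B)
  define r where "r i j = ratvs.representation B (x * b i) (b j)" for i j
  have rep: "x * b i = (\<Sum>j<d. of_rat (r i j) * b j)" if "i < d" for i
  proof -
    have "(\<Sum>c\<in>B. of_rat (ratvs.representation B (x * b i) c) * c) = x * b i"
      using x bK that fin B by (intro ratvs.sum_representation_eq) (auto simp: K_mult)
    then show ?thesis unfolding r_def using sum.reindex_bij_betw[OF b, of "\<lambda>c. of_rat (ratvs.representation B (x * b i) c) * c"]
      by simp
  qed
  have AW: "(\<Sum>k<d. A $$ (i, k) * enum k (b j)) = (if i = j then det W else 0)" if "i < d" "j < d" for i j
  proof -
    have "(\<Sum>k<d. A $$ (i, k) * enum k (b j)) = (A * W) $$ (i, j)"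
      using that A(1) W by (auto simp: scalar_prod_def lessThan_atLeast0 W_def conj_mat_def intro!: sum.cong)
    then show ?thesis using that by (simp add: A(3))
  qed
  have WA: "(\<Sum>i<d. enum k (b i) * A $$ (i, k)) = det W" if "k < d" for k
  proof -
    have "(\<Sum>i<d. enum k (b i) * A $$ (i, k)) = (W * A) $$ (k, k)"
      using that A(1) W by (auto simp: scalar_prod_def lessThan_atLeast0 W_def conj_mat_def intro!: sum.cong)
    then show ?thesis using that by (simp add: A(2))
  qed
  have act: "(\<Sum>j<d. of_rat (r i j) * enum k (b j)) = enum k x * enum k (b i)" if "i < d" "k < d" for i k
  proof -
    have "enum k (x * b i) = (\<Sum>j<d. of_rat (r i j) * enum k (b j))"
      unfolding rep[OF that(1)] using enum_G[OF that(2)] bK by (subst G_sum) (auto simp: G_mult intro!: K_mult)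
    then show ?thesis using G_mult[OF enum_G[OF that(2)] x bK[OF that(1)]] by simp
  qed
  have "det W * of_rat (field_trace K x) = det W * (\<Sum>i<d. of_rat (r i i))"
    unfolding field_trace_def B_def[symmetric] Let_def r_def
    using sum.reindex_bij_betw[OF b, of "\<lambda>c. ratvs.representation B (x * c) c"] by (simp add: of_rat_sum[symmetric])
  also have "\<dots> = (\<Sum>i<d. \<Sum>j<d. of_rat (r i j) * (if i = j then det W else 0))"
    by (simp add: if_distrib[of "\<lambda>a. _ * a"] sum_distrib_left mult.commute cong: if_cong)
  also have "\<dots> = (\<Sum>i<d. \<Sum>j<d. of_rat (r i j) * (\<Sum>k<d. A $$ (i, k) * enum k (b j)))"
    by (simp add: AW)
  also have "\<dots> = (\<Sum>i<d. \<Sum>k<d. A $$ (i, k) * (\<Sum>j<d. of_rat (r i j) * enum k (b j)))"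
    by (rule sum.cong[OF refl]) (simp add: sum_distrib_left mult_ac, rule sum.swap)
  also have "\<dots> = (\<Sum>i<d. \<Sum>k<d. enum k x * (enum k (b i) * A $$ (i, k)))"
    by (simp add: act mult_ac)
  also have "\<dots> = (\<Sum>k<d. enum k x * (\<Sum>i<d. enum k (b i) * A $$ (i, k)))"
    by (subst sum.swap) (simp add: sum_distrib_left)
  also have "\<dots> = (\<Sum>k<d. enum k x * det W)" by (simp add: WA)
  also have "\<dots> = det W * (\<Sum>k<d. enum k x)" by (simp add: sum_distrib_right[symmetric])
  finally show ?thesis using D by (simp add: sum_enum[of "\<lambda>g. g x"])
qed

text \<open>Traces are sums over the conjugates, so the Gram matrix of the trace form is the
  transpose of \<open>conj_mat w\<close> times \<open>conj_mat w\<close>.\<close>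

lemma det_trace_mat:
  assumes w: "\<And>i. i < d \<Longrightarrow> w i \<in> K"
  shows "of_rat (det (mat d d (\<lambda>(i, j). field_trace K (w i * w j)))) = det (conj_mat w) ^ 2"
proof -
  have "map_mat of_rat (mat d d (\<lambda>(i, j). field_trace K (w i * w j))) = transpose_mat (conj_mat w) * conj_mat w"
  proof (rule eq_matI)
    fix i j assume "i < dim_row (transpose_mat (conj_mat w) * conj_mat w)"
      "j < dim_col (transpose_mat (conj_mat w) * conj_mat w)"
    then have ij: "i < d" "j < d" by (simp_all add: conj_mat_def)
    have "(transpose_mat (conj_mat w) * conj_mat w) $$ (i, j) = (\<Sum>k<d. enum k (w i) * enum k (w j))"
      using ij by (auto simp: conj_mat_def scalar_prod_def lessThan_atLeast0 intro!: sum.cong)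
    also have "\<dots> = (\<Sum>k<d. enum k (w i * w j))" using ij w enum_G by (simp add: G_mult)
    also have "\<dots> = of_rat (field_trace K (w i * w j))"
      using ij w by (simp add: sum_enum[of "\<lambda>g. g (w i * w j)"] field_trace K_mult)
    finally show "map_mat of_rat (mat d d (\<lambda>(i, j). field_trace K (w i * w j))) $$ (i, j) =
      (transpose_mat (conj_mat w) * conj_mat w) $$ (i, j)" using ij by simp
  qed (simp_all add: conj_mat_def)
  then have "of_rat (det (mat d d (\<lambda>(i, j). field_trace K (w i * w j)))) =
      det (transpose_mat (conj_mat w) * conj_mat w)"
    by (metis of_rat_hom.hom_det)
  also have "\<dots> = det (conj_mat w) ^ 2"
    by (simp add: det_mult[of _ d] det_transpose[of _ d] power2_eq_square)
  finally show ?thesis .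
qed

section \<open>Existence of an integral basis\<close>

abbreviation "OK \<equiv> ring_of_integers K"

lemma OK_iff: "x \<in> OK \<longleftrightarrow> x \<in> K \<and> algebraic_int x"
  by (simp add: ring_of_integers_def)

lemma OK_add: "x \<in> OK \<Longrightarrow> y \<in> OK \<Longrightarrow> x + y \<in> OK"
  and OK_mult: "x \<in> OK \<Longrightarrow> y \<in> OK \<Longrightarrow> x * y \<in> OK"
  and OK_of_int: "of_int k \<in> OK"
  by (auto simp: OK_iff K_add K_mult intro: algebraic_int_plus_times int_imp_algebraic_int)

lemma OK_int_combination:
  assumes "\<And>i. i \<in> I \<Longrightarrow> w i \<in> OK"
  shows "(\<Sum>i\<in>I. of_int (c i) * w i) \<in> OK"
proof -
  have "algebraic_int (of_int (c i) * w i)" if "i \<in> I" for i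
    using assms[OF that] by (auto simp: OK_iff intro: algebraic_int_plus_times(2) int_imp_algebraic_int)
  then show ?thesis using assms unfolding OK_iff
    by (auto intro!: K_sum K_mult algebraic_int_sum)
qed

text \<open>The determinant is a polynomial in algebraic integers and its square is rational, hence
  an integer. The integer \<open>n\<close> links the determinant, which lives in the ambient field,
  with the discriminant in \<open>rat\<close>.\<close>

lemma det_conj_mat_square:
  assumes w: "\<And>i. i < d \<Longrightarrow> w i \<in> OK"
  shows "\<exists>n. det (conj_mat w) ^ 2 = of_int n \<and>
    det (mat d d (\<lambda>(i, j). field_trace K (w i * w j))) = of_int n"
proof -
  have wK: "w i \<in> K" if "i < d" for i using w[OF that] by (simp add: OK_iff)
  have "algebraic_int (det (conj_mat w))"
    unfolding det_def'[OF conj_mat_carrier]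
  proof (intro algebraic_int_sum algebraic_int_plus_times(2) algebraic_int_prod)
    fix p i assume p: "p \<in> {p. p permutes {0..<d}}" and i: "i \<in> {0..<d}"
    then have "p i < d" using permutes_in_image[of p "{0..<d}" i] by simp
    then show "algebraic_int (conj_mat w $$ (i, p i))"
      using i w[of "p i"] algebraic_int_G[OF enum_G[of i], of "w (p i)"] by (simp add: conj_mat_def OK_iff)
  next
    fix p show "algebraic_int (signof p :: 'a)" by (rule int_imp_algebraic_int) (simp add: sign_def)
  qed
  then have "algebraic_int (det (conj_mat w) ^ 2)"
    by (simp add: power2_eq_square algebraic_int_plus_times)
  then have "det (conj_mat w) ^ 2 \<in> \<int>"
    by (rule rational_algebraic_int_is_int) (metis Rats_of_rat det_trace_mat wK)
  then obtain n where n: "det (conj_mat w) ^ 2 = of_int n" by (elim Ints_cases)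
  then have "(of_rat (det (mat d d (\<lambda>(i, j). field_trace K (w i * w j)))) :: 'a) = of_rat (of_int n)"
    using det_trace_mat[OF wK] by simp
  then have "det (mat d d (\<lambda>(i, j). field_trace K (w i * w j))) = of_int n"
    unfolding of_rat_eq_iff .
  then show ?thesis using n by blast
qed

lemma det_conj_mat_replace:
  assumes w: "\<And>i. i < d \<Longrightarrow> w i \<in> K" and i: "i < d"
  shows "det (conj_mat (w(i := \<Sum>j<d. of_rat (q j) * w j))) = of_rat (q i) * det (conj_mat w)"
proof -
  let ?v = "vec d (\<lambda>i. of_rat (q i) :: 'a)"
  have "conj_mat (w(i := \<Sum>j<d. of_rat (q j) * w j)) = replace_col (conj_mat w) (conj_mat w *\<^sub>v ?v) i"
    by (subst conj_mat_mult_vec[OF w]) (auto simp: conj_mat_def replace_col_def intro!: eq_matI)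
  then show ?thesis using cramer_lemma_mat[OF conj_mat_carrier _ i, of ?v w] i by simp
qed

text \<open>Among the families of \<open>d\<close> integers with nonzero determinant of conjugates,
  one with the least squared determinant is an integral basis: a fractional coordinate would allow a
  replacement with a smaller determinant.\<close>

lemma ex_integral_basis: "\<exists>w. integral_basis K w"
proof -
  define good where "good w \<longleftrightarrow> (\<forall>i<d. w i \<in> OK) \<and> det (conj_mat w) \<noteq> 0" for w
  \<comment> \<open>The squared determinant is an integer inside the ambient field;
    \<open>SOME\<close> extracts it so that a natural number can be minimised.\<close>
  define size where "size w = nat \<bar>SOME n::int. det (conj_mat w) ^ 2 = of_int n\<bar>" for w
  have size: "size w = nat \<bar>n\<bar>" if "det (conj_mat w) ^ 2 = of_int n" for w n
    using that by (simp add: size_def)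
  have "good (\<lambda>i. theta ^ i)"
    unfolding good_def
  proof (intro conjI allI impI)
    fix i
    have "algebraic_int (theta ^ i)" using algebraic_int_prod[of "{..<i}" "\<lambda>_. theta"] theta(2) by simp
    then show "theta ^ i \<in> OK" using theta(1) by (simp add: OK_iff K_power)
  next
    have "ratvs.span ((\<lambda>i. theta ^ i) ` {..<d}) = K"
      using theta_span theta by (auto simp: card_G ratvs.span_image_finite intro!: K_sum K_mult K_power)
    then show "det (conj_mat (\<lambda>i. theta ^ i)) \<noteq> 0" by (rule det_conj_mat_neq_0)
  qed
  then obtain w where w: "good w" and min: "\<And>w'. good w' \<Longrightarrow> size w \<le> size w'"
    using ex_has_least_nat[of good _ size] by blast
  have wO: "w i \<in> OK" and wK: "w i \<in> K" if "i < d" for i using w that by (auto simp: good_def OK_iff)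
  have det: "det (conj_mat w) \<noteq> 0" using w by (simp add: good_def)
  have indep: "q i = 0" if "(\<Sum>i<d. of_rat (q i) * w i) = 0" "i < d" for q i
    by (rule independent_if_det_conj_mat_neq_0[OF wK det that])
  have inj: "inj_on w {..<d}"
    by (rule ratvs.inj_on_if_independent_family) (auto intro: indep)
  have "ratvs.independent (w ` {..<d})"
    by (rule ratvs.independent_imageI[OF inj]) (auto intro: indep)
  then have span: "ratvs.span (w ` {..<d}) = K" using span_eq_K_if_independent[OF wK inj] by simp
  have iindep: "intmod.independent (w ` {..<d})"
  proof (rule intmod.independent_imageI[OF inj])
    fix c :: "nat \<Rightarrow> int" and i
    assume "(\<Sum>i<d. of_int (c i) * w i) = 0" "i \<in> {..<d}"
    then have "of_int (c i) = (0 :: rat)" by (intro indep[of "\<lambda>i. of_int (c i)"]) auto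
    then show "c i = 0" by simp
  qed simp
  have "intmod.span (w ` {..<d}) = OK"
  proof (intro equalityI subsetI)
    fix x assume "x \<in> intmod.span (w ` {..<d})"
    then obtain c where "x = (\<Sum>i<d. of_int (c i) * w i)" by (auto simp: intmod.span_image_finite)
    then show "x \<in> OK" using wO by (auto intro: OK_int_combination)
  next
    fix x assume x: "x \<in> OK"
    then obtain q where q: "x = (\<Sum>i<d. of_rat (q i) * w i)"
      using span by (auto simp: OK_iff ratvs.span_image_finite)
    have "q i \<in> \<int>" if i: "i < d" for i
    proof (rule ccontr)
      assume "q i \<notin> \<int>"
      \<comment> \<open>The replacement for \<open>w i\<close> is \<open>x\<close> minus
        \<open>\<lfloor>q i\<rfloor> * w i\<close>, still integral. By Cramer's rule it multiplies
        the determinant by \<open>frac (q i)\<close>, strictly between 0 and 1.\<close>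
      define q' where "q' = q(i := frac (q i))"
      define w' where "w' = w(i := \<Sum>j<d. of_rat (q' j) * w j)"
      have "(\<Sum>j<d. of_rat (q' j) * w j) = (\<Sum>j<d. of_rat (q j) * w j - (if j = i then of_int \<lfloor>q i\<rfloor> * w i else 0))"
        by (intro sum.cong) (auto simp: q'_def frac_def of_rat_diff algebra_simps)
      also have "\<dots> = x - of_int \<lfloor>q i\<rfloor> * w i" using i by (simp add: sum_subtractf q)
      finally have x': "(\<Sum>j<d. of_rat (q' j) * w j) = x + of_int (- \<lfloor>q i\<rfloor>) * w i" by simp
      have "x + of_int (- \<lfloor>q i\<rfloor>) * w i \<in> OK"
        by (intro OK_add OK_mult OK_of_int x wO i)
      then have w'O: "w' j \<in> OK" if "j < d" for j using that wO by (simp add: w'_def x')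
      have fr: "0 < frac (q i)" "frac (q i) < 1" using \<open>q i \<notin> \<int>\<close> frac_lt_1 by auto
      have det': "det (conj_mat w') = of_rat (frac (q i)) * det (conj_mat w)"
        unfolding w'_def by (subst det_conj_mat_replace[OF wK i]) (simp_all add: q'_def)
      then have good': "good w'" using w'O fr det by (simp add: good_def)
      obtain n where n: "det (conj_mat w) ^ 2 = of_int n" using det_conj_mat_square[of w] wO by auto
      obtain n' where n': "det (conj_mat w') ^ 2 = of_int n'" using det_conj_mat_square[of w'] w'O by auto
      have n0: "n \<noteq> 0" using n det by auto
      have "(of_rat (of_int n') :: 'a) = of_rat (frac (q i) ^ 2 * of_int n)"
        using n n' det' by (simp add: power_mult_distrib of_rat_mult of_rat_power)
      then have eq: "of_int n' = frac (q i) ^ 2 * of_int n" unfolding of_rat_eq_iff .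
      have "of_int \<bar>n'\<bar> = frac (q i) ^ 2 * of_int \<bar>n\<bar>" by (simp add: eq abs_mult)
      also have "\<dots> < 1 * of_int \<bar>n\<bar>"
        using fr n0 by (intro mult_strict_right_mono) (auto simp: power_less_one_iff abs_square_less_1)
      finally have "\<bar>n'\<bar> < \<bar>n\<bar>" by simp
      then have "size w' < size w" using size[OF n] size[OF n'] by simp
      then show False using min[OF good'] by simp
    qed
    then have "\<forall>i. \<exists>k. i < d \<longrightarrow> q i = of_int k" by (metis Ints_cases)
    then obtain k where "\<And>i. i < d \<Longrightarrow> q i = of_int (k i)" by metis
    then have "x = (\<Sum>i<d. of_int (k i) * w i)" unfolding q by simp
    then show "x \<in> intmod.span (w ` {..<d})" by (auto simp: intmod.span_image_finite)
  qed
  then have "integral_basis K w" using inj iindep by (simp add: integral_basis_def)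
  then show ?thesis by blast
qed

text \<open>The same choice term as in \<open>field_discriminant\<close>, so that the discriminant
  unfolds to this very basis.\<close>

definition "ibasis = (SOME w. integral_basis K w)"

lemma ibasis: "integral_basis K ibasis"
  unfolding ibasis_def by (rule someI_ex[OF ex_integral_basis])

lemma ibasis_OK: "i < d \<Longrightarrow> ibasis i \<in> OK"
  using ibasis intmod.span_base[of "ibasis i" "ibasis ` {..<d}"] by (auto simp: integral_basis_def)

lemma ibasis_K: "i < d \<Longrightarrow> ibasis i \<in> K"
  using ibasis_OK by (simp add: OK_iff)

lemma OK_ibasis: "x \<in> OK \<Longrightarrow> \<exists>c. x = (\<Sum>i<d. of_int (c i) * ibasis i)"
  using ibasis by (auto simp: integral_basis_def intmod.span_image_finite)

text \<open>An integral basis is by definition independent over the integers; clearing denominators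
  makes it independent over the rationals.\<close>

lemma span_ibasis: "ratvs.span (ibasis ` {..<d}) = K"
proof (rule span_eq_K_if_independent[OF ibasis_K])
  have ib: "inj_on ibasis {..<d}" "intmod.independent (ibasis ` {..<d})"
    using ibasis by (auto simp: integral_basis_def)
  show "inj_on ibasis {..<d}" by fact
  show "ratvs.independent (ibasis ` {..<d})"
  proof (rule ratvs.independent_imageI[OF ib(1)])
    fix q :: "nat \<Rightarrow> rat" and i assume z: "(\<Sum>i<d. of_rat (q i) * ibasis i) = 0" and i: "i \<in> {..<d}"
    obtain c k where ck: "c > 0" "\<And>i. i \<in> {..<d} \<Longrightarrow> of_int c * q i = of_int (k i)"
      using common_denominator[of "{..<d}" q] by blast
    have "(\<Sum>i<d. of_int (k i) * ibasis i) = (\<Sum>i<d. of_rat (of_int c * q i) * ibasis i)"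
      by (simp add: ck(2))
    also have "\<dots> = of_int c * (\<Sum>i<d. of_rat (q i) * ibasis i)"
      by (simp add: of_rat_mult sum_distrib_left mult.assoc)
    finally have "(\<Sum>i<d. of_int (k i) * ibasis i) = 0" using z by simp
    then have "k i = 0" using intmod.independent_imageD[OF ib(2,1)] i by blast
    then show "q i = 0" using ck(1) ck(2)[OF i] by simp
  qed simp
qed

lemma det_ibasis: "det (conj_mat ibasis) \<noteq> 0"
  by (rule det_conj_mat_neq_0[OF span_ibasis])

lemma discriminant:
  "of_rat (field_discriminant K) = det (conj_mat ibasis) ^ 2"
  "\<exists>n. field_discriminant K = of_int n \<and> n \<noteq> 0"
proof -
  have eq: "field_discriminant K = det (mat d d (\<lambda>(i, j). field_trace K (ibasis i * ibasis j)))"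
    by (simp add: field_discriminant_def ibasis_def Let_def)
  show "of_rat (field_discriminant K) = det (conj_mat ibasis) ^ 2"
    unfolding eq by (rule det_trace_mat[OF ibasis_K])
  obtain n where n: "det (conj_mat ibasis) ^ 2 = of_int n" "field_discriminant K = of_int n"
    using det_conj_mat_square[of ibasis] ibasis_OK unfolding eq by auto
  moreover have "n \<noteq> 0" using n(1) det_ibasis by auto
  ultimately show "\<exists>n. field_discriminant K = of_int n \<and> n \<noteq> 0" by blast
qed

end

section \<open>Complex embeddings\<close>

text \<open>One rational polynomial can be evaluated in the ambient field of \<open>K\<close> and in
  the complex numbers, which is how elements are carried from one field to the other.\<close>

definition ev :: "rat poly \<Rightarrow> 'b::field_char_0 \<Rightarrow> 'b" where
  "ev P x = poly (map_poly of_rat P) x"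

lemma
  fixes x :: "'b::field_char_0"
  shows ev_add: "ev (P + Q) x = ev P x + ev Q x"
  and ev_mult: "ev (P * Q) x = ev P x * ev Q x"
  and ev_diff: "ev (P - Q) x = ev P x - ev Q x"
  and ev_const: "ev [:q:] x = of_rat q"
proof -
  interpret m: map_poly_comm_ring_hom "of_rat :: rat \<Rightarrow> 'b" ..
  show "ev (P + Q) x = ev P x + ev Q x" "ev (P * Q) x = ev P x * ev Q x"
    "ev (P - Q) x = ev P x - ev Q x"
    unfolding ev_def m.hom_add m.hom_mult m.hom_minus by simp_all
  show "ev [:q:] x = of_rat q" by (simp add: ev_def poly_altdef degree_map_poly coeff_map_poly)
qed

lemma ev_altdef: "degree P < n \<Longrightarrow> ev P x = (\<Sum>i<n. of_rat (coeff P i) * x ^ i)"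
proof -
  assume *: "degree P < n"
  have "ev P x = (\<Sum>i\<le>degree P. of_rat (coeff P i) * x ^ i)"
    by (simp add: ev_def poly_altdef degree_map_poly coeff_map_poly)
  also have "\<dots> = (\<Sum>i<n. of_rat (coeff P i) * x ^ i)"
    using * by (intro sum.mono_neutral_left) (auto simp: coeff_eq_0)
  finally show ?thesis .
qed

lemma ev_cnj: "ev P (cnj z) = cnj (ev P z)"
proof -
  have "cnj (of_rat q) = of_rat q" for q
    by (cases q) (simp add: of_rat_rat)
  then show ?thesis by (simp add: ev_altdef[OF lessI])
qed

lemma det_scale_rows:
  fixes a :: "nat \<Rightarrow> 'b::comm_ring_1"
  shows "det (mat n n (\<lambda>(i, j). a i * f i j)) = (\<Prod>i<n. a i) * det (mat n n (\<lambda>(i, j). f i j))"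
proof -
  have "(\<Prod>i = 0..<n. mat n n (\<lambda>(i, j). a i * f i j) $$ (i, p i)) =
      (\<Prod>i<n. a i) * (\<Prod>i = 0..<n. mat n n (\<lambda>(i, j). f i j) $$ (i, p i))"
    if "p permutes {0..<n}" for p
  proof -
    have p: "p i < n" if "i < n" for i using permutes_in_image[OF \<open>p permutes {0..<n}\<close>, of i] that by simp
    have "(\<Prod>i = 0..<n. mat n n (\<lambda>(i, j). a i * f i j) $$ (i, p i)) = (\<Prod>i = 0..<n. a i * f i (p i))"
      using p by (intro prod.cong) auto
    moreover have "(\<Prod>i = 0..<n. mat n n (\<lambda>(i, j). f i j) $$ (i, p i)) = (\<Prod>i = 0..<n. f i (p i))"
      using p by (intro prod.cong) auto
    ultimately show ?thesis by (simp add: prod.distrib lessThan_atLeast0)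
  qed
  then show ?thesis
    by (simp add: det_def'[of _ n] sum_distrib_left mult.left_commute)
qed

section \<open>The minimal polynomial of \<open>theta\<close> and an embedding into the complex
  numbers\<close>

context galois_number_field
begin

lemma d_pos: "d > 0"
  using card_G G_id finite_G by (metis card_gt_0_iff empty_iff)

lemma ex_ev: "x \<in> K \<Longrightarrow> \<exists>P. ev P theta = x"
proof -
  assume "x \<in> K"
  then obtain c where c: "x = (\<Sum>i<d. of_rat (c i) * theta ^ i)" using theta_span by (auto simp: card_G)
  define P where "P = (\<Sum>i<d. monom (c i) i)"
  have co: "coeff P j = (if j < d then c j else 0)" for j
    unfolding P_def coeff_sum by (simp add: if_distrib[of "\<lambda>f. f j"] cong: if_cong)
  have "degree P < d"
  proof (rule ccontr)
    assume "\<not> degree P < d"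
    then have "coeff P (degree P) = 0" by (simp add: co)
    then have "P = 0" by simp
    then show False using \<open>\<not> degree P < d\<close> d_pos by simp
  qed
  then have "ev P theta = x" by (simp add: ev_altdef c co)
  then show ?thesis by blast
qed

lemma ev_theta_eq_0:
  assumes "degree P < d" "ev P theta = 0"
  shows "P = 0"
proof (rule poly_eqI)
  fix i
  have "(\<Sum>i<card G. of_rat (coeff P i) * theta ^ i) = 0"
    using assms by (simp add: ev_altdef card_G)
  then show "coeff P i = coeff 0 i"
    using theta_indep[of "coeff P" i] assms(1) by (cases "i < d") (auto simp: card_G coeff_eq_0)
qed

lemma ex_minpoly: "\<exists>f. degree f = d \<and> lead_coeff f = 1 \<and> ev f theta = 0"
proof -
  obtain P where P: "ev P theta = theta ^ d" using ex_ev[of "theta ^ d"] theta by (auto intro: K_power)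
  obtain c where c: "theta ^ d = (\<Sum>i<d. of_rat (c i) * theta ^ i)"
    using theta_span[of "theta ^ d"] theta by (auto simp: card_G intro: K_power)
  define f where "f = monom 1 d - (\<Sum>i<d. monom (c i) i)"
  have co: "coeff f j = (if j = d then 1 else if j < d then - c j else 0)" for j
    unfolding f_def coeff_sum coeff_diff by (simp add: if_distrib[of "\<lambda>f. f j"] coeff_sum cong: if_cong)
  have deg: "degree f = d"
  proof (rule antisym)
    show "degree f \<le> d" by (rule degree_le) (simp add: co)
    show "d \<le> degree f" by (rule le_degree) (simp add: co)
  qed
  have "ev f theta = (\<Sum>i<Suc d. of_rat (coeff f i) * theta ^ i)" by (rule ev_altdef) (simp add: deg)
  also have "\<dots> = theta ^ d - (\<Sum>i<d. of_rat (c i) * theta ^ i)"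
    by (simp add: co of_rat_minus sum_negf)
  finally have "ev f theta = 0" using c by simp
  then show ?thesis using deg co by auto
qed

definition "minpoly = (SOME f. degree f = d \<and> lead_coeff f = 1 \<and> ev f theta = 0)"

lemma minpoly: "degree minpoly = d" "lead_coeff minpoly = 1" "ev minpoly theta = 0"
  using someI_ex[OF ex_minpoly] unfolding minpoly_def by auto

lemma minpoly_dvd: "ev P theta = 0 \<Longrightarrow> minpoly dvd P"
proof -
  assume P: "ev P theta = 0"
  have "minpoly \<noteq> 0" using minpoly(2) by auto
  have "ev (P mod minpoly) theta = ev (P - minpoly * (P div minpoly)) theta"
    by (simp add: minus_mult_div_eq_mod)
  also have "\<dots> = 0" by (simp add: ev_diff ev_mult P minpoly)
  finally have z: "ev (P mod minpoly) theta = 0" .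
  have "degree (P mod minpoly) < d"
  proof (cases "P mod minpoly = 0")
    case False
    then show ?thesis using degree_mod_less'[OF \<open>minpoly \<noteq> 0\<close>] minpoly(1) by auto
  qed (simp add: d_pos)
  then have "P mod minpoly = 0" using z by (rule ev_theta_eq_0)
  then show ?thesis by (simp add: dvd_eq_mod_eq_0)
qed

lemma ex_complex_root: "\<exists>z::complex. ev minpoly z = 0"
proof -
  have "degree (map_poly of_rat minpoly :: complex poly) \<noteq> 0"
    using d_pos by (simp add: degree_map_poly minpoly)
  then have "\<not> constant (poly (map_poly of_rat minpoly :: complex poly))"
    by (simp add: constant_degree)
  then show ?thesis unfolding ev_def by (rule fundamental_theorem_of_algebra)
qed

definition "croot = (SOME z::complex. ev minpoly z = 0)"

lemma croot: "ev minpoly croot = 0"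
  unfolding croot_def by (rule someI_ex[OF ex_complex_root])

text \<open>The embedding sending \<open>theta\<close> to \<open>croot\<close>. Polynomials
  representing the same \<open>x\<close> differ by a multiple of \<open>minpoly\<close>, which
  vanishes at \<open>croot\<close>, so the choice does not matter on \<open>K\<close>; outside
  \<open>K\<close> the value is arbitrary.\<close>

definition iota :: "'a \<Rightarrow> complex" where
  "iota x = ev (SOME P. ev P theta = x) croot"

lemma iota_ev: "iota (ev P theta) = ev P croot"
proof -
  define Q where "Q = (SOME Q. ev Q theta = ev P theta)"
  have "ev Q theta = ev P theta" unfolding Q_def by (rule someI) (rule refl)
  then have "minpoly dvd Q - P" by (intro minpoly_dvd) (simp add: ev_diff)
  then obtain R where "Q - P = minpoly * R" by (rule dvdE)
  then have "ev (Q - P) croot = 0" by (simp add: ev_mult croot)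
  then show ?thesis by (simp add: iota_def Q_def[symmetric] ev_diff)
qed

lemma iota_add: "x \<in> K \<Longrightarrow> y \<in> K \<Longrightarrow> iota (x + y) = iota x + iota y"
  using ex_ev[of x] ex_ev[of y] by (metis ev_add iota_ev)

lemma iota_mult: "x \<in> K \<Longrightarrow> y \<in> K \<Longrightarrow> iota (x * y) = iota x * iota y"
  using ex_ev[of x] ex_ev[of y] by (metis ev_mult iota_ev)

lemma iota_of_rat [simp]: "iota (of_rat q) = of_rat q"
  by (metis ev_const iota_ev)

lemma iota_of_int [simp]: "iota (of_int k) = of_int k"
  using iota_of_rat[of "of_int k"] by simp

lemma iota_0 [simp]: "iota 0 = 0" and iota_1 [simp]: "iota 1 = 1"
  using iota_of_int[of 0] iota_of_int[of 1] by auto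

lemma iota_sum: "(\<And>i. i \<in> I \<Longrightarrow> f i \<in> K) \<Longrightarrow> iota (sum f I) = (\<Sum>i\<in>I. iota (f i))"
  by (induction I rule: infinite_finite_induct) (auto simp: iota_add K_sum)

lemma iota_prod: "(\<And>i. i \<in> I \<Longrightarrow> f i \<in> K) \<Longrightarrow> iota (prod f I) = (\<Prod>i\<in>I. iota (f i))"
  by (induction I rule: infinite_finite_induct) (auto simp: iota_mult K_prod)

lemma iota_power: "x \<in> K \<Longrightarrow> iota (x ^ n) = iota x ^ n"
  by (induction n) (auto simp: iota_mult K_power)

lemma iota_minus: "x \<in> K \<Longrightarrow> iota (- x) = - iota x"
  using iota_mult[of "of_int (- 1)" x] iota_of_int[of "- 1"] by (simp add: K_minus)

lemma iota_eq_0: "x \<in> K \<Longrightarrow> iota x = 0 \<longleftrightarrow> x = 0"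
proof
  assume x: "x \<in> K" "iota x = 0"
  show "x = 0"
  proof (rule ccontr)
    assume "x \<noteq> 0"
    then show False using iota_mult[OF x(1) K_inverse[OF x(1)]] x(2) by simp
  qed
qed simp

lemma ev_G: "g \<in> G \<Longrightarrow> x \<in> K \<Longrightarrow> g (ev P x) = ev P (g x)"
  by (simp add: ev_altdef[OF lessI] G_sum G_mult G_power K_mult K_power del: sum.lessThan_Suc)

lemma ev_iota: "x \<in> K \<Longrightarrow> iota (ev P x) = ev P (iota x)"
  by (simp add: ev_altdef[OF lessI] iota_sum iota_mult iota_power K_mult K_power del: sum.lessThan_Suc)

text \<open>The \<open>d\<close> distinct numbers \<open>iota (g theta)\<close> exhaust the complex
  roots of \<open>minpoly\<close>. Its coefficients are rational, so the conjugate of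
  \<open>croot\<close> is a root too and equals \<open>iota (t theta)\<close> for some
  \<open>t\<close>.\<close>

lemma ex_complex_conjugation: "\<exists>t\<in>G. \<forall>x\<in>K. cnj (iota x) = iota (t x)"
proof -
  let ?f = "map_poly of_rat minpoly :: complex poly"
  have f0: "?f \<noteq> 0" using minpoly(2) by (auto simp: map_poly_eq_0_iff)
  define R where "R = (\<lambda>g. iota (g theta)) ` G"
  have root: "poly ?f (iota (g theta)) = 0" if "g \<in> G" for g
    using that theta ev_iota[of "g theta" minpoly] ev_G[of g theta minpoly]
    by (simp add: ev_def[symmetric] G_closed minpoly)
  have inj: "inj_on (\<lambda>g. iota (g theta)) G"
  proof (rule inj_onI)
    fix g h assume gh: "g \<in> G" "h \<in> G" "iota (g theta) = iota (h theta)"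
    then have "iota (g theta - h theta) = 0"
      using theta by (simp add: iota_add[of "g theta" "- h theta", simplified] iota_minus G_closed K_minus)
    then have "g theta = h theta" using gh theta iota_eq_0[of "g theta - h theta"] by (simp add: G_closed K_diff)
    then show "g = h" using theta(3) gh by (auto simp: inj_on_def)
  qed
  have "card R = d" using inj by (simp add: R_def card_image card_G)
  have "R = {z. poly ?f z = 0}"
  proof (rule card_seteq)
    show "finite {z. poly ?f z = 0}" by (rule poly_roots_finite[OF f0])
    show "R \<subseteq> {z. poly ?f z = 0}" using root by (auto simp: R_def)
    show "card {z. poly ?f z = 0} \<le> card R"
      using card_poly_roots_bound[OF f0] \<open>card R = d\<close> by (simp add: degree_map_poly minpoly)
  qed
  moreover have "poly ?f (cnj croot) = 0" using ev_cnj[of minpoly croot] croot by (simp add: ev_def)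
  ultimately have "cnj croot \<in> R" by simp
  then obtain t where t: "t \<in> G" "cnj croot = iota (t theta)" by (auto simp: R_def)
  have "cnj (iota x) = iota (t x)" if x: "x \<in> K" for x
  proof -
    obtain P where P: "ev P theta = x" using ex_ev[OF x] by blast
    have "cnj (iota x) = ev P (iota (t theta))" unfolding P[symmetric] iota_ev ev_cnj[symmetric] t(2) ..
    also have "\<dots> = iota (t x)" unfolding P[symmetric]
      using t(1) theta by (simp add: ev_iota ev_G G_closed)
    finally show ?thesis .
  qed
  then show ?thesis using t(1) by blast
qed

text \<open>Complex conjugation transported to \<open>K\<close>. It is the identity when
  \<open>iota\<close> maps \<open>K\<close> into the reals, so \<open>tau = e\<close> stays possible
  throughout.\<close>

definition "tau = (SOME t. t \<in> G \<and> (\<forall>x\<in>K. cnj (iota x) = iota (t x)))"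

lemma tau: "tau \<in> G" "x \<in> K \<Longrightarrow> iota (tau x) = cnj (iota x)"
proof -
  have "\<exists>t. t \<in> G \<and> (\<forall>x\<in>K. cnj (iota x) = iota (t x))" using ex_complex_conjugation by blast
  then have "tau \<in> G \<and> (\<forall>x\<in>K. cnj (iota x) = iota (tau x))" unfolding tau_def by (rule someI_ex)
  then show "tau \<in> G" "x \<in> K \<Longrightarrow> iota (tau x) = cnj (iota x)" by auto
qed

text \<open>A real linear form for every embedding: \<open>g\<close> and \<open>tau g\<close> are complex conjugate embeddings, and
  together their forms \<open>Re + Im\<close> and \<open>Re - Im\<close> determine \<open>iota (g x)\<close>; for a real embedding the form is
  the embedding itself.  This treats real and complex places uniformly.\<close>

definition lform :: "('a \<Rightarrow> 'a) \<Rightarrow> 'a \<Rightarrow> real" where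
  "lform g x = Re (iota (g x)) + Im (iota (g x))"

lemma lform_tau: "g \<in> G \<Longrightarrow> x \<in> K \<Longrightarrow> lform (compose K tau g) x = Re (iota (g x)) - Im (iota (g x))"
  by (simp add: lform_def compose_eq tau G_closed)

text \<open>With a and b the real and imaginary parts, the two forms are a + b and a - b, and the
  sum of their squares is twice the squared modulus.\<close>

lemma cmod_iota_le:
  assumes "g \<in> G" "x \<in> K" "\<bar>lform g x\<bar> \<le> C" "\<bar>lform (compose K tau g) x\<bar> \<le> C"
  shows "cmod (iota (g x)) \<le> C"
proof (rule power2_le_imp_le)
  let ?a = "Re (iota (g x))" and ?b = "Im (iota (g x))"
  have "(?a + ?b)\<^sup>2 \<le> C\<^sup>2" "(?a - ?b)\<^sup>2 \<le> C\<^sup>2"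
    using assms lform_tau[OF assms(1,2)] by (auto simp: lform_def abs_le_square_iff[symmetric] intro: order_trans[OF _ abs_ge_self])
  then have "(?a + ?b)\<^sup>2 + (?a - ?b)\<^sup>2 \<le> 2 * C\<^sup>2" by simp
  then show "(cmod (iota (g x)))\<^sup>2 \<le> C\<^sup>2" by (simp add: cmod_power2 power2_sum power2_diff)
  show "0 \<le> C" using assms(3) by (rule order_trans[OF abs_ge_zero])
qed

lemma lform_add: "g \<in> G \<Longrightarrow> x \<in> K \<Longrightarrow> y \<in> K \<Longrightarrow> lform g (x + y) = lform g x + lform g y"
  by (simp add: lform_def G_add iota_add G_closed)

lemma lform_rat_mult: "g \<in> G \<Longrightarrow> x \<in> K \<Longrightarrow> lform g (of_rat q * x) = of_rat q * lform g x"
proof -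
  assume *: "g \<in> G" "x \<in> K"
  have "(of_rat q :: complex) = of_real (of_rat q)" by (cases q) (simp add: of_rat_rat)
  then show ?thesis using * by (simp add: lform_def G_mult iota_mult G_closed distrib_left)
qed

lemma lform_rat_combination:
  assumes "g \<in> G" "\<And>i. i \<in> I \<Longrightarrow> w i \<in> K"
  shows "lform g (\<Sum>i\<in>I. of_rat (q i) * w i) = (\<Sum>i\<in>I. of_rat (q i) * lform g (w i))"
  using assms(2)
proof (induction I rule: infinite_finite_induct)
  case (insert j I)
  then show ?case using assms(1) by (simp add: lform_add lform_rat_mult K_sum K_mult)
qed (use assms(1) in \<open>auto simp: lform_def\<close>)

section \<open>The determinant of the real forms\<close>

lemma sum_Im_mult_eq_0:
  assumes "x \<in> K" "y \<in> K"
  shows "(\<Sum>g\<in>G. Im (iota (g x) * iota (g y))) = 0"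
proof -
  have "(\<Sum>g\<in>G. iota (g x) * iota (g y)) = iota (\<Sum>g\<in>G. g (x * y))"
    using assms by (simp add: iota_sum G_closed K_mult G_mult iota_mult)
  also have "\<dots> = of_rat (field_trace K (x * y))"
    using field_trace[OF K_mult[OF assms]] by (metis iota_of_rat)
  finally have "Im (\<Sum>g\<in>G. iota (g x) * iota (g y)) = Im (of_rat (field_trace K (x * y)))" by simp
  moreover have "Im (of_rat q) = 0" for q by (cases q) (simp add: of_rat_rat)
  ultimately show ?thesis by simp
qed

lemma sum_cnj_mult_real:
  assumes "x \<in> K" "y \<in> K"
  shows "Im (\<Sum>g\<in>G. cnj (iota (g x)) * iota (g y)) = 0"
proof -
  let ?F = "\<lambda>g. cnj (iota (g x)) * iota (g y)"
  have "(\<Sum>g\<in>G. ?F g) = (\<Sum>g\<in>G. ?F (compose K tau g))"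
    by (rule sum.reindex_bij_betw[OF G_compose_bij[OF tau(1)], symmetric])
  also have "\<dots> = (\<Sum>g\<in>G. cnj (?F g))"
    using assms by (simp add: compose_eq tau G_closed)
  finally have "(\<Sum>g\<in>G. ?F g) = cnj (\<Sum>g\<in>G. ?F g)" by simp
  moreover have "Im s = 0" if "s = cnj s" for s using arg_cong[OF that, of Im] by simp
  ultimately show ?thesis by blast
qed

definition "lmat = mat d d (\<lambda>(k, i). lform (enum k) (ibasis i))"

text \<open>A product of forms is the real part of conj(z) z' plus the imaginary part of z z'.
  Summed over \<open>G\<close>, the second part is the imaginary part of a rational trace and
  vanishes. So the real forms have the same Gram matrix as the complex conjugates under the
  hermitian product, with determinant |det Z|^2.\<close>

lemma det_lmat_square: "det lmat ^ 2 = of_rat \<bar>field_discriminant K\<bar>"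
proof -
  define Z where "Z = mat d d (\<lambda>(k, i). iota (enum k (ibasis i)))"
  have Z: "Z \<in> carrier_mat d d" and lm: "lmat \<in> carrier_mat d d" by (auto simp: Z_def lmat_def)
  interpret cnj: comm_ring_hom cnj by unfold_locales auto
  have "map_mat of_rat (mat d d (\<lambda>(i, j). field_trace K (ibasis i * ibasis j))) = transpose_mat Z * Z"
  proof (rule eq_matI)
    fix i j assume "i < dim_row (transpose_mat Z * Z)" "j < dim_col (transpose_mat Z * Z)"
    then have ij: "i < d" "j < d" by (simp_all add: Z_def)
    have "(transpose_mat Z * Z) $$ (i, j) = (\<Sum>k<d. iota (enum k (ibasis i)) * iota (enum k (ibasis j)))"
      using ij by (auto simp: Z_def scalar_prod_def lessThan_atLeast0 intro!: sum.cong)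
    also have "\<dots> = iota (\<Sum>k<d. enum k (ibasis i * ibasis j))"
      using ij ibasis_K enum_G by (subst iota_sum) (auto simp: G_mult iota_mult G_closed K_mult)
    also have "\<dots> = iota (of_rat (field_trace K (ibasis i * ibasis j)))"
      using ij ibasis_K by (simp add: sum_enum[of "\<lambda>g. g (ibasis i * ibasis j)"] field_trace K_mult del: iota_of_rat)
    finally show "map_mat of_rat (mat d d (\<lambda>(i, j). field_trace K (ibasis i * ibasis j))) $$ (i, j) =
      (transpose_mat Z * Z) $$ (i, j)" using ij by simp
  qed (simp_all add: Z_def)
  then have "of_rat (field_discriminant K) = det (transpose_mat Z * Z)"
    unfolding field_discriminant_def ibasis_def[symmetric] Let_def by (metis of_rat_hom.hom_det)
  then have dZ: "of_rat (field_discriminant K) = det Z ^ 2"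
    using Z by (simp add: det_mult[of _ d] det_transpose[of _ d] power2_eq_square)
  have "map_mat of_real (transpose_mat lmat * lmat) = transpose_mat (map_mat cnj Z) * Z"
  proof (rule eq_matI)
    fix i j assume "i < dim_row (transpose_mat (map_mat cnj Z) * Z)" "j < dim_col (transpose_mat (map_mat cnj Z) * Z)"
    then have ij: "i < d" "j < d" by (simp_all add: Z_def)
    have K: "ibasis i \<in> K" "ibasis j \<in> K" using ij ibasis_K by auto
    have l: "lform g (ibasis i) * lform g (ibasis j) =
        Re (cnj (iota (g (ibasis i))) * iota (g (ibasis j))) + Im (iota (g (ibasis i)) * iota (g (ibasis j)))" for g
      by (simp add: lform_def algebra_simps)
    have "(transpose_mat lmat * lmat) $$ (i, j) = (\<Sum>k<d. lform (enum k) (ibasis i) * lform (enum k) (ibasis j))"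
      using ij by (auto simp: lmat_def scalar_prod_def lessThan_atLeast0 intro!: sum.cong)
    also have "\<dots> = (\<Sum>g\<in>G. lform g (ibasis i) * lform g (ibasis j))"
      by (rule sum_enum[of "\<lambda>g. lform g (ibasis i) * lform g (ibasis j)"])
    also have "\<dots> = Re (\<Sum>g\<in>G. cnj (iota (g (ibasis i))) * iota (g (ibasis j)))"
      unfolding l sum.distrib sum_Im_mult_eq_0[OF K] by simp
    finally have "of_real ((transpose_mat lmat * lmat) $$ (i, j)) = (\<Sum>g\<in>G. cnj (iota (g (ibasis i))) * iota (g (ibasis j)))"
      using sum_cnj_mult_real[OF K] by (simp add: complex_eq_iff)
    also have "\<dots> = (\<Sum>k<d. cnj (iota (enum k (ibasis i))) * iota (enum k (ibasis j)))"
      by (rule sum_enum[of "\<lambda>g. cnj (iota (g (ibasis i))) * iota (g (ibasis j))", symmetric])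
    also have "\<dots> = (transpose_mat (map_mat cnj Z) * Z) $$ (i, j)"
      using ij by (auto simp: Z_def scalar_prod_def lessThan_atLeast0 intro!: sum.cong)
    finally show "map_mat of_real (transpose_mat lmat * lmat) $$ (i, j) = (transpose_mat (map_mat cnj Z) * Z) $$ (i, j)"
      using ij by (simp add: lmat_def)
  qed (simp_all add: Z_def lmat_def)
  then have "of_real (det (transpose_mat lmat * lmat)) = det (transpose_mat (map_mat cnj Z) * Z)"
    by (metis of_real_hom.hom_det)
  also have "\<dots> = cnj (det Z) * det Z"
    using Z by (simp add: det_mult[of _ d] det_transpose[of _ d] cnj.hom_det)
  also have "\<dots> = of_real (cmod (det Z ^ 2))"
    by (simp add: norm_power mult.commute complex_mult_cnj cmod_power2)
  finally have "det (transpose_mat lmat * lmat) = cmod (det Z ^ 2)" unfolding of_real_eq_iff .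
  also have "\<dots> = cmod (of_rat (field_discriminant K))" by (simp add: dZ)
  also have "(of_rat (field_discriminant K) :: complex) = of_real (of_rat (field_discriminant K))"
    by (cases "field_discriminant K") (simp add: of_rat_rat)
  finally have "det (transpose_mat lmat * lmat) = \<bar>of_rat (field_discriminant K)\<bar>" by simp
  then show ?thesis
    using lm by (simp add: det_mult[of _ d] det_transpose[of _ d] power2_eq_square)
qed

lemma abs_discriminant_ge_1: "real_of_rat \<bar>field_discriminant K\<bar> \<ge> 1"
proof -
  obtain n where n: "field_discriminant K = of_int n" "n \<noteq> 0" using discriminant(2) by blast
  then have "\<bar>field_discriminant K\<bar> = of_int \<bar>n\<bar>" by simp
  then have "real_of_rat \<bar>field_discriminant K\<bar> = of_int \<bar>n\<bar>" by (metis of_rat_of_int_eq)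
  then show ?thesis using n(2) by simp
qed

end

section \<open>A small integer generating a normal basis\<close>

lemma prod_less_1:
  fixes f :: "'b \<Rightarrow> real"
  assumes "finite A" "A \<noteq> {}" "\<And>i. i \<in> A \<Longrightarrow> 0 \<le> f i \<and> f i < 1"
  shows "prod f A < 1"
proof -
  obtain i where i: "i \<in> A" using assms(2) by blast
  have "prod f A = f i * prod f (A - {i})" using assms(1) i by (rule prod.remove)
  also have "\<dots> \<le> f i * 1"
  proof (rule mult_left_mono)
    show "prod f (A - {i}) \<le> 1" using assms(3) by (intro prod_le_1) (auto intro: less_imp_le)
  qed (use assms(3) i in auto)
  also have "\<dots> < 1" using assms(3) i by simp
  finally show ?thesis .
qed

context galois_number_field
begin

abbreviation "e \<equiv> restrict id K"

lemma compose_e: "g \<in> G \<Longrightarrow> compose K e g = g" "g \<in> G \<Longrightarrow> compose K g e = g"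
  by (auto intro!: G_eqI G_compose G_id simp: compose_eq G_closed)

lemma tau_tau: "compose K tau tau = e"
proof (rule G_eqI)
  fix x assume x: "x \<in> K"
  have "iota (tau (tau x)) = iota x" using x tau by (simp add: G_closed)
  then have "iota (tau (tau x) + - x) = 0"
    using x tau by (subst iota_add) (auto simp: iota_minus G_closed K_minus)
  then have "tau (tau x) + - x = 0" using x tau iota_eq_0[of "tau (tau x) + - x"] by (simp add: G_closed K_add K_minus del: add_uminus_conv_diff)
  then show "compose K tau tau x = e x" using x by (simp add: compose_eq)
qed (auto intro: G_compose tau G_id)

lemma compose_tau_eq_iff:
  assumes "g \<in> G" "h \<in> G"
  shows "compose K tau g = h \<longleftrightarrow> g = compose K tau h"
proof -
  have *: "compose K tau (compose K tau g) = g" if "g \<in> G" for g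
  proof (rule G_eqI)
    fix x assume x: "x \<in> K"
    have "tau (tau y) = y" if "y \<in> K" for y using fun_cong[OF tau_tau, of y] that by (simp add: compose_eq)
    then show "compose K tau (compose K tau g) x = g x" using x that by (simp add: compose_eq G_closed)
  qed (use that tau in \<open>auto intro: G_compose\<close>)
  show ?thesis
  proof
    assume "compose K tau g = h"
    then show "g = compose K tau h" using *[OF assms(1)] by simp
  next
    assume "g = compose K tau h"
    then show "compose K tau g = h" using *[OF assms(2)] by simp
  qed
qed

text \<open>The norm is rational, an algebraic integer and nonzero, so it cannot be a product of
  factors of modulus below 1.\<close>

lemma ex_conjugate_ge_1:
  assumes x: "x \<in> OK" "x \<noteq> 0"
  shows "\<exists>g\<in>G. cmod (iota (g x)) \<ge> 1"
proof (rule ccontr)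
  assume *: "\<not> ?thesis"
  have xK: "x \<in> K" "algebraic_int x" using x by (auto simp: OK_iff)
  have "algebraic_int (\<Prod>g\<in>G. g x)" by (rule algebraic_int_prod) (rule algebraic_int_G[OF _ xK])
  then have "(\<Prod>g\<in>G. g x) \<in> \<int>" by (rule rational_algebraic_int_is_int[OF _ norm_Rats[OF xK(1)]])
  then obtain n where n: "(\<Prod>g\<in>G. g x) = of_int n" by (elim Ints_cases)
  have "g x \<noteq> 0" if "g \<in> G" for g using G_inj[OF that xK(1) K_zero] that x(2) by simp
  then have "(\<Prod>g\<in>G. g x) \<noteq> 0" using finite_G by simp
  then have n0: "n \<noteq> 0" using n by auto
  have "(\<Prod>g\<in>G. cmod (iota (g x))) = cmod (iota (\<Prod>g\<in>G. g x))"
    using xK by (simp add: iota_prod G_closed prod_norm)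
  also have "\<dots> = of_int \<bar>n\<bar>" by (simp add: n)
  also have "\<dots> \<ge> 1" using n0 by linarith
  finally have "(\<Prod>g\<in>G. cmod (iota (g x))) \<ge> 1" .
  moreover have "(\<Prod>g\<in>G. cmod (iota (g x))) < 1"
    using * finite_G G_id by (intro prod_less_1) (auto simp: not_le)
  ultimately show False by simp
qed

lemma sqrt_discriminant: "\<bar>det lmat\<bar> = sqrt (real_of_rat \<bar>field_discriminant K\<bar>)"
  using det_lmat_square by (metis real_sqrt_abs)

text \<open>Twice the weight \<open>c e\<close> of the next lemma; the factor 2 is the bound on
  forms from \<open>exists_int_vec_small_linear_forms\<close>.\<close>

definition "small_bound = 4 * (2 * real d) ^ (d - 1) * sqrt (real_of_rat \<bar>field_discriminant K\<bar>)"

lemma ex_small_integer: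
  "\<exists>\<beta>\<in>OK. \<beta> \<noteq> 0 \<and> \<bar>lform e \<beta>\<bar> \<le> small_bound \<and> (\<forall>g\<in>G - {e}. \<bar>lform g \<beta>\<bar> \<le> 1 / real d)"
proof -
  define S where "S = sqrt (real_of_rat \<bar>field_discriminant K\<bar>)"
  have S: "S > 0" using abs_discriminant_ge_1 by (simp add: S_def)
  \<comment> \<open>The weights have product \<open>2 * S\<close>, so dividing each form by its
    weight leaves a determinant of absolute value 1/2. Forms come out at most twice their weight,
    hence \<open>1 / (2 * real d)\<close> where \<open>1 / real d\<close> is wanted.\<close>
  define c where "c g = (if g = e then 2 * (2 * real d) ^ (d - 1) * S else 1 / (2 * real d))" for g
  have c: "c g > 0" for g using S d_pos by (simp add: c_def)
  define A where "A = mat d d (\<lambda>(k, i). inverse (c (enum k)) * lform (enum k) (ibasis i))"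
  have A: "A \<in> carrier_mat d d" by (simp add: A_def)
  have "(\<Prod>k<d. inverse (c (enum k))) = (\<Prod>g\<in>G. inverse (c g))"
    by (rule prod.reindex_bij_betw[OF enum])
  also have "\<dots> = inverse (c e) * (\<Prod>g\<in>G - {e}. inverse (c g))"
    by (rule prod.remove[OF finite_G G_id])
  also have "(\<Prod>g\<in>G - {e}. inverse (c g)) = (2 * real d) ^ (d - 1)"
    using finite_G G_id d_pos by (simp add: c_def card_G)
  also have "inverse (c e) * (2 * real d) ^ (d - 1) = inverse (2 * S)"
  proof -
    have "inverse (2 * P * S) * P = inverse (2 * S)" if "P \<noteq> 0" for P
      using that S by (simp add: field_simps)
    from this[of "(2 * real d) ^ (d - 1)"] show ?thesis using d_pos unfolding c_def by simp
  qed
  finally have dA: "det A = inverse (2 * S) * det lmat"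
    unfolding A_def lmat_def det_scale_rows by (rule arg_cong)
  have "\<bar>det A\<bar> = inverse (2 * S) * S"
    unfolding dA abs_mult sqrt_discriminant S_def[symmetric] using S by simp
  then have "\<bar>det A\<bar> = 1 / 2" using S by simp
  then have "det A \<noteq> 0" "\<bar>det A\<bar> < 1" by auto
  from exists_int_vec_small_linear_forms[OF A this] obtain x :: "nat \<Rightarrow> int"
    where nz: "\<exists>k<d. x k \<noteq> 0" and sm: "\<And>k. k < d \<Longrightarrow> \<bar>\<Sum>i<d. A $$ (k, i) * of_int (x i)\<bar> \<le> 2"
    by blast
  define \<beta> where "\<beta> = (\<Sum>i<d. of_rat (of_int (x i)) * ibasis i)"
  have "\<beta> = (\<Sum>i<d. of_int (x i) * ibasis i)" by (simp add: \<beta>_def)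
  then have OK: "\<beta> \<in> OK" using ibasis_OK by (auto intro: OK_int_combination)
  have "\<beta> \<noteq> 0"
  proof
    assume z: "\<beta> = 0"
    obtain k where k: "k < d" "x k \<noteq> 0" using nz by blast
    have "(of_int (x k) :: rat) = 0"
      by (rule independent_if_det_conj_mat_neq_0[of ibasis "\<lambda>i. of_int (x i)"])
        (use z k ibasis_K det_ibasis in \<open>auto simp: \<beta>_def\<close>)
    then show False using k by simp
  qed
  moreover have bnd: "\<bar>lform g \<beta>\<bar> \<le> 2 * c g" if g: "g \<in> G" for g
  proof -
    obtain k where k: "k < d" "g = enum k" using g enum by (auto simp: bij_betw_def)
    have "lform g \<beta> = (\<Sum>i<d. of_int (x i) * lform g (ibasis i))"
      unfolding \<beta>_def using g ibasis_K by (subst lform_rat_combination) auto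
    then have "(\<Sum>i<d. A $$ (k, i) * of_int (x i)) = inverse (c g) * lform g \<beta>"
      using k by (simp add: A_def sum_distrib_left mult_ac)
    then have "inverse (c g) * \<bar>lform g \<beta>\<bar> \<le> 2" using sm[OF k(1)] c[of g] by (simp add: abs_mult)
    then show ?thesis using c[of g] by (simp add: field_simps)
  qed
  moreover have "\<bar>lform e \<beta>\<bar> \<le> small_bound" using bnd[OF G_id] by (simp add: c_def S_def small_bound_def)
  moreover have "\<bar>lform g \<beta>\<bar> \<le> 1 / real d" if "g \<in> G - {e}" for g using bnd[of g] that by (simp add: c_def)
  ultimately show ?thesis using OK by blast
qed

end

locale galois_number_field_ge_2 = galois_number_field +
  assumes d_ge_2: "d \<ge> 2"
begin

lemma small_bound_ge_1: "small_bound \<ge> 1"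
proof -
  have "(2 * real d) ^ (d - 1) \<ge> 1" using d_ge_2 by (intro one_le_power) auto
  moreover have "sqrt (real_of_rat \<bar>field_discriminant K\<bar>) \<ge> 1" using abs_discriminant_ge_1 by simp
  ultimately have "4 * (2 * real d) ^ (d - 1) * sqrt (real_of_rat \<bar>field_discriminant K\<bar>) \<ge> 1 * 1"
    by (intro mult_mono) auto
  then show ?thesis by (simp add: small_bound_def)
qed

definition "beta = (SOME \<beta>. \<beta> \<in> OK \<and> \<beta> \<noteq> 0 \<and> \<bar>lform e \<beta>\<bar> \<le> small_bound \<and>
  (\<forall>g\<in>G - {e}. \<bar>lform g \<beta>\<bar> \<le> 1 / real d))"

lemma beta: "beta \<in> OK" "beta \<noteq> 0" "\<bar>lform e beta\<bar> \<le> small_bound"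
  "g \<in> G \<Longrightarrow> g \<noteq> e \<Longrightarrow> \<bar>lform g beta\<bar> \<le> 1 / real d"
proof -
  have "\<exists>\<beta>. \<beta> \<in> OK \<and> \<beta> \<noteq> 0 \<and> \<bar>lform e \<beta>\<bar> \<le> small_bound \<and>
    (\<forall>g\<in>G - {e}. \<bar>lform g \<beta>\<bar> \<le> 1 / real d)" using ex_small_integer by blast
  then have "beta \<in> OK \<and> beta \<noteq> 0 \<and> \<bar>lform e beta\<bar> \<le> small_bound \<and>
    (\<forall>g\<in>G - {e}. \<bar>lform g beta\<bar> \<le> 1 / real d)" unfolding beta_def by (rule someI_ex)
  then show "beta \<in> OK" "beta \<noteq> 0" "\<bar>lform e beta\<bar> \<le> small_bound"
    "g \<in> G \<Longrightarrow> g \<noteq> e \<Longrightarrow> \<bar>lform g beta\<bar> \<le> 1 / real d" by auto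
qed

lemma beta_K: "beta \<in> K" using beta(1) by (simp add: OK_iff)

lemma lform_beta_le: "g \<in> G \<Longrightarrow> \<bar>lform g beta\<bar> \<le> small_bound"
proof (cases "g = e")
  case False
  assume "g \<in> G"
  then have "\<bar>lform g beta\<bar> \<le> 1 / real d" using beta(4) False by simp
  also have "\<dots> \<le> 1" using d_pos by simp
  finally show ?thesis using small_bound_ge_1 by simp
qed (simp add: beta)

lemma cmod_beta_le: "g \<in> G \<Longrightarrow> cmod (iota (g beta)) \<le> small_bound"
  by (intro cmod_iota_le lform_beta_le G_compose tau beta_K)

text \<open>The modulus is controlled by the forms at \<open>g\<close> and at \<open>tau\<close>
  after \<open>g\<close>; both must be small ones, and as \<open>tau\<close> is an involution this
  excludes \<open>e\<close> and \<open>tau\<close>.\<close>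

lemma cmod_beta_le_small:
  assumes "g \<in> G" "g \<noteq> e" "g \<noteq> tau"
  shows "cmod (iota (g beta)) \<le> 1 / real d"
proof (rule cmod_iota_le[OF assms(1) beta_K])
  have "compose K tau g \<noteq> e"
    using compose_tau_eq_iff[OF assms(1) G_id] assms(3) compose_e(2)[OF tau(1)] by simp
  then show "\<bar>lform (compose K tau g) beta\<bar> \<le> 1 / real d"
    using assms(1) tau by (intro beta) (auto intro: G_compose)
qed (use assms beta in auto)

text \<open>If the form at \<open>e\<close> were at most (d - 1)/d, then so would be all forms,
  because \<open>d \<ge> 2\<close>, and every conjugate would have modulus below 1. The remaining
  \<open>d - 1\<close> forms add up to at most (d - 1)/d.\<close>

lemma sum_lform_beta_less: "(\<Sum>g\<in>G - {e}. \<bar>lform g beta\<bar>) < \<bar>lform e beta\<bar>"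
proof -
  have "\<bar>lform e beta\<bar> > (real d - 1) / real d"
  proof (rule ccontr)
    assume "\<not> ?thesis"
    then have le: "\<bar>lform g beta\<bar> \<le> (real d - 1) / real d" if "g \<in> G" for g
    proof (cases "g = e")
      case False
      then have "\<bar>lform g beta\<bar> \<le> 1 / real d" using beta(4) that by simp
      also have "\<dots> \<le> (real d - 1) / real d" using d_ge_2 by (intro divide_right_mono) auto
      finally show ?thesis .
    qed simp
    have "cmod (iota (g beta)) \<le> (real d - 1) / real d" if "g \<in> G" for g
      using that by (intro cmod_iota_le le beta_K G_compose tau)
    moreover have "(real d - 1) / real d < 1" using d_pos by simp
    ultimately show False using ex_conjugate_ge_1[OF beta(1,2)] by fastforce
  qed
  moreover have "(\<Sum>g\<in>G - {e}. \<bar>lform g beta\<bar>) \<le> (\<Sum>g\<in>G - {e}. 1 / real d)"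
    using beta(4) by (intro sum_mono) auto
  moreover have "(\<Sum>g\<in>G - {e}. 1 / real d) = (real d - 1) / real d"
    using finite_G G_id d_pos by (simp add: card_G of_nat_diff)
  ultimately show ?thesis by linarith
qed

text \<open>The matrix \<open>lform (g h) beta\<close> (\<open>g, h \<in> G\<close>) is strictly diagonally dominant up to a permutation.\<close>

lemma beta_conjugates_independent:
  assumes z: "(\<Sum>k<d. of_rat (q k) * enum k beta) = 0" and k: "k < d"
  shows "q k = 0"
proof (rule ccontr)
  assume "q k \<noteq> 0"
  define m where "m = Max ((\<lambda>k. \<bar>q k\<bar>) ` {..<d})"
  have m: "\<bar>q i\<bar> \<le> m" if "i < d" for i using that by (simp add: m_def)
  have "m \<in> (\<lambda>k. \<bar>q k\<bar>) ` {..<d}" unfolding m_def using d_pos by (intro Max_in) auto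
  then obtain j where j: "j < d" "\<bar>q j\<bar> = m" by auto
  have m0: "m > 0" using m[OF k] \<open>q k \<noteq> 0\<close> by linarith
  \<comment> \<open>The inverse of \<open>enum j\<close> moves \<open>enum j beta\<close> back to
    \<open>beta\<close>, so the largest coefficient \<open>q j\<close> meets the dominant form,
    while the other indices run through \<open>G - {e}\<close>.\<close>
  obtain g where g: "g \<in> G" "\<And>x. x \<in> K \<Longrightarrow> g (enum j x) = x" using G_inverse[OF enum_G[OF j(1)]] by metis
  define c where "c i = compose K g (enum i)" for i
  have bij: "bij_betw c {..<d} G"
    using bij_betw_trans[OF enum G_compose_bij[OF g(1)]] by (simp add: c_def[abs_def] comp_def)
  have cj: "c j = e"
    unfolding c_def using g enum_G[OF j(1)] by (intro G_eqI G_compose G_id) (auto simp: compose_eq)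
  have bij': "bij_betw c ({..<d} - {j}) (G - {e})"
    using bij_betw_DiffI[OF bij, of "{j}" "{e}"] cj j(1) by (simp add: G_id bij_betw_def)
  have lc: "lform g (enum i beta) = lform (c i) beta" for i by (simp add: lform_def c_def compose_eq beta_K)
  have "0 = lform g (\<Sum>k<d. of_rat (q k) * enum k beta)" using g(1) by (simp add: z lform_def)
  also have "\<dots> = (\<Sum>i<d. of_rat (q i) * lform (c i) beta)"
    using g(1) enum_G beta_K by (subst lform_rat_combination) (auto simp: G_closed lc)
  also have "\<dots> = of_rat (q j) * lform e beta + (\<Sum>i\<in>{..<d} - {j}. of_rat (q i) * lform (c i) beta)"
    using j(1) by (subst sum.remove[of _ j]) (auto simp: cj)
  finally have "\<bar>of_rat (q j) * lform e beta\<bar> = \<bar>\<Sum>i\<in>{..<d} - {j}. of_rat (q i) * lform (c i) beta\<bar>"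
    by linarith
  also have "\<dots> \<le> (\<Sum>i\<in>{..<d} - {j}. of_rat m * \<bar>lform (c i) beta\<bar>)"
  proof (intro order_trans[OF sum_abs] sum_mono)
    fix i assume "i \<in> {..<d} - {j}"
    then have "real_of_rat \<bar>q i\<bar> \<le> of_rat m" using m by (simp add: of_rat_less_eq)
    then show "\<bar>of_rat (q i) * lform (c i) beta\<bar> \<le> of_rat m * \<bar>lform (c i) beta\<bar>"
      unfolding abs_mult by (intro mult_right_mono) auto
  qed
  also have "\<dots> = of_rat m * (\<Sum>i\<in>{..<d} - {j}. \<bar>lform (c i) beta\<bar>)" by (simp add: sum_distrib_left)
  also have "(\<Sum>i\<in>{..<d} - {j}. \<bar>lform (c i) beta\<bar>) = (\<Sum>g\<in>G - {e}. \<bar>lform g beta\<bar>)"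
    by (rule sum.reindex_bij_betw[OF bij'])
  also have "of_rat m * \<dots> < of_rat m * \<bar>lform e beta\<bar>"
    using m0 by (intro mult_strict_left_mono sum_lform_beta_less) auto
  also have "\<dots> = \<bar>of_rat (q j) * lform e beta\<bar>" unfolding j(2)[symmetric] by (simp add: abs_mult)
  finally show False by (rule notE[OF less_irrefl])
qed

text \<open>The shift arises because \<open>normal_basis\<close> numbers from 1 and
  \<open>enum\<close> from 0.\<close>

lemma normal_basis_beta: "normal_basis K (\<lambda>i. enum (i - 1) beta)"
proof -
  let ?b = "\<lambda>k. enum k beta"
  have inj: "inj_on ?b {..<d}"
    by (rule ratvs.inj_on_if_independent_family) (auto intro: beta_conjugates_independent)
  have ind: "ratvs.independent (?b ` {..<d})"
    by (rule ratvs.independent_imageI[OF inj]) (auto intro: beta_conjugates_independent)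
  have span: "ratvs.span (?b ` {..<d}) = K"
    by (rule span_eq_K_if_independent[OF _ inj ind]) (auto simp: enum_G G_closed beta_K)
  have bij: "bij_betw (\<lambda>i. i - 1) {1..d} {..<d}"
    by (rule bij_betw_byWitness[of _ Suc]) auto
  have im: "(\<lambda>i. enum (i - 1) beta) ` {1..d} = ?b ` {..<d}"
    using image_image[of ?b "\<lambda>i. i - 1" "{1..d}"] bij_betw_imp_surj_on[OF bij] by simp
  have "inj_on (?b \<circ> (\<lambda>i. i - 1)) {1..d}"
    using bij inj by (intro comp_inj_on) (auto simp: bij_betw_def)
  moreover have "bij_betw (\<lambda>i. enum (i - 1)) {1..d} G"
    using bij_betw_trans[OF bij enum] by (simp add: comp_def)
  ultimately show ?thesis
    unfolding normal_basis_def im using ind span beta_K by (auto simp: comp_def)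
qed

end

section \<open>Absolute values\<close>

lemma padic_abs_of_int_le_1:
  assumes "prime p" shows "padic_abs p (of_int k) \<le> 1"
proof (cases "k = 0")
  case False
  have "p > 1" using assms prime_gt_1_nat by blast
  have "padic_abs p (of_int k) = real p powi (- int (multiplicity (int p) k))"
    using False by (simp add: padic_abs_def)
  also have "\<dots> = inverse (real p ^ multiplicity (int p) k)"
    by (simp add: power_int_minus)
  also have "\<dots> \<le> 1" using \<open>p > 1\<close> by (intro inverse_le_1_iff[THEN iffD2] disjI2 one_le_power) auto
  finally show ?thesis .
qed (simp add: padic_abs_def)

context galois_number_field
begin

lemma
  assumes "absolute_value_on K v"
  shows v_nonneg: "x \<in> K \<Longrightarrow> v x \<ge> 0"
    and v_eq_0: "x \<in> K \<Longrightarrow> v x = 0 \<longleftrightarrow> x = 0"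
    and v_mult: "x \<in> K \<Longrightarrow> y \<in> K \<Longrightarrow> v (x * y) = v x * v y"
    and v_add: "x \<in> K \<Longrightarrow> y \<in> K \<Longrightarrow> v (x + y) \<le> v x + v y"
  using assms by (auto simp: absolute_value_on_def)

lemma v_1: "absolute_value_on K v \<Longrightarrow> v 1 = 1"
  using v_mult[of v 1 1] v_eq_0[of v 1] by simp

lemma v_power: "absolute_value_on K v \<Longrightarrow> x \<in> K \<Longrightarrow> v (x ^ n) = v x ^ n"
  by (induction n) (auto simp: v_1 v_mult K_power)

lemma v_sum:
  assumes "absolute_value_on K v" "\<And>i. i \<in> I \<Longrightarrow> f i \<in> K"
  shows "v (sum f I) \<le> (\<Sum>i\<in>I. v (f i))"
  using assms(2)
proof (induction I rule: infinite_finite_induct)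
  case (insert j I)
  then have "v (f j + sum f I) \<le> v (f j) + v (sum f I)" by (intro v_add[OF assms(1)] K_sum) auto
  then show ?case using insert by fastforce
qed (use v_eq_0[OF assms(1) K_zero] in auto)

text \<open>All powers of \<open>x\<close> are integer combinations of one fixed integral basis, and
  rational integers have absolute value at most 1, so the powers stay bounded by the triangle
  inequality; a value above 1 would make them grow.\<close>

lemma nonarchimedean_integer_le_1:
  assumes v: "absolute_value_on K v" and p: "prime p" "\<And>q. v (of_rat q) = padic_abs p q" and x: "x \<in> OK"
  shows "v x \<le> 1"
proof (rule ccontr)
  assume "\<not> v x \<le> 1"
  then obtain n where n: "(\<Sum>i<d. v (ibasis i)) < v x ^ n" using real_arch_pow by (metis not_le)
  have xK: "x \<in> K" using x by (simp add: OK_iff)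
  have "x ^ n \<in> OK"
  proof (induction n)
    case 0
    show ?case using OK_of_int[of 1] by simp
  next
    case (Suc n)
    then show ?case using x by (simp add: OK_mult)
  qed
  then obtain c where c: "x ^ n = (\<Sum>i<d. of_int (c i) * ibasis i)" using OK_ibasis by blast
  have int: "v (of_int k) \<le> 1" for k using p(2)[of "of_int k"] padic_abs_of_int_le_1[OF p(1), of k] by simp
  have "v x ^ n \<le> (\<Sum>i<d. v (of_int (c i) * ibasis i))"
    unfolding v_power[OF v xK, symmetric] c using ibasis_K by (intro v_sum[OF v] K_mult) auto
  also have "\<dots> \<le> (\<Sum>i<d. v (ibasis i))"
  proof (rule sum_mono)
    fix i assume "i \<in> {..<d}"
    then show "v (of_int (c i) * ibasis i) \<le> v (ibasis i)"
      using ibasis_K[of i] int[of "c i"] v_nonneg[OF v, of "ibasis i"]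
      by (simp add: v_mult[OF v] mult_left_le_one_le v_nonneg[OF v])
  qed
  finally show False using n by simp
qed

text \<open>Rational coordinates in the integral basis are bounded by the real forms, so
  \<open>v\<close> is at most a constant \<open>D\<close> times the largest conjugate. Applying this
  to all powers of \<open>x\<close> removes the constant.\<close>

lemma archimedean_le:
  assumes v: "absolute_value_on K v" and arch: "\<And>q. v (of_rat q) = real_of_rat \<bar>q\<bar>"
    and x: "x \<in> K" and B: "\<And>g. g \<in> G \<Longrightarrow> cmod (iota (g x)) \<le> B"
  shows "v x \<le> B"
proof -
  have lm: "lmat \<in> carrier_mat d d" by (simp add: lmat_def)
  have "det lmat \<noteq> 0" using det_lmat_square abs_discriminant_ge_1 by auto
  then obtain C where C: "C > 0" "\<And>x. (\<Sum>k<d. norm (x k)) \<le> C * (\<Sum>i<d. norm (\<Sum>k<d. lmat $$ (i, k) * x k))"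
    using sum_norm_le_mult_linear_forms[OF lm] by blast
  define V where "V = (\<Sum>i<d. v (ibasis i))"
  have Vi: "v (ibasis i) \<le> V" if "i < d" for i
    unfolding V_def using that ibasis_K v_nonneg[OF v] by (intro member_le_sum) auto
  have V0: "V \<ge> 0" unfolding V_def using ibasis_K v_nonneg[OF v] by (intro sum_nonneg) auto
  define D where "D = V * (C * (real d * 2))"
  have main: "v y \<le> D * B'" if y: "y \<in> K" and B': "\<And>g. g \<in> G \<Longrightarrow> cmod (iota (g y)) \<le> B'" for y B'
  proof -
    obtain q where q: "y = (\<Sum>i<d. of_rat (q i) * ibasis i)"
      using y span_ibasis by (auto simp: ratvs.span_image_finite)
    have "v y \<le> (\<Sum>i<d. v (of_rat (q i) * ibasis i))"
      unfolding q using ibasis_K by (intro v_sum[OF v] K_mult) auto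
    also have "\<dots> \<le> (\<Sum>i<d. norm (real_of_rat (q i)) * V)"
    proof (rule sum_mono)
      fix i assume "i \<in> {..<d}"
      then show "v (of_rat (q i) * ibasis i) \<le> norm (real_of_rat (q i)) * V"
        using ibasis_K[of i] Vi[of i] by (simp add: v_mult[OF v] arch mult_left_mono)
    qed
    also have "\<dots> = V * (\<Sum>i<d. norm (real_of_rat (q i)))" by (simp add: sum_distrib_left mult.commute)
    also have "\<dots> \<le> V * (C * (\<Sum>k<d. norm (\<Sum>i<d. lmat $$ (k, i) * real_of_rat (q i))))"
      by (intro mult_left_mono C V0)
    also have "\<dots> = V * (C * (\<Sum>k<d. \<bar>lform (enum k) y\<bar>))"
    proof -
      have "(\<Sum>i<d. lmat $$ (k, i) * real_of_rat (q i)) = lform (enum k) y" if "k < d" for k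
        unfolding q using that enum_G ibasis_K
        by (subst lform_rat_combination) (auto simp: lmat_def mult.commute)
      then show ?thesis by simp
    qed
    also have "\<dots> \<le> V * (C * (\<Sum>k<d. 2 * B'))"
    proof (intro mult_left_mono sum_mono)
      fix k assume "k \<in> {..<d}"
      then have "cmod (iota (enum k y)) \<le> B'" by (intro B' enum_G) simp
      then show "\<bar>lform (enum k) y\<bar> \<le> 2 * B'"
        using abs_Re_le_cmod[of "iota (enum k y)"] abs_Im_le_cmod[of "iota (enum k y)"]
        unfolding lform_def by linarith
    qed (use C V0 in auto)
    also have "\<dots> = D * B'" by (simp add: D_def)
    finally show ?thesis .
  qed
  have D0: "D \<ge> 0" using V0 C by (simp add: D_def)
  have B0: "B \<ge> 0" using B[OF G_id] by (rule order_trans[OF norm_ge_zero])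
  show ?thesis
  proof (rule ccontr)
    assume n: "\<not> v x \<le> B"
    have pow: "v x ^ n \<le> D * B ^ n" for n
      unfolding v_power[OF v x, symmetric]
      by (rule main) (auto simp: x K_power G_power iota_power G_closed norm_power intro!: power_mono B)
    show False
    proof (cases "B = 0")
      case True
      then show False using n pow[of 1] by simp
    next
      case False
      then have "v x / B > 1" using n B0 by (simp add: field_simps)
      then obtain k where k: "D < (v x / B) ^ k" using real_arch_pow by blast
      have "(v x / B) ^ k \<le> D" using pow[of k] False B0 by (simp add: power_divide field_simps)
      then show False using k by simp
    qed
  qed
qed

end

section \<open>Archimedean absolute values come from embeddings\<close>

context galois_number_field_ge_2
begin

text \<open>\<open>beta\<close> is large at a single archimedean place; multiplied by its complex conjugate it becomes real
  there, so that the large conjugates cannot cancel in the traces of its powers.\<close>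

lemma ex_dominant_element:
  "\<exists>\<gamma>\<in>K. \<exists>a\<ge>1. iota \<gamma> = complex_of_real a \<and> iota (tau \<gamma>) = complex_of_real a \<and>
    (\<forall>g\<in>G - {e, tau}. cmod (iota (g \<gamma>)) \<le> 1 / 4)"
proof -
  define \<gamma> where "\<gamma> = beta * tau beta"
  define a where "a = (cmod (iota beta))\<^sup>2"
  have tbK: "tau beta \<in> K" using tau beta_K by (simp add: G_closed)
  have \<gamma>K: "\<gamma> \<in> K" by (simp add: \<gamma>_def K_mult beta_K tbK)
  have i\<gamma>: "iota \<gamma> = of_real a"
    unfolding \<gamma>_def a_def by (simp only: iota_mult[OF beta_K tbK] tau(2)[OF beta_K] complex_norm_square)
  have it\<gamma>: "iota (tau \<gamma>) = of_real a" by (simp add: tau(2)[OF \<gamma>K] i\<gamma>)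
  have small: "cmod (iota (g \<gamma>)) \<le> 1 / 4" if g: "g \<in> G" "g \<noteq> e" "g \<noteq> tau" for g
  proof -
    \<comment> \<open>\<open>g \<gamma>\<close> is the product of \<open>g beta\<close> and
      \<open>h beta\<close>. Neither \<open>g\<close> nor \<open>h\<close> is \<open>e\<close> or
      \<open>tau\<close>, so both factors have modulus at most 1/d, which is at most 1/2: the origin
      of 1/4.\<close>
    define h where "h = compose K g tau"
    have h: "h \<in> G" using g tau by (simp add: h_def G_compose)
    have hh: "compose K h tau = g"
    proof (rule G_eqI[OF G_compose[OF h tau(1)] g(1)])
      fix x assume x: "x \<in> K"
      have "tau (tau x) = x" using fun_cong[OF tau_tau, of x] x by (simp add: compose_eq)
      then show "compose K h tau x = g x" using x tau by (simp add: h_def compose_eq G_closed)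
    qed
    have "h \<noteq> e" using hh g(3) compose_e(1)[OF tau(1)] by auto
    moreover have "h \<noteq> tau" using hh g(2) tau_tau by auto
    ultimately have "cmod (iota (h beta)) \<le> 1 / real d" using h by (intro cmod_beta_le_small)
    moreover have "cmod (iota (g beta)) \<le> 1 / real d" using g by (intro cmod_beta_le_small)
    moreover have "1 / real d \<le> 1 / 2" using d_ge_2 by (intro divide_left_mono) auto
    ultimately have "cmod (iota (g beta)) * cmod (iota (h beta)) \<le> 1 / 2 * (1 / 2)"
      by (intro mult_mono) auto
    then show ?thesis unfolding \<gamma>_def h_def
      using g by (simp add: G_mult beta_K tbK iota_mult G_closed norm_mult compose_eq)
  qed
  have "a \<ge> 1"
  proof (rule ccontr)
    assume "\<not> a \<ge> 1"
    moreover have "a \<ge> 0" by (simp add: a_def)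
    ultimately have "cmod (iota (g \<gamma>)) < 1" if "g \<in> G" for g
      using that small[of g] i\<gamma> it\<gamma> \<gamma>K by (cases "g = e \<or> g = tau") auto
    moreover have "\<gamma> \<in> OK" unfolding \<gamma>_def using beta(1) tbK
      by (intro OK_mult) (auto simp: OK_iff beta_K intro: algebraic_int_G tau)
    moreover have "\<gamma> \<noteq> 0" using beta(2) G_inj[OF tau(1) beta_K K_zero] tau(1) by (simp add: \<gamma>_def)
    ultimately show False using ex_conjugate_ge_1[of \<gamma>] by fastforce
  qed
  then show ?thesis using \<gamma>K i\<gamma> it\<gamma> small by blast
qed

text \<open>The trace of \<open>\<gamma> ^ n\<close> is rational, so \<open>v\<close> and the usual
  absolute value agree on it. The latter is at least a^n - (d - 1)/4^n, the former at most d m^n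
  with m the largest \<open>v (g \<gamma>)\<close>. If m < a, division by a^n yields 1 \<le> 0 in
  the limit.\<close>

lemma archimedean_large_conjugate:
  assumes v: "absolute_value_on K v" and arch: "\<And>q. v (of_rat q) = real_of_rat \<bar>q\<bar>"
    and \<gamma>: "\<gamma> \<in> K" "a \<ge> 1" "iota \<gamma> = complex_of_real a" "iota (tau \<gamma>) = complex_of_real a"
      "\<forall>g\<in>G - {e, tau}. cmod (iota (g \<gamma>)) \<le> 1 / 4"
  shows "\<exists>g\<in>G. v (g \<gamma>) \<ge> a"
proof (rule ccontr)
  assume *: "\<not> ?thesis"
  define m where "m = Max ((\<lambda>g. v (g \<gamma>)) ` G)"
  have "m \<in> (\<lambda>g. v (g \<gamma>)) ` G" unfolding m_def using finite_G G_id by (intro Max_in) auto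
  then have m: "0 \<le> m" "m < a" using * v_nonneg[OF v] \<gamma>(1) by (auto simp: G_closed not_le)
  have vm: "v (g \<gamma>) \<le> m" if "g \<in> G" for g using that finite_G by (simp add: m_def)
  have ineq: "1 \<le> d * (m / a) ^ n + d * ((1 / 4) / a) ^ n" for n
  proof -
    define T where "T = (\<Sum>g\<in>G. g (\<gamma> ^ n))"
    have TK: "\<gamma> ^ n \<in> K" using \<gamma>(1) by (rule K_power)
    have "T \<in> \<rat>" unfolding T_def using TK by (rule trace_Rats)
    then obtain q where q: "T = of_rat q" by (elim Rats_cases)
    have "iota T = (\<Sum>g\<in>G. iota (g \<gamma>) ^ n)"
      unfolding T_def using \<gamma>(1) TK by (subst iota_sum) (auto simp: G_closed G_power iota_power K_power)
    then have "Re (iota T) = (\<Sum>g\<in>G. Re (iota (g \<gamma>) ^ n))" by simp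
    also have "\<dots> = Re (iota (e \<gamma>) ^ n) + (\<Sum>g\<in>G - {e}. Re (iota (g \<gamma>) ^ n))"
      by (rule sum.remove[OF finite_G G_id])
    also have "\<dots> \<ge> a ^ n + (\<Sum>g\<in>G - {e}. - ((1 / 4) ^ n))"
    proof (rule add_mono)
      show "a ^ n \<le> Re (iota (e \<gamma>) ^ n)" using \<gamma>(1) by (simp add: \<gamma>(3) flip: of_real_power)
      show "(\<Sum>g\<in>G - {e}. - ((1 / 4) ^ n)) \<le> (\<Sum>g\<in>G - {e}. Re (iota (g \<gamma>) ^ n))"
      proof (rule sum_mono)
        fix g assume g: "g \<in> G - {e}"
        show "- ((1 / 4) ^ n) \<le> Re (iota (g \<gamma>) ^ n)"
        \<comment> \<open>When \<open>tau\<close> differs from \<open>e\<close>, its term is again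
          the positive \<open>a ^ n\<close>, so it cannot cancel the term of
          \<open>e\<close>.\<close>
        proof (cases "g = tau")
          case True
          have "- ((1 / 4) ^ n) \<le> (0 :: real)" by simp
          also have "\<dots> \<le> a ^ n" using \<gamma>(2) by simp
          finally show ?thesis using True by (simp add: \<gamma>(4) flip: of_real_power)
        next
          case False
          then have "cmod (iota (g \<gamma>)) ^ n \<le> (1 / 4) ^ n" using g \<gamma>(5) by (intro power_mono) auto
          then show ?thesis using abs_Re_le_cmod[of "iota (g \<gamma>) ^ n"] by (simp add: norm_power)
        qed
      qed
    qed
    also have "(\<Sum>g\<in>G - {e}. - ((1 / 4 :: real) ^ n)) = - (real (d - 1) * (1 / 4) ^ n)"
      using finite_G G_id by (simp add: card_G)
    finally have "Re (iota T) \<ge> a ^ n - real (d - 1) * (1 / 4) ^ n" by simp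
    then have "a ^ n - real (d - 1) * (1 / 4) ^ n \<le> cmod (iota T)"
      using complex_Re_le_cmod[of "iota T"] by linarith
    also have "(of_rat q :: complex) = of_real (of_rat q)" by (cases q) (simp add: of_rat_rat)
    then have "cmod (iota T) = real_of_rat \<bar>q\<bar>" by (simp add: q)
    also have "\<dots> = v T" by (simp add: q arch)
    also have "\<dots> \<le> (\<Sum>g\<in>G. v (g (\<gamma> ^ n)))" unfolding T_def by (rule v_sum[OF v]) (rule G_closed[OF _ TK])
    also have "\<dots> \<le> (\<Sum>g\<in>G. m ^ n)"
      using \<gamma>(1) vm v_nonneg[OF v] by (intro sum_mono) (auto simp: G_power v_power[OF v] G_closed intro!: power_mono)
    also have "\<dots> = d * m ^ n" by (simp add: card_G)
    finally have "a ^ n \<le> d * m ^ n + real (d - 1) * (1 / 4) ^ n" by simp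
    also have "\<dots> \<le> d * m ^ n + d * (1 / 4) ^ n" by (intro add_left_mono mult_right_mono) auto
    finally show ?thesis using \<gamma>(2) by (simp add: power_divide field_simps)
  qed
  have "(\<lambda>n. d * (m / a) ^ n + d * ((1 / 4) / a) ^ n) \<longlonglongrightarrow> real d * 0 + real d * 0"
    using m \<gamma>(2) by (intro tendsto_add tendsto_mult_left LIMSEQ_realpow_zero) (auto simp: field_simps)
  then have "1 \<le> real d * 0 + real d * 0"
    by (rule LIMSEQ_le_const) (use ineq in auto)
  then show False by simp
qed

text \<open>Multiplying \<open>y\<close> by a high power of \<open>\<gamma>\<close> makes the
  conjugates outside \<open>e\<close> and \<open>tau\<close> negligible, and
  \<open>archimedean_le\<close> then gives \<open>v (g y) \<le> cmod (iota y)\<close>. The same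
  inequality for \<open>inverse y\<close> forces equality, and \<open>h\<close> is the inverse of
  \<open>g\<close>.\<close>

lemma archimedean_place_embedding:
  assumes v: "absolute_value_on K v" and arch: "\<And>q. v (of_rat q) = real_of_rat \<bar>q\<bar>"
  shows "\<exists>h\<in>G. \<forall>x\<in>K. v x = cmod (iota (h x))"
proof -
  obtain \<gamma> a where \<gamma>: "\<gamma> \<in> K" "a \<ge> 1" "iota \<gamma> = complex_of_real a" "iota (tau \<gamma>) = complex_of_real a"
      "\<forall>g\<in>G - {e, tau}. cmod (iota (g \<gamma>)) \<le> 1 / 4"
    using ex_dominant_element by blast
  obtain g where g: "g \<in> G" "v (g \<gamma>) \<ge> a" using archimedean_large_conjugate[OF v arch \<gamma>] by blast
  have le: "v (g y) \<le> cmod (iota y)" if y: "y \<in> K" "y \<noteq> 0" for y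
  proof -
    define Y where "Y = (\<Sum>h\<in>G. cmod (iota (h y)))"
    have c: "cmod (iota y) > 0" using y iota_eq_0 by simp
    have "(\<lambda>n. Y * ((1 / 4) / a) ^ n) \<longlonglongrightarrow> Y * 0"
      using \<gamma>(2) by (intro tendsto_mult_left LIMSEQ_realpow_zero) (auto simp: field_simps)
    then have "\<forall>\<^sub>F n in sequentially. Y * ((1 / 4) / a) ^ n < cmod (iota y)"
      using c by (intro order_tendstoD(2)) auto
    then obtain n where n: "Y * ((1 / 4) / a) ^ n < cmod (iota y)"
      using eventually_happens'[OF sequentially_bot] by blast
    then have n': "Y * (1 / 4) ^ n \<le> cmod (iota y) * a ^ n"
      using \<gamma>(2) by (simp add: power_divide field_simps)
    have \<gamma>n: "\<gamma> ^ n \<in> K" using \<gamma>(1) by (rule K_power)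
    have "v (g y) * a ^ n \<le> v (g y) * v (g \<gamma>) ^ n"
      using g \<gamma>(2) y v_nonneg[OF v] by (intro mult_left_mono power_mono) (auto simp: G_closed)
    also have "\<dots> = v (g (y * \<gamma> ^ n))"
      using y g(1) \<gamma>(1) \<gamma>n by (simp add: G_mult G_power v_mult[OF v] v_power[OF v] G_closed K_power)
    also have "\<dots> \<le> cmod (iota y) * a ^ n"
    proof (rule archimedean_le[OF v arch])
      show "g (y * \<gamma> ^ n) \<in> K" using g(1) y \<gamma>n by (simp add: G_closed K_mult)
      fix h assume h: "h \<in> G"
      define k where "k = compose K h g"
      have k: "k \<in> G" using h g by (simp add: k_def G_compose)
      have "cmod (iota (h (g (y * \<gamma> ^ n)))) = cmod (iota (k (y * \<gamma> ^ n)))"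
        using y \<gamma>n by (simp add: k_def compose_eq K_mult)
      also have "\<dots> = cmod (iota (k y)) * cmod (iota (k \<gamma>)) ^ n"
        using k y \<gamma>(1) \<gamma>n by (simp add: G_mult G_power iota_mult iota_power norm_mult norm_power G_closed K_power)
      also have "\<dots> \<le> cmod (iota y) * a ^ n"
      proof (cases "k = e \<or> k = tau")
        case True
        have "cmod (iota (k y)) = cmod (iota y)" using True y tau(2) by auto
        moreover have "cmod (iota (k \<gamma>)) = a" using True \<gamma> by auto
        ultimately show ?thesis by simp
      next
        case False
        have "cmod (iota (k y)) \<le> Y" unfolding Y_def using finite_G k by (intro member_le_sum) auto
        moreover have "cmod (iota (k \<gamma>)) ^ n \<le> (1 / 4) ^ n"
          using False k \<gamma>(5) by (intro power_mono) auto
        ultimately have "cmod (iota (k y)) * cmod (iota (k \<gamma>)) ^ n \<le> Y * (1 / 4) ^ n"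
          by (intro mult_mono) (auto intro: order_trans[OF norm_ge_zero])
        then show ?thesis using n' by linarith
      qed
      finally show "cmod (iota (h (g (y * \<gamma> ^ n)))) \<le> cmod (iota y) * a ^ n" .
    qed
    finally show ?thesis using \<gamma>(2) by simp
  qed
  have eq: "v (g y) = cmod (iota y)" if y: "y \<in> K" for y
  proof (cases "y = 0")
    case True
    then show ?thesis using g v_eq_0[OF v K_zero] by simp
  next
    case False
    have iy: "inverse y \<in> K" using y by (rule K_inverse)
    have "g y * g (inverse y) = 1" using G_mult[OF g(1) y iy] False g(1) by simp
    then have 1: "v (g y) * v (g (inverse y)) = 1"
      using v_mult[OF v G_closed[OF g(1) y] G_closed[OF g(1) iy]] v_1[OF v] by simp
    have "iota y * iota (inverse y) = 1" using iota_mult[OF y iy] False by simp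
    then have 2: "cmod (iota y) * cmod (iota (inverse y)) = 1" by (metis norm_mult norm_one)
    have 3: "v (g (inverse y)) \<le> cmod (iota (inverse y))" using le[OF iy] False by simp
    have pos: "cmod (iota y) > 0" using y False iota_eq_0 by simp
    have "cmod (iota y) * v (g (inverse y)) \<le> v (g y) * v (g (inverse y))"
      using mult_left_mono[OF 3, of "cmod (iota y)"] 1 2 pos by simp
    moreover have "v (g (inverse y)) > 0"
      using 1 v_nonneg[OF v G_closed[OF g(1) iy]] by (metis less_eq_real_def mult_zero_right zero_neq_one)
    ultimately have "cmod (iota y) \<le> v (g y)" by simp
    then show ?thesis using le[OF y False] by simp
  qed
  obtain h where h: "h \<in> G" "\<And>x. x \<in> K \<Longrightarrow> g (h x) = x" using G_inverse[OF g(1)] by metis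
  have "v x = cmod (iota (h x))" if "x \<in> K" for x
    using eq[of "h x"] h that by (simp add: G_closed)
  then show ?thesis using h(1) by blast
qed

end

section \<open>Local degrees at archimedean places\<close>

lemma ex_rat_sequence: "\<exists>r. (\<lambda>n. real_of_rat (r n)) \<longlonglongrightarrow> a"
proof -
  have "\<exists>q. a < real_of_rat q \<and> real_of_rat q < a + 1 / real (Suc n)" for n
    by (rule of_rat_dense) simp
  then obtain r where r: "\<And>n. a < real_of_rat (r n)" "\<And>n. real_of_rat (r n) < a + 1 / real (Suc n)" by metis
  have "(\<lambda>n. a + 1 / real (Suc n)) \<longlonglongrightarrow> a + 0"
    by (intro tendsto_add tendsto_const LIMSEQ_Suc[OF lim_1_over_n])
  then have "(\<lambda>n. real_of_rat (r n)) \<longlonglongrightarrow> a"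
    by (intro tendsto_sandwich[of "\<lambda>_. a" "\<lambda>n. real_of_rat (r n)" sequentially "\<lambda>n. a + 1 / real (Suc n)"])
      (use r in \<open>auto intro!: always_eventually less_imp_le\<close>)
  then show ?thesis by blast
qed

locale archimedean_place = galois_number_field K for K :: "'a::field_char_0 set" +
  fixes h :: "'a \<Rightarrow> 'a" and v :: "'a \<Rightarrow> real"
  assumes h: "h \<in> G" and v: "\<And>x. x \<in> K \<Longrightarrow> v x = cmod (iota (h x))"
begin

section \<open>The completion, described by limits in the complex numbers\<close>

definition "phi x = iota (h x)"
definition "cauchy = cauchy_ring K v"
definition "nullseqs = null_sequences K v"
definition "compl = completion K v"
text \<open>The null sequences are the kernel of this map on Cauchy sequences. It therefore
  separates the classes, and computations in the quotient ring become computations with complex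
  limits.\<close>

definition "seq_lim s = lim (\<lambda>n. phi (s n))" for s :: "nat \<Rightarrow> 'a"

lemma phi_add: "x \<in> K \<Longrightarrow> y \<in> K \<Longrightarrow> phi (x + y) = phi x + phi y"
  and phi_mult: "x \<in> K \<Longrightarrow> y \<in> K \<Longrightarrow> phi (x * y) = phi x * phi y"
  and phi_minus: "x \<in> K \<Longrightarrow> phi (- x) = - phi x"
  and phi_rat: "phi (of_rat q) = of_real (of_rat q)"
  using h by (auto simp: phi_def G_add G_mult G_minus iota_add iota_mult iota_minus G_closed)
    (cases q, simp add: of_rat_rat)

lemma cauchy_simps [simp]:
  "mult cauchy s t = (\<lambda>n. s n * t n)" "one cauchy = (\<lambda>n. 1)" "zero cauchy = (\<lambda>n. 0)" "add cauchy s t = (\<lambda>n. s n + t n)"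
  by (simp_all add: cauchy_def cauchy_ring_def)

lemma cauchy_carrier: "s \<in> carrier cauchy \<longleftrightarrow> (\<forall>n. s n \<in> K) \<and> (\<lambda>n. phi (s n)) \<longlonglongrightarrow> seq_lim s"
proof -
  have "(\<forall>e>0. \<exists>N. \<forall>m\<ge>N. \<forall>n\<ge>N. v (s m - s n) < e) \<longleftrightarrow> Cauchy (\<lambda>n. phi (s n))" if "\<forall>n. s n \<in> K"
  proof -
    have "v (s m - s n) = dist (phi (s m)) (phi (s n))" for m n
      using that phi_add[of "s m" "- s n"] phi_minus[of "s n"]
      by (simp add: v K_diff K_minus dist_norm phi_def[symmetric])
    then show ?thesis by (simp add: Cauchy_def)
  qed
  then show ?thesis
    by (auto simp: cauchy_def cauchy_ring_def Cauchy_convergent_iff convergent_LIMSEQ_iff seq_lim_def)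
qed

lemma cauchy_carrierI: "(\<And>n. s n \<in> K) \<Longrightarrow> (\<lambda>n. phi (s n)) \<longlonglongrightarrow> z \<Longrightarrow> s \<in> carrier cauchy"
  by (auto simp: cauchy_carrier seq_lim_def dest: limI)

lemma seq_lim_eqI: "(\<lambda>n. phi (s n)) \<longlonglongrightarrow> z \<Longrightarrow> seq_lim s = z"
  unfolding seq_lim_def by (rule limI)

lemma
  assumes "s \<in> carrier cauchy" "t \<in> carrier cauchy"
  shows cauchy_add: "(\<lambda>n. s n + t n) \<in> carrier cauchy" "seq_lim (\<lambda>n. s n + t n) = seq_lim s + seq_lim t"
    and cauchy_mult: "(\<lambda>n. s n * t n) \<in> carrier cauchy" "seq_lim (\<lambda>n. s n * t n) = seq_lim s * seq_lim t"
    and cauchy_minus: "(\<lambda>n. - s n) \<in> carrier cauchy" "seq_lim (\<lambda>n. - s n) = - seq_lim s"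
proof -
  have K: "s n \<in> K" "t n \<in> K" for n using assms by (auto simp: cauchy_carrier)
  have "(\<lambda>n. phi (s n + t n)) \<longlonglongrightarrow> seq_lim s + seq_lim t" "(\<lambda>n. phi (s n * t n)) \<longlonglongrightarrow> seq_lim s * seq_lim t"
    "(\<lambda>n. phi (- s n)) \<longlonglongrightarrow> - seq_lim s"
    using assms by (auto simp: phi_add phi_mult phi_minus K cauchy_carrier intro!: tendsto_intros)
  then show "(\<lambda>n. s n + t n) \<in> carrier cauchy" "seq_lim (\<lambda>n. s n + t n) = seq_lim s + seq_lim t"
    "(\<lambda>n. s n * t n) \<in> carrier cauchy" "seq_lim (\<lambda>n. s n * t n) = seq_lim s * seq_lim t"
    "(\<lambda>n. - s n) \<in> carrier cauchy" "seq_lim (\<lambda>n. - s n) = - seq_lim s"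
    using K by (auto intro!: cauchy_carrierI seq_lim_eqI K_add K_mult K_minus)
qed

lemma cauchy_const: "x \<in> K \<Longrightarrow> (\<lambda>n. x) \<in> carrier cauchy" "seq_lim (\<lambda>n. x) = phi x"
  by (auto intro!: cauchy_carrierI seq_lim_eqI)

lemma phi_0_1: "phi 0 = 0" "phi 1 = 1"
  using phi_rat[of 0] phi_rat[of 1] by auto

lemma cauchy_cring: "cring cauchy"
proof (rule cringI)
  show "abelian_group cauchy"
  proof (rule abelian_groupI)
    fix x assume x: "x \<in> carrier cauchy"
    show "\<exists>y\<in>carrier cauchy. y \<oplus>\<^bsub>cauchy\<^esub> x = \<zero>\<^bsub>cauchy\<^esub>"
      by (rule bexI[of _ "\<lambda>n. - x n"]) (auto intro: cauchy_minus x)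
  qed (auto intro: cauchy_add cauchy_const simp: add.assoc add.commute)
  show "Group.comm_monoid cauchy"
    by (rule comm_monoidI) (auto intro: cauchy_mult cauchy_const simp: mult.assoc mult.commute)
qed (auto simp: distrib_right)

interpretation cauchy: cring cauchy by (rule cauchy_cring)

lemma cauchy_a_inv: "s \<in> carrier cauchy \<Longrightarrow> \<ominus>\<^bsub>cauchy\<^esub> s = (\<lambda>n. - s n)"
  by (rule cauchy.minus_equality) (auto intro: cauchy_minus)

lemma nullseqs_iff: "s \<in> nullseqs \<longleftrightarrow> s \<in> carrier cauchy \<and> seq_lim s = 0"
proof -
  have "(\<lambda>n. v (s n)) \<longlonglongrightarrow> 0 \<longleftrightarrow> seq_lim s = 0" if s: "s \<in> carrier cauchy"
  proof -
    have "v (s n) = norm (phi (s n))" for n using s by (auto simp: cauchy_carrier v phi_def)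
    then have "(\<lambda>n. v (s n)) \<longlonglongrightarrow> 0 \<longleftrightarrow> (\<lambda>n. phi (s n)) \<longlonglongrightarrow> 0" by (simp add: tendsto_norm_zero_iff)
    also have "\<dots> \<longleftrightarrow> seq_lim s = 0" using s by (auto simp: cauchy_carrier seq_lim_eqI)
    finally show ?thesis .
  qed
  then show ?thesis by (auto simp: nullseqs_def null_sequences_def cauchy_def)
qed

lemma nullseqs_ideal: "ideal nullseqs cauchy"
proof (rule idealI[OF cauchy.ring_axioms])
  show "subgroup nullseqs (add_monoid cauchy)"
  proof (rule subgroup.intro)
    fix x assume x: "x \<in> nullseqs"
    then have xc: "x \<in> carrier cauchy" by (simp add: nullseqs_iff)
    have "inv\<^bsub>add_monoid cauchy\<^esub> x = (\<lambda>n. - x n)" using cauchy_a_inv[OF xc] by (simp add: a_inv_def)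
    then show "inv\<^bsub>add_monoid cauchy\<^esub> x \<in> nullseqs" using x cauchy_minus[OF xc xc] by (simp add: nullseqs_iff)
  qed (auto simp: nullseqs_iff cauchy_add cauchy_const phi_0_1)
qed (auto simp: nullseqs_iff cauchy_mult)

interpretation nullseqs: ideal nullseqs cauchy by (rule nullseqs_ideal)

definition "cls s = nullseqs +>\<^bsub>cauchy\<^esub> s"

lemma compl_eq: "compl = cauchy Quot nullseqs" by (simp add: compl_def completion_def cauchy_def nullseqs_def)

interpretation compl: cring compl unfolding compl_eq by (rule nullseqs.quotient_is_cring[OF cauchy_cring])

lemma cls_eq_iff: "s \<in> carrier cauchy \<Longrightarrow> t \<in> carrier cauchy \<Longrightarrow> cls s = cls t \<longleftrightarrow> seq_lim s = seq_lim t"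
proof -
  assume st: "s \<in> carrier cauchy" "t \<in> carrier cauchy"
  have mt: "(\<lambda>n. - t n) \<in> carrier cauchy" "seq_lim (\<lambda>n. - t n) = - seq_lim t" using cauchy_minus[OF st(2,2)] by auto
  have "s \<ominus>\<^bsub>cauchy\<^esub> t = (\<lambda>n. s n + - t n)" using cauchy_a_inv[OF st(2)] by (simp add: cauchy.minus_eq)
  then have "s \<ominus>\<^bsub>cauchy\<^esub> t \<in> nullseqs \<longleftrightarrow> seq_lim s = seq_lim t"
    using cauchy_add[OF st(1) mt(1)] mt(2) by (simp add: nullseqs_iff)
  then show ?thesis using cauchy.quotient_eq_iff_same_a_r_cos[OF nullseqs_ideal st] by (simp add: cls_def)
qed

lemma compl_carrier: "carrier compl = cls ` carrier cauchy"
  by (auto simp: compl_eq FactRing_def A_RCOSETS_def' cls_def)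

lemma cls_closed: "s \<in> carrier cauchy \<Longrightarrow> cls s \<in> carrier compl" by (simp add: compl_carrier)

lemma
  assumes "s \<in> carrier cauchy" "t \<in> carrier cauchy"
  shows cls_add: "cls s \<oplus>\<^bsub>compl\<^esub> cls t = cls (\<lambda>n. s n + t n)" and cls_mult: "cls s \<otimes>\<^bsub>compl\<^esub> cls t = cls (\<lambda>n. s n * t n)"
  using ring_hom_add[OF nullseqs.rcos_ring_hom assms] ring_hom_mult[OF nullseqs.rcos_ring_hom assms]
  by (simp_all add: cls_def compl_eq)

lemma cls_one: "\<one>\<^bsub>compl\<^esub> = cls (\<lambda>n. 1)"
  using ring_hom_one[OF nullseqs.rcos_ring_hom] by (simp add: cls_def compl_eq)

lemma cls_zero: "\<zero>\<^bsub>compl\<^esub> = cls (\<lambda>n. 0)"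
  using ring_hom_zero[OF nullseqs.rcos_ring_hom cauchy.ring_axioms nullseqs.quotient_is_ring] by (simp add: cls_def compl_eq)

section \<open>The closure of the rationals in the completion\<close>

definition "compl_rat = completion_rat K v"

lemma compl_rat_iff: "q \<in> compl_rat \<longleftrightarrow> (\<exists>r. (\<lambda>n. of_rat (r n)) \<in> carrier cauchy \<and> q = cls (\<lambda>n. of_rat (r n)))"
proof
  assume "q \<in> compl_rat"
  then obtain s where s: "q = cls s" "s \<in> carrier cauchy" "range s \<subseteq> \<rat>"
    by (auto simp: compl_rat_def completion_rat_def cls_def cauchy_def nullseqs_def)
  have "\<exists>r. s n = of_rat r" for n using s(3) by (metis Rats_cases rangeI subsetD)
  then obtain r where "\<And>n. s n = of_rat (r n)" by metis
  then have "s = (\<lambda>n. of_rat (r n))" by auto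
  then show "\<exists>r. (\<lambda>n. of_rat (r n)) \<in> carrier cauchy \<and> q = cls (\<lambda>n. of_rat (r n))" using s by blast
next
  assume "\<exists>r. (\<lambda>n. of_rat (r n)) \<in> carrier cauchy \<and> q = cls (\<lambda>n. of_rat (r n))"
  then show "q \<in> compl_rat" by (auto simp: compl_rat_def completion_rat_def cls_def cauchy_def nullseqs_def)
qed

lemma compl_rat_E:
  assumes "q \<in> compl_rat"
  obtains r where "(\<lambda>n. of_rat (r n)) \<in> carrier cauchy" "q = cls (\<lambda>n. of_rat (r n))"
  using assms compl_rat_iff by blast

lemma compl_rat_I: "(\<lambda>n. of_rat (r n)) \<in> carrier cauchy \<Longrightarrow> cls (\<lambda>n. of_rat (r n)) \<in> compl_rat"
  using compl_rat_iff by blast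

text \<open>Every real number is a limit of rationals, so \<open>compl_rat\<close> plays the role of
  the real line.\<close>

lemma ex_rat_cauchy: "\<exists>r. (\<lambda>n. of_rat (r n)) \<in> carrier cauchy \<and> seq_lim (\<lambda>n. of_rat (r n)) = of_real a"
proof -
  obtain r where r: "(\<lambda>n. real_of_rat (r n)) \<longlonglongrightarrow> a" using ex_rat_sequence by blast
  then have "(\<lambda>n. phi (of_rat (r n))) \<longlonglongrightarrow> of_real a" unfolding phi_rat by (rule tendsto_of_real)
  then show ?thesis by (intro exI[of _ r] conjI cauchy_carrierI seq_lim_eqI) auto
qed

lemma compl_rat_subset: "compl_rat \<subseteq> carrier compl" by (auto elim!: compl_rat_E intro: cls_closed)

lemma compl_rat_subring: "subring compl_rat compl"
proof (rule compl.subringI[OF compl_rat_subset])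
  show "\<one>\<^bsub>compl\<^esub> \<in> compl_rat" unfolding cls_one using compl_rat_I[of "\<lambda>n. 1"] cauchy_const(1)[of 1] by simp
next
  fix q assume "q \<in> compl_rat"
  then obtain r where r: "(\<lambda>n. of_rat (r n)) \<in> carrier cauchy" "q = cls (\<lambda>n. of_rat (r n))" by (rule compl_rat_E)
  note m = cauchy_minus[OF r(1) r(1)]
  have "\<ominus>\<^bsub>compl\<^esub> q = cls (\<lambda>n. - of_rat (r n))"
  proof (rule compl.minus_equality)
    show "cls (\<lambda>n. - of_rat (r n)) \<oplus>\<^bsub>compl\<^esub> q = \<zero>\<^bsub>compl\<^esub>"
      unfolding r(2) cls_add[OF m(1) r(1)] cls_zero by simp
  qed (use r m in \<open>auto intro: cls_closed\<close>)
  then show "\<ominus>\<^bsub>compl\<^esub> q \<in> compl_rat" using compl_rat_I[of "\<lambda>n. - r n"] m(1) by (simp add: of_rat_minus)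
next
  fix p q assume "p \<in> compl_rat" "q \<in> compl_rat"
  then obtain r t where r: "(\<lambda>n. of_rat (r n)) \<in> carrier cauchy" "p = cls (\<lambda>n. of_rat (r n))"
    and t: "(\<lambda>n. of_rat (t n)) \<in> carrier cauchy" "q = cls (\<lambda>n. of_rat (t n))" by (metis compl_rat_E)
  show "p \<otimes>\<^bsub>compl\<^esub> q \<in> compl_rat" unfolding r(2) t(2) cls_mult[OF r(1) t(1)]
    using compl_rat_I[of "\<lambda>n. r n * t n"] cauchy_mult[OF r(1) t(1)] by (simp add: of_rat_mult)
  show "p \<oplus>\<^bsub>compl\<^esub> q \<in> compl_rat" unfolding r(2) t(2) cls_add[OF r(1) t(1)]
    using compl_rat_I[of "\<lambda>n. r n + t n"] cauchy_add[OF r(1) t(1)] by (simp add: of_rat_add)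
qed

lemma seq_lim_rat_real: "(\<lambda>n. of_rat (r n)) \<in> carrier cauchy \<Longrightarrow> \<exists>a. seq_lim (\<lambda>n. of_rat (r n)) = of_real a"
proof -
  assume "(\<lambda>n. of_rat (r n)) \<in> carrier cauchy"
  then have "(\<lambda>n. complex_of_real (of_rat (r n))) \<longlonglongrightarrow> seq_lim (\<lambda>n. of_rat (r n))" by (simp add: cauchy_carrier phi_rat)
  then have "(\<lambda>n. Im (complex_of_real (of_rat (r n)))) \<longlonglongrightarrow> Im (seq_lim (\<lambda>n. of_rat (r n)))" by (rule tendsto_Im)
  then have "Im (seq_lim (\<lambda>n. of_rat (r n))) = 0" by (simp add: LIMSEQ_const_iff)
  then show ?thesis by (metis complex_is_Real_iff Reals_cases)
qed

text \<open>A nonzero class has a nonzero real limit \<open>a\<close>, and its inverse is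
  represented by any rational sequence tending to \<open>inverse a\<close>. This avoids inverting a
  sequence that may have zero terms.\<close>

lemma compl_rat_subfield: "subfield compl_rat compl"
proof (rule compl.subfieldI)
  show "subcring compl_rat compl" by (rule compl.subcringI'[OF compl_rat_subring])
  have one0: "\<one>\<^bsub>compl\<^esub> \<noteq> \<zero>\<^bsub>compl\<^esub>"
    unfolding cls_one cls_zero using cauchy_const by (simp add: cls_eq_iff phi_0_1)
  show "Units (compl\<lparr>carrier := compl_rat\<rparr>) = compl_rat - {\<zero>\<^bsub>compl\<^esub>}"
  proof (intro equalityI subsetI)
    fix q assume "q \<in> Units (compl\<lparr>carrier := compl_rat\<rparr>)"
    then obtain p where p: "q \<in> compl_rat" "p \<in> compl_rat" "p \<otimes>\<^bsub>compl\<^esub> q = \<one>\<^bsub>compl\<^esub>" by (auto simp: Units_def)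
    then have "q \<noteq> \<zero>\<^bsub>compl\<^esub>" using one0 compl_rat_subset by auto
    then show "q \<in> compl_rat - {\<zero>\<^bsub>compl\<^esub>}" using p by simp
  next
    fix q assume q: "q \<in> compl_rat - {\<zero>\<^bsub>compl\<^esub>}"
    then obtain r where r: "(\<lambda>n. of_rat (r n)) \<in> carrier cauchy" "q = cls (\<lambda>n. of_rat (r n))" by (auto elim: compl_rat_E)
    obtain a where a: "seq_lim (\<lambda>n. of_rat (r n)) = of_real a" using seq_lim_rat_real[OF r(1)] by blast
    have "a \<noteq> 0"
    proof
      assume "a = 0"
      then have "q = \<zero>\<^bsub>compl\<^esub>" unfolding r(2) cls_zero using r(1) a cauchy_const by (simp add: cls_eq_iff phi_0_1)
      then show False using q by simp
    qed
    obtain t where t: "(\<lambda>n. of_rat (t n)) \<in> carrier cauchy" "seq_lim (\<lambda>n. of_rat (t n)) = of_real (inverse a)"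
      using ex_rat_cauchy by blast
    have "cls (\<lambda>n. of_rat (t n)) \<otimes>\<^bsub>compl\<^esub> q = \<one>\<^bsub>compl\<^esub>"
      unfolding r(2) cls_mult[OF t(1) r(1)] cls_one
      using cauchy_mult[OF t(1) r(1)] t(2) a \<open>a \<noteq> 0\<close> cauchy_const(1)[of 1] cauchy_const(2)[of 1]
      by (subst cls_eq_iff) (auto simp: phi_0_1)
    moreover have tF: "cls (\<lambda>n. of_rat (t n)) \<in> compl_rat" using t by (intro compl_rat_I)
    moreover have "q \<otimes>\<^bsub>compl\<^esub> cls (\<lambda>n. of_rat (t n)) = cls (\<lambda>n. of_rat (t n)) \<otimes>\<^bsub>compl\<^esub> q"
      using q tF compl_rat_subset by (intro compl.m_comm) auto
    ultimately show "q \<in> Units (compl\<lparr>carrier := compl_rat\<rparr>)" using q by (auto simp: Units_def)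
  qed
qed

text \<open>If some \<open>phi c\<close> is not real, then 1 and \<open>phi c\<close> span the plane
  over the reals; otherwise all limits are real and \<open>c = 0\<close> serves.\<close>

lemma ex_plane_generator:
  "\<exists>c\<in>K. \<forall>s\<in>carrier cauchy. \<exists>a b. seq_lim s = of_real a * phi c + of_real b"
proof (cases "\<exists>c\<in>K. Im (phi c) \<noteq> 0")
  case True
  then obtain c where c: "c \<in> K" "Im (phi c) \<noteq> 0" by blast
  have "seq_lim s = of_real (Im (seq_lim s) / Im (phi c)) * phi c +
      of_real (Re (seq_lim s) - Im (seq_lim s) / Im (phi c) * Re (phi c))" for s
    using c(2) by (simp add: complex_eq_iff)
  then show ?thesis using c(1) by blast
next
  case False
  have "\<exists>b. seq_lim s = of_real b" if s: "s \<in> carrier cauchy" for s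
  proof -
    have "(\<lambda>n. Im (phi (s n))) \<longlonglongrightarrow> Im (seq_lim s)" using s by (intro tendsto_Im) (simp add: cauchy_carrier)
    moreover have "Im (phi (s n)) = 0" for n using False s by (auto simp: cauchy_carrier)
    ultimately have "Im (seq_lim s) = 0" by (simp add: LIMSEQ_const_iff)
    then show ?thesis by (metis complex_is_Real_iff Reals_cases)
  qed
  then show ?thesis by (intro bexI[of _ 0]) (auto simp: phi_0_1)
qed

text \<open>The class \<open>u\<close> of the constant sequence \<open>c\<close> and the class of 1
  span the completion over \<open>compl_rat\<close>; the dimension is 1 or 2 according to whether
  \<open>u\<close> lies in \<open>compl_rat\<close>.\<close>

lemma local_degree_le_2: "local_degree K v \<le> 2"
proof -
  obtain c where c: "c \<in> K" "\<And>s. s \<in> carrier cauchy \<Longrightarrow> \<exists>a b. seq_lim s = of_real a * phi c + of_real b"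
    using ex_plane_generator by blast
  define u where "u = cls (\<lambda>n. c)"
  have cC: "(\<lambda>n. c) \<in> carrier cauchy" "seq_lim (\<lambda>n. c) = phi c" using cauchy_const(1)[OF c(1)] cauchy_const(2)[of c] by auto
  have uQ: "u \<in> carrier compl" unfolding u_def by (rule cls_closed[OF cC(1)])
  have ext: "carrier compl = compl.line_extension compl_rat u compl_rat"
  proof (intro equalityI subsetI)
    fix q assume "q \<in> carrier compl"
    then obtain s where s: "s \<in> carrier cauchy" "q = cls s" by (auto simp: compl_carrier)
    obtain a b where ab: "seq_lim s = of_real a * phi c + of_real b" using c(2)[OF s(1)] by blast
    obtain r where r: "(\<lambda>n. of_rat (r n)) \<in> carrier cauchy" "seq_lim (\<lambda>n. of_rat (r n)) = of_real a" using ex_rat_cauchy by blast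
    obtain t where t: "(\<lambda>n. of_rat (t n)) \<in> carrier cauchy" "seq_lim (\<lambda>n. of_rat (t n)) = of_real b" using ex_rat_cauchy by blast
    note m = cauchy_mult[OF r(1) cC(1)]
    note p = cauchy_add[OF m(1) t(1)]
    have "q = cls (\<lambda>n. of_rat (r n)) \<otimes>\<^bsub>compl\<^esub> u \<oplus>\<^bsub>compl\<^esub> cls (\<lambda>n. of_rat (t n))"
      unfolding u_def cls_mult[OF r(1) cC(1)] cls_add[OF m(1) t(1)] s(2) cls_eq_iff[OF s(1) p(1)]
      by (simp add: p(2) m(2) r(2) t(2) cC(2) ab)
    then show "q \<in> compl.line_extension compl_rat u compl_rat" unfolding compl.line_extension_mem_iff
      using compl_rat_I[OF r(1)] compl_rat_I[OF t(1)] by blast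
  next
    fix q assume "q \<in> compl.line_extension compl_rat u compl_rat"
    then show "q \<in> carrier compl" unfolding compl.line_extension_mem_iff using compl_rat_subset uQ by auto
  qed
  have one: "compl.dimension 1 compl_rat compl_rat" using compl.dimension_one[OF compl_rat_subfield] .
  have "\<exists>n\<le>2. compl.dimension n compl_rat (carrier compl)"
  proof (cases "u \<in> compl_rat")
    case True
    have "carrier compl = compl_rat"
    proof
      show "carrier compl \<subseteq> compl_rat" unfolding ext
      proof
        fix q assume "q \<in> compl.line_extension compl_rat u compl_rat"
        then show "q \<in> compl_rat" unfolding compl.line_extension_mem_iff
          using True subringE(6,7)[OF compl_rat_subring] by blast
      qed
    qed (rule compl_rat_subset)
    then show ?thesis using one by (intro exI[of _ 1]) auto
  next
    case False
    have "compl.dimension (Suc 1) compl_rat (compl.line_extension compl_rat u compl_rat)"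
      by (rule compl.Suc_dim[OF uQ False one])
    then show ?thesis using ext by (intro exI[of _ 2]) (auto simp: numeral_2_eq_2)
  qed
  then obtain n where n: "n \<le> 2" "compl.dimension n compl_rat (carrier compl)" by blast
  have "compl.dim compl_rat (carrier compl) = n" using compl.dimI[OF compl_rat_subfield n(2)] by (simp add: over_def)
  then show ?thesis using n(1) by (simp add: local_degree_def compl_def compl_rat_def)
qed

end

section \<open>The height bound\<close>

context galois_number_field_ge_2
begin

lemma weil_height_le:
  assumes x: "x \<in> OK" and M: "M \<ge> 1" and le: "\<And>g. g \<in> G \<Longrightarrow> cmod (iota (g x)) \<le> M"
  shows "weil_height K x \<le> M ^ 2"
proof -
  have xK: "x \<in> K" using x by (simp add: OK_iff)
  define S where "S = {v \<in> places K. max 1 (v x) \<noteq> 1}"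
  \<comment> \<open>Several \<open>h\<close> may induce the same place; an upper bound for the
    number of places is enough, since each factor is at most \<open>M powr (2 / real d)\<close>,
    which is at least 1.\<close>
  define A where "A = (\<lambda>h. restrict (\<lambda>x. cmod (iota (h x))) K) ` G"
  have S_A: "S \<subseteq> A"
  proof
    fix v assume "v \<in> S"
    then have v: "v \<in> extensional K" "absolute_value_on K v" "v x > 1"
      and cases: "(\<forall>q. v (of_rat q) = real_of_rat \<bar>q\<bar>) \<or> (\<exists>p. prime p \<and> (\<forall>q. v (of_rat q) = padic_abs p q))"
      by (auto simp: S_def places_def max_def split: if_splits)
    have "\<forall>q. v (of_rat q) = real_of_rat \<bar>q\<bar>"
    proof (rule ccontr)
      assume "\<not> ?thesis"
      then obtain p where "prime p" "\<forall>q. v (of_rat q) = padic_abs p q" using cases by blast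
      then have "v x \<le> 1" by (intro nonarchimedean_integer_le_1[OF v(2) _ _ x]) auto
      then show False using v(3) by simp
    qed
    then obtain h where h: "h \<in> G" "\<forall>x\<in>K. v x = cmod (iota (h x))"
      using archimedean_place_embedding[OF v(2)] by blast
    have "v = restrict (\<lambda>x. cmod (iota (h x))) K"
      using v(1) h(2) by (intro extensionalityI[of _ K]) auto
    then show "v \<in> A" using h(1) by (auto simp: A_def)
  qed
  have finA: "finite A" and cardA: "card A \<le> d"
    using finite_G card_image_le[OF finite_G] by (auto simp: A_def card_G[symmetric])
  have factor: "max 1 (v x) powr (real (local_degree K v) / real d) \<le> M powr (2 / real d)" if vS: "v \<in> S" for v
  proof -
    obtain h where hv: "h \<in> G" "v = restrict (\<lambda>x. cmod (iota (h x))) K"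
      using subsetD[OF S_A vS] by (auto simp: A_def)
    interpret archimedean_place K h v by unfold_locales (use hv in auto)
    have ld: "real (local_degree K v) / real d \<le> 2 / real d"
      using local_degree_le_2 by (intro divide_right_mono) auto
    have "v x \<le> M" using le[OF hv(1)] xK by (simp add: hv(2))
    then have "max 1 (v x) powr (real (local_degree K v) / real d) \<le> M powr (real (local_degree K v) / real d)"
      using M by (intro powr_mono2) auto
    also have "\<dots> \<le> M powr (2 / real d)" using ld M by (rule powr_mono)
    finally show ?thesis .
  qed
  have "weil_height K x = (\<Prod>v\<in>S. max 1 (v x) powr (real (local_degree K v) / real d))"
    by (simp add: weil_height_def S_def)
  also have "\<dots> \<le> (\<Prod>v\<in>S. M powr (2 / real d))" using factor by (intro prod_mono) auto
  also have "\<dots> = (M powr (2 / real d)) ^ card S" by simp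
  also have "\<dots> \<le> (M powr (2 / real d)) ^ d"
    using M card_mono[OF finA S_A] cardA by (intro power_increasing ge_one_powr_ge_zero) auto
  also have "\<dots> = M powr (2 / real d * real d)"
    using M by (subst powr_powr[symmetric]) (simp add: powr_realpow)
  also have "2 / real d * real d = 2" using d_pos by simp
  also have "M powr 2 = M ^ 2" using M by simp
  finally show ?thesis .
qed

lemma weil_height_conjugate_beta_le:
  assumes g: "g \<in> G" shows "weil_height K (g beta) \<le> small_bound ^ 2"
proof (rule weil_height_le[OF _ small_bound_ge_1])
  show "g beta \<in> OK" using beta(1) g by (auto simp: OK_iff G_closed intro: algebraic_int_G)
  fix h assume h: "h \<in> G"
  have "cmod (iota (compose K h g beta)) \<le> small_bound"
    by (rule cmod_beta_le[OF G_compose[OF h g]])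
  then show "cmod (iota (h (g beta))) \<le> small_bound" by (simp add: compose_eq beta_K)
qed

text \<open>The numerical factor 16 (2d)^(2d-2) equals 2^(2d+2) d^(2d-2), and
  \<open>d \<ge> 2\<close> bounds it by d^(4d). The other factors of the target are at least 1, and
  the exponent of the discriminant is at least 1.\<close>

lemma small_bound_square_le:
  "small_bound ^ 2 \<le> real d ^ (4 * d) * (real d ^ 2 - real d + 2) ^ (4 * d - 3) / 2 ^ (4 * d - 3)
     * real ((d - 1) choose ((d - 1) div 2)) ^ 2
     * real_of_rat \<bar>field_discriminant K\<bar> ^ ((d - 1) * (4 * d - 3))"
proof -
  define D where "D = real_of_rat \<bar>field_discriminant K\<bar>"
  have D: "D \<ge> 1" unfolding D_def by (rule abs_discriminant_ge_1)
  have "small_bound ^ 2 = 16 * (2 * real d) ^ (2 * (d - 1)) * D"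
    using D by (simp add: small_bound_def D_def[symmetric] power_mult_distrib power_mult[symmetric] mult.commute)
  also have "16 * (2 * real d) ^ (2 * (d - 1)) = 2 ^ (2 * d + 2) * real d ^ (2 * d - 2)"
  proof -
    have e: "2 * (d - 1) = 2 * d - 2" "2 * d + 2 = (2 * d - 2) + 4" using d_ge_2 by auto
    show ?thesis unfolding e by (simp add: power_mult_distrib power_add)
  qed
  also have "\<dots> \<le> real d ^ (2 * d + 2) * real d ^ (2 * d - 2)"
    using d_ge_2 by (intro mult_right_mono power_mono) auto
  also have "\<dots> = real d ^ (4 * d)"
  proof -
    have "2 * d + 2 + (2 * d - 2) = 4 * d" using d_ge_2 by simp
    then show ?thesis unfolding power_add[symmetric] by (rule arg_cong)
  qed
  finally have 1: "small_bound ^ 2 \<le> real d ^ (4 * d) * D" using D by simp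
  have "real d * (real d - 1) \<ge> 0" using d_ge_2 by simp
  then have "((real d ^ 2 - real d + 2) / 2) ^ (4 * d - 3) \<ge> 1"
    by (intro one_le_power) (simp add: power2_eq_square algebra_simps)
  then have 2: "(real d ^ 2 - real d + 2) ^ (4 * d - 3) / 2 ^ (4 * d - 3) \<ge> 1"
    by (simp add: power_divide)
  have "real ((d - 1) choose ((d - 1) div 2)) \<ge> 1"
    by (simp add: Suc_le_eq)
  then have 3: "real ((d - 1) choose ((d - 1) div 2)) ^ 2 \<ge> 1" by (rule one_le_power)
  have "D ^ 1 \<le> D ^ ((d - 1) * (4 * d - 3))"
    using D d_ge_2 by (intro power_increasing) (auto simp: Suc_le_eq)
  then have 4: "D \<le> D ^ ((d - 1) * (4 * d - 3))" by simp
  have "a * 1 * 1 * D \<le> a * b * c * D'" if "a \<ge> 0" "b \<ge> 1" "c \<ge> 1" "D \<le> D'" for a b c D' :: real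
    using that D by (intro mult_mono order_refl mult_nonneg_nonneg) auto
  from this[OF _ 2 3 4, of "real d ^ (4 * d)"] show ?thesis using 1 unfolding D_def by simp
qed

end

theorem theorem1p2:
  fixes K :: "'a::field_char_0 set" and d :: nat
  assumes "galois_over_rat K" and "field_degree K = d" and "d \<ge> 2"
  shows "\<exists>\<beta>. normal_basis K \<beta> \<and>
    (\<forall>i\<in>{1..d}. weil_height K (\<beta> i) \<le>
       real d ^ (4 * d) * (real d ^ 2 - real d + 2) ^ (4 * d - 3) / 2 ^ (4 * d - 3)
       * real ((d - 1) choose ((d - 1) div 2)) ^ 2
       * real_of_rat \<bar>field_discriminant K\<bar> ^ ((d - 1) * (4 * d - 3)))"
proof -
  interpret galois_number_field_ge_2 K
    using assms by unfold_locales auto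
  have "weil_height K (enum (i - 1) beta) \<le> small_bound ^ 2" if "i \<in> {1..d}" for i
    using that assms(2) by (intro weil_height_conjugate_beta_le enum_G) auto
  then have "\<forall>i\<in>{1..d}. weil_height K (enum (i - 1) beta) \<le>
       real d ^ (4 * d) * (real d ^ 2 - real d + 2) ^ (4 * d - 3) / 2 ^ (4 * d - 3)
       * real ((d - 1) choose ((d - 1) div 2)) ^ 2
       * real_of_rat \<bar>field_discriminant K\<bar> ^ ((d - 1) * (4 * d - 3))"
    using small_bound_square_le unfolding assms(2) by (intro ballI) (rule order_trans)
  then show ?thesis using normal_basis_beta by blast
qed

end
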